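(* Let $D$ be an integral domain in the class $\mathcal{D}$ (or in the class $\mathcal{C}$), and let $A$ be a $D$-algebra. The following conditions are equivalent. (1) $A$ is a WPC $D$-algebra. (2) $a^{N(\mathfrak{p})}\equiv a\pmod{\mathfrak{p}A}$ for all $a\in A$ and for every $t$-maximal ideal $\mathfrak{p}$ of $D$ of finite norm $N(\mathfrak{p})$. (3) $a^q\equiv a\pmod{\Pi_qA}$ for all $a\in A$ and for every prime power $q$. Moreover, if $D$ is in the class $\mathcal{C}$, then conditions (1), (2), and (3) are equivalent to the following. (4) $A$ is isomorphic as a $D$-algebra to a quotient of $\operatorname{Int}(D^{\mathbf{X}})$ for some set $\mathbf{X}$.
   Context: All rings and algebras are commutative with identity. Let $D$ be an integral domain with quotient field $K$. $\operatorname{Int}(D)=\{f\in K[X]: f(D)\subseteq D\}$, and for a set $\mathbf{X}$ of variables, $\operatorname{Int}(D^{\mathbf{X}})=\{f\in K[\mathbf{X}]: f(D^{\mathbf{X}})\subseteq D\}$. A $D$-algebra $A$ is weakly polynomially complete (WPC) if for every $a\in A$ there is a $D$-algebra homomorphism $\operatorname{Int}(D)\to A$ sending $X$ to $a$. $f^{\circ k}$ denotes $k$-fold composition, with $f^{\circ 0}=X$. For a nonzero fractional ideal $I$ of $D$, $I^{-1}=\{x\in K: xI\subseteq D\}$, $I_v=(I^{-1})^{-1}$, and $I_t=\bigcup J_v$ over the nonzero finitely generated $J\subseteq I$; $I$ is a $t$-ideal if $I_t=I$. A $t$-maximal ideal of $D$ is an ideal maximal among the nonzero proper ideals of $D$ that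 are $t$-ideals. The norm of an ideal $\mathfrak{a}$ is $N(\mathfrak{a})=|D/\mathfrak{a}|$. $\Pi_q=\Pi_q(D)$ is the intersection of all $t$-maximal ideals of $D$ of norm $q$ (equal to $D$ if there are none). $D$ is polynomially L-regular if $S^{-1}\operatorname{Int}(D)=\operatorname{Int}(S^{-1}D)$ for every multiplicative subset $S$ of $D$ (with $0\notin S$). The class $\mathcal{C}$ consists of the integral domains $D$ such that: ($\mathcal{C}1$) $D$ is polynomially L-regular; ($\mathcal{C}2$) for any nonnegative integer $n$ there exist only finitely many $t$-maximal ideals $\mathfrak{p}$ of $D$ with $N(\mathfrak{p})\le n$; ($\mathcal{C}3$) $\Pi_q$ is principal for every prime power $q$; ($\mathcal{C}4$) every $t$-maximal ideal of $D$ of finite norm has finite height. The class $\mathcal{D}$ consists of the integral domains $D$ such that $\Pi_q=\pi_qD$ is principal (with $\pi_q\ne 0$) for every prime power $q$ and such that, with $F_q=\frac{X^q-X}{\pi_q}\in\operatorname{Int}(D)$, the $D$-algebra homomorphism $D[\{X,X_{q,k}: q\text{ a prime power},\ k\in\mathbb{Z}_{\ge0}\}]\to\operatorname{Int}(D)$ sending $X\mapsto X$ and $X_{q,k}\mapsto F_q^{\circ k}$ is surjective with kernel generated by $X_{q,0}-X$ and $X_{q,k}^q-X_{q,k}-\pi_qX_{q,k+1}$ for all $q,k$. One has $\mathcal{C}\subseteq\mathcal{D}$. *)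

theory Defs
  imports
    "HOL-Algebra.Module"
    "HOL-Algebra.QuotRing"
    "HOL-Computational_Algebra.Polynomial"
    "HOL-Library.Poly_Mapping"
    "HOL-Library.Extended_Nat"
    "HOL-Number_Theory.Prime_Powers"
begin

section \<open>Domains inside their quotient field, and algebras over them\<close>

text \<open>
  The quotient field is a field type \<open>'k\<close>, and the domain \<open>D\<close> is a subset of it. Rings and
  algebras as objects are records of HOL-Algebra; those built from a type-class ring use its
  operations. The locale \<^locale>\<open>algebra\<close> of HOL-Algebra is that of commutative algebras
  with identity, the zero algebra included.
\<close>

definition ring_on :: "'r::comm_ring_1 set \<Rightarrow> 'r ring" where
  "ring_on S = \<lparr>carrier = S, monoid.mult = (*), one = 1, zero = 0, add = (+)\<rparr>"

definition algebra_on :: "('k \<Rightarrow> 'r \<Rightarrow> 'r) \<Rightarrow> 'r::comm_ring_1 set \<Rightarrow> ('k, 'r) module" where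
  "algebra_on s S = \<lparr>carrier = S, monoid.mult = (*), one = 1, zero = 0, add = (+), module.smult = s\<rparr>"

definition domain_with_quotient_field :: "'k::field set \<Rightarrow> bool" where
  "domain_with_quotient_field D \<longleftrightarrow>
     domain (ring_on D) \<and> (\<forall>x. \<exists>a\<in>D. \<exists>b\<in>D. b \<noteq> 0 \<and> x = a / b)"

definition algebra_hom ::
  "('k, 'm) ring_scheme \<Rightarrow> ('k, 'a, 'n) module_scheme \<Rightarrow> ('k, 'b, 'o) module_scheme
     \<Rightarrow> ('a \<Rightarrow> 'b) set" where
  "algebra_hom R A B =
     {h \<in> ring_hom A B. \<forall>r\<in>carrier R. \<forall>a\<in>carrier A. h (r \<odot>\<^bsub>A\<^esub> a) = r \<odot>\<^bsub>B\<^esub> h a}"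

definition algebra_isomorphic ::
  "('k, 'm) ring_scheme \<Rightarrow> ('k, 'a, 'n) module_scheme \<Rightarrow> ('k, 'b, 'o) module_scheme \<Rightarrow> bool" where
  "algebra_isomorphic R A B \<longleftrightarrow>
     (\<exists>h\<in>algebra_hom R A B. bij_betw h (carrier A) (carrier B))"

text \<open>The ring \<open>A Quot I\<close> with the scalar multiplication \<open>r (I + a) = I + r a\<close>.\<close>

definition quotient_algebra ::
  "('k, 'a, 'm) module_scheme \<Rightarrow> 'a set \<Rightarrow> ('k, 'a set) module" where
  "quotient_algebra A I =
     \<lparr>carrier = carrier (A Quot I), monoid.mult = monoid.mult (A Quot I), one = monoid.one (A Quot I),
      zero = ring.zero (A Quot I), add = ring.add (A Quot I),
      module.smult = (\<lambda>r C. \<Union>a\<in>C. I +>\<^bsub>A\<^esub> (r \<odot>\<^bsub>A\<^esub> a))\<rparr>"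

text \<open>The extension \<open>I A\<close> of an ideal \<open>I\<close> of the base ring to the algebra \<open>A\<close>.\<close>

definition extended_ideal :: "'k set \<Rightarrow> ('k, 'a, 'm) module_scheme \<Rightarrow> 'a set" where
  "extended_ideal I A = genideal A {r \<odot>\<^bsub>A\<^esub> a |r a. r \<in> I \<and> a \<in> carrier A}"


section \<open>The t-operation\<close>

definition ideal_inverse :: "'k::field set \<Rightarrow> 'k set \<Rightarrow> 'k set" where
  "ideal_inverse D I = {x. \<forall>y\<in>I. x * y \<in> D}"

definition v_closure :: "'k::field set \<Rightarrow> 'k set \<Rightarrow> 'k set" where
  "v_closure D I = ideal_inverse D (ideal_inverse D I)"

definition finitely_generated :: "'k::field set \<Rightarrow> 'k set \<Rightarrow> bool" where
  "finitely_generated D J \<longleftrightarrow>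
     (\<exists>F. finite F \<and> J = {\<Sum>x\<in>F. c x * x |c. \<forall>x\<in>F. c x \<in> D})"

definition t_closure :: "'k::field set \<Rightarrow> 'k set \<Rightarrow> 'k set" where
  "t_closure D I =
     \<Union> (v_closure D ` {J. finitely_generated D J \<and> J \<noteq> {0} \<and> J \<subseteq> I})"

text \<open>The nonzero proper ideals of \<open>D\<close> that are t-ideals, and the maximal ones among them.\<close>

definition proper_t_ideal :: "'k::field set \<Rightarrow> 'k set \<Rightarrow> bool" where
  "proper_t_ideal D I \<longleftrightarrow> ideal I (ring_on D) \<and> I \<noteq> {0} \<and> I \<noteq> D \<and> t_closure D I = I"

definition t_maximal :: "'k::field set \<Rightarrow> 'k set \<Rightarrow> bool" where
  "t_maximal D p \<longleftrightarrow>
     proper_t_ideal D p \<and> (\<forall>I. proper_t_ideal D I \<and> p \<subseteq> I \<longrightarrow> I = p)"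

text \<open>The second definition is the norm only for ideals of finite norm: \<^const>\<open>card\<close> sends
  infinite sets to 0.\<close>

definition finite_norm :: "'k::field set \<Rightarrow> 'k set \<Rightarrow> bool" where
  "finite_norm D I \<longleftrightarrow> finite (carrier (ring_on D Quot I))"

definition ideal_norm :: "'k::field set \<Rightarrow> 'k set \<Rightarrow> nat" where
  "ideal_norm D I = card (carrier (ring_on D Quot I))"

definition Pi_ideal :: "'k::field set \<Rightarrow> nat \<Rightarrow> 'k set" where
  "Pi_ideal D q = D \<inter> \<Inter> {p. t_maximal D p \<and> finite_norm D p \<and> ideal_norm D p = q}"

text \<open>The height of a prime ideal, as the supremum of the lengths of the chains
  \<open>P 0 \<subset> \<dots> \<subset> P n = p\<close> of prime ideals. (The t-maximal ideals are prime.)\<close>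

definition height :: "'k::field set \<Rightarrow> 'k set \<Rightarrow> enat" where
  "height D p =
     Sup {enat n |n. \<exists>P::nat \<Rightarrow> 'k set. (\<forall>i\<le>n. primeideal (P i) (ring_on D)) \<and>
                       (\<forall>i<n. P i \<subset> P (Suc i)) \<and> P n = p}"


section \<open>Integer-valued polynomials\<close>

definition Int_poly :: "'k::field set \<Rightarrow> 'k poly set" where
  "Int_poly D = {f. \<forall>x\<in>D. poly f x \<in> D}"

definition Int_algebra :: "'k::field set \<Rightarrow> ('k, 'k poly) module" where
  "Int_algebra D = algebra_on Polynomial.smult (Int_poly D)"

definition WPC :: "'k::field set \<Rightarrow> ('k, 'a, 'm) module_scheme \<Rightarrow> bool" where
  "WPC D A \<longleftrightarrow>
     (\<forall>a\<in>carrier A. \<exists>h\<in>algebra_hom (ring_on D) (Int_algebra D) A. h [:0, 1:] = a)"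

text \<open>Polynomials in variables of type \<open>'x\<close>: a monomial is a finitely supported exponent
  function, a polynomial is a finitely supported coefficient function on monomials, and the
  ring structure is that of \<^theory>\<open>HOL-Library.Poly_Mapping\<close>.\<close>

type_synonym ('x, 'k) mpoly = "('x \<Rightarrow>\<^sub>0 nat) \<Rightarrow>\<^sub>0 'k"

definition mpoly_const :: "'k::field \<Rightarrow> ('x, 'k) mpoly" where
  "mpoly_const c = Poly_Mapping.single 0 c"

definition mpoly_var :: "'x \<Rightarrow> ('x, 'k::field) mpoly" where
  "mpoly_var x = Poly_Mapping.single (Poly_Mapping.single x 1) 1"

definition mpoly_vars :: "('x, 'k::field) mpoly \<Rightarrow> 'x set" where
  "mpoly_vars f = (\<Union>m\<in>Poly_Mapping.keys f. Poly_Mapping.keys m)"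

text \<open>Evaluation at \<open>v\<close>, with \<open>\<phi>\<close> applied to the coefficients.\<close>

definition mpoly_eval ::
  "('k::field \<Rightarrow> 'r::comm_ring_1) \<Rightarrow> ('x \<Rightarrow> 'r) \<Rightarrow> ('x, 'k) mpoly \<Rightarrow> 'r" where
  "mpoly_eval \<phi> v f =
     (\<Sum>m\<in>Poly_Mapping.keys f. \<phi> (Poly_Mapping.lookup f m) *
        (\<Prod>x\<in>Poly_Mapping.keys m. v x ^ Poly_Mapping.lookup m x))"

definition mpoly_smult :: "'k::field \<Rightarrow> ('x, 'k) mpoly \<Rightarrow> ('x, 'k) mpoly" where
  "mpoly_smult c f = mpoly_const c * f"

definition mpoly_algebra :: "'k::field set \<Rightarrow> 'x set \<Rightarrow> ('k, ('x, 'k) mpoly) module" where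
  "mpoly_algebra D X =
     algebra_on mpoly_smult {f. mpoly_vars f \<subseteq> X \<and> (\<forall>m. Poly_Mapping.lookup f m \<in> D)}"

definition Int_algebra_mv :: "'k::field set \<Rightarrow> 'x set \<Rightarrow> ('k, ('x, 'k) mpoly) module" where
  "Int_algebra_mv D X =
     algebra_on mpoly_smult
       {f. mpoly_vars f \<subseteq> X \<and> (\<forall>v. (\<forall>x\<in>X. v x \<in> D) \<longrightarrow> mpoly_eval (\<lambda>c. c) v f \<in> D)}"


section \<open>Polynomial L-regularity and the two classes of domains\<close>

definition localization :: "'k::field set \<Rightarrow> 'k set \<Rightarrow> 'k set" where
  "localization S D = {a / s |a s. a \<in> D \<and> s \<in> S}"

definition polynomially_L_regular :: "'k::field set \<Rightarrow> bool" where
  "polynomially_L_regular D \<longleftrightarrow>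
     (\<forall>S. submonoid S (ring_on D) \<and> 0 \<notin> S \<longrightarrow>
        {Polynomial.smult (1 / s) f |s f. s \<in> S \<and> f \<in> Int_poly D} =
        Int_poly (localization S D))"

definition class_C :: "'k::field set \<Rightarrow> bool" where
  "class_C D \<longleftrightarrow>
     polynomially_L_regular D \<and>
     (\<forall>n. finite {p. t_maximal D p \<and> finite_norm D p \<and> ideal_norm D p \<le> n}) \<and>
     (\<forall>q. primepow q \<longrightarrow> principalideal (Pi_ideal D q) (ring_on D)) \<and>
     (\<forall>p. t_maximal D p \<and> finite_norm D p \<longrightarrow> height D p \<noteq> \<infinity>)"

definition F_poly :: "'k::field \<Rightarrow> nat \<Rightarrow> 'k poly" where
  "F_poly \<pi> q = Polynomial.smult (1 / \<pi>) ([:0, 1:] ^ q - [:0, 1:])"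

definition poly_iterate :: "'k::field poly \<Rightarrow> nat \<Rightarrow> 'k poly" where
  "poly_iterate f k = ((\<lambda>g. pcompose f g) ^^ k) [:0, 1:]"

text \<open>The variables \<open>X\<close> and \<open>X\<^sub>q\<^sub>,\<^sub>k\<close>; only those with \<open>q\<close> a prime power are used.\<close>

datatype gen_var = VX | VQ nat nat

definition gen_vars :: "gen_var set" where
  "gen_vars = {VX} \<union> {VQ q k |q k. primepow q}"

fun gen_image :: "(nat \<Rightarrow> 'k::field) \<Rightarrow> gen_var \<Rightarrow> 'k poly" where
  "gen_image \<pi> VX = [:0, 1:]"
| "gen_image \<pi> (VQ q k) = poly_iterate (F_poly (\<pi> q) q) k"

definition gen_hom :: "(nat \<Rightarrow> 'k::field) \<Rightarrow> (gen_var, 'k) mpoly \<Rightarrow> 'k poly" where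
  "gen_hom \<pi> = mpoly_eval (\<lambda>c. [:c:]) (gen_image \<pi>)"

definition gen_relations :: "(nat \<Rightarrow> 'k::field) \<Rightarrow> (gen_var, 'k) mpoly set" where
  "gen_relations \<pi> =
     {mpoly_var (VQ q 0) - mpoly_var VX |q. primepow q} \<union>
     {mpoly_var (VQ q k) ^ q - mpoly_var (VQ q k) - mpoly_const (\<pi> q) * mpoly_var (VQ q (Suc k))
       |q k. primepow q}"

text \<open>The equation for the image says both that the homomorphism takes values in \<open>Int(D)\<close>
  (in particular that the polynomials \<open>F\<^sub>q\<close> lie there) and that it is surjective.\<close>

definition class_D :: "'k::field set \<Rightarrow> bool" where
  "class_D D \<longleftrightarrow>
     (\<exists>\<pi>::nat \<Rightarrow> 'k.
        (\<forall>q. primepow q \<longrightarrow>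
           \<pi> q \<in> D \<and> \<pi> q \<noteq> 0 \<and> Pi_ideal D q = {\<pi> q * d |d. d \<in> D} \<and>
           F_poly (\<pi> q) q \<in> Int_poly D) \<and>
        gen_hom \<pi> ` carrier (mpoly_algebra D gen_vars) = carrier (Int_algebra D) \<and>
        a_kernel (mpoly_algebra D gen_vars) (Int_algebra D) (gen_hom \<pi>) =
          genideal (mpoly_algebra D gen_vars) (gen_relations \<pi>))"

end

theory Submission
  imports Defs "HOL-Algebra.Multiplicative_Group" "HOL-Algebra.Sylow"
begin

text \<open>
  (1) implies (3) because \<open>F\<^sub>q = (X\<^sup>q - X) / \<pi>\<^sub>q\<close> lies in \<open>Int(D)\<close>. Conditions (2) and (3) are
  compared locally: a maximal ideal \<open>M\<close> containing \<open>\<Pi>\<^sub>q = \<pi>\<^sub>q D\<close> is t-maximal, its residue field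
  consists of roots of \<open>X\<^sup>q - X\<close>, and \<open>\<pi>\<^sub>q\<close> generates \<open>M\<close> locally.

  Given (3) and \<open>a\<close> in \<open>A\<close>, iterated division by \<open>\<pi>\<^sub>q\<close> yields elements \<open>a\<^sub>q\<^sub>,\<^sub>k\<close> of \<open>A\<close> that satisfy the
  relations between the iterates of \<open>F\<^sub>q\<close>. For \<open>D\<close> in the class D this is all that is needed. For
  \<open>D\<close> in the class C, let \<open>\<Gamma>\<close> be the subalgebra of \<open>K[X] \<times> A\<close> generated by the pairs of the k-th
  iterate of \<open>F\<^sub>q\<close> and \<open>a\<^sub>q\<^sub>,\<^sub>k\<close>; it is the graph of the required homomorphism, for two reasons.
  First, up to factors \<open>\<pi>\<^sub>r\<close> with \<open>r \<noteq> q\<close>, it is spanned by pairs whose first components are products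
  of the iterates of \<open>F\<^sub>q\<close> alone according to the base \<open>q\<close> digits of a number \<open>n\<close>, hence of degree
  \<open>n\<close>; as the \<open>\<pi>\<^sub>q\<close> are pairwise comaximal, \<open>(0, \<alpha>)\<close> in \<open>\<Gamma>\<close> forces \<open>\<alpha> = 0\<close>. Secondly, the same
  products and comaximality provide polynomials of every degree in the projection of \<open>\<Gamma>\<close> whose
  leading coefficients are optimal by Newton interpolation at the t-maximal ideals, so that they
  form a basis of \<open>Int(D)\<close>. Products of these basis polynomials in several variables form a basis
  of \<open>Int(D\<^sup>X)\<close>, and (4) follows from (1) by another graph.
\<close>

text \<open>No localization is ever formed: "locally at p" always means after multiplication by some
  s in \<open>D - p\<close>, and integrality is tested at t-maximal ideals because the denominators
  of an element of the quotient field form a t-ideal. The obstacle in (3) implies (1) is that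
  \<pi>_q may annihilate nonzero elements of A. The a_{q,k} are therefore chosen, not determined by
  a, and no formula with denominators can define the homomorphism. Given (0, \<alpha>) in \<Gamma>,
  the proof studies the annihilator of \<alpha>. The relations, valid in both components, write
  \<pi>_r times a generator of index r through the preceding one, down to the pair (X, a) shared by
  all indices; so for each q some product of \<pi>_r with r \<noteq> q annihilates \<alpha>. No
  maximal ideal contains such products for all q: if it contains \<pi>_r, its norm is r, and it
  avoids every other \<pi>. The same argument, applied to the ideal of attainable leading
  coefficients, yields the basis without a Chinese remainder construction. That (3) reaches every
  ideal in (2) rests on finite norms being prime powers.\<close>

lemma carrier_ring_on [simp]: "carrier (ring_on S) = S"
  and mult_ring_on [simp]: "monoid.mult (ring_on S) = (*)"
  and one_ring_on [simp]: "monoid.one (ring_on S) = 1"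
  and zero_ring_on [simp]: "ring.zero (ring_on S) = 0"
  and add_ring_on [simp]: "ring.add (ring_on S) = (+)"
  by (simp_all add: ring_on_def)

lemma nat_pow_ring_on [simp]: "x [^]\<^bsub>ring_on S\<^esub> (n::nat) = x ^ n"
  by (induction n) (simp_all add: nat_pow_def ring_on_def mult.commute)

locale domain_in_field =
  fixes D :: "'k::field set"
  assumes domain_with_quotient_field: "domain_with_quotient_field D"
begin

lemma domain_ring_on: "domain (ring_on D)"
  using domain_with_quotient_field by (simp add: domain_with_quotient_field_def)

sublocale D: domain "ring_on D"
  by (rule domain_ring_on)

lemma zero_mem [simp]: "0 \<in> D" and one_mem [simp]: "1 \<in> D"
  using D.zero_closed D.one_closed by simp_all

lemma add_mem [simp]: "x \<in> D \<Longrightarrow> y \<in> D \<Longrightarrow> x + y \<in> D"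
  using D.add.m_closed by simp

lemma mult_mem [simp]: "x \<in> D \<Longrightarrow> y \<in> D \<Longrightarrow> x * y \<in> D"
  using D.m_closed by simp

lemma a_inv_D [simp]: "x \<in> D \<Longrightarrow> \<ominus>\<^bsub>ring_on D\<^esub> x = - x"
  using D.l_neg[of x] by (simp add: eq_neg_iff_add_eq_0)

lemma uminus_mem [simp]: "x \<in> D \<Longrightarrow> - x \<in> D"
  using D.a_inv_closed[of x] by simp

lemma diff_mem [simp]: "x \<in> D \<Longrightarrow> y \<in> D \<Longrightarrow> x - y \<in> D"
  using add_mem[of x "- y"] uminus_mem by auto

lemma a_minus_D [simp]: "x \<in> D \<Longrightarrow> y \<in> D \<Longrightarrow> x \<ominus>\<^bsub>ring_on D\<^esub> y = x - y"
  by (simp add: a_minus_def)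

lemma power_mem [simp]: "x \<in> D \<Longrightarrow> x ^ n \<in> D"
  by (induction n) auto

lemma sum_mem: "(\<And>i. i \<in> I \<Longrightarrow> f i \<in> D) \<Longrightarrow> sum f I \<in> D"
  by (induction I rule: infinite_finite_induct) auto

lemma prod_mem: "(\<And>i. i \<in> I \<Longrightarrow> f i \<in> D) \<Longrightarrow> prod f I \<in> D"
  by (induction I rule: infinite_finite_induct) auto

lemma of_nat_mem [simp]: "of_nat n \<in> D"
  by (induction n) auto

lemma fraction: obtains a b where "a \<in> D" "b \<in> D" "b \<noteq> 0" "x = a / b"
  using domain_with_quotient_field unfolding domain_with_quotient_field_def by blast

section \<open>Ideals and submodules of the quotient field\<close>

text \<open>The working form of ideals: bare closure conditions in the quotient field, without the
  record \<open>ring_on D\<close>. \<open>ideal_iff\<close> is the bridge to HOL-Algebra.\<close>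

definition submod :: "'k set \<Rightarrow> bool" where
  "submod J \<longleftrightarrow> 0 \<in> J \<and> (\<forall>x\<in>J. \<forall>y\<in>J. x + y \<in> J) \<and> (\<forall>d\<in>D. \<forall>x\<in>J. d * x \<in> J)"

lemma submodI:
  assumes "0 \<in> J" "\<And>x y. x \<in> J \<Longrightarrow> y \<in> J \<Longrightarrow> x + y \<in> J" "\<And>d x. d \<in> D \<Longrightarrow> x \<in> J \<Longrightarrow> d * x \<in> J"
  shows "submod J"
  using assms by (auto simp: submod_def)

lemma submod_zero: "submod J \<Longrightarrow> 0 \<in> J"
  and submod_add: "submod J \<Longrightarrow> x \<in> J \<Longrightarrow> y \<in> J \<Longrightarrow> x + y \<in> J"
  and submod_mult: "submod J \<Longrightarrow> d \<in> D \<Longrightarrow> x \<in> J \<Longrightarrow> d * x \<in> J"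
  by (auto simp: submod_def)

lemma submod_mult_right: "submod J \<Longrightarrow> x \<in> J \<Longrightarrow> d \<in> D \<Longrightarrow> x * d \<in> J"
  using submod_mult[of J d x] by (simp add: mult.commute)

lemma submod_uminus: "submod J \<Longrightarrow> x \<in> J \<Longrightarrow> - x \<in> J"
  using submod_mult[of J "- 1" x] uminus_mem[of 1] by simp

lemma submod_diff: "submod J \<Longrightarrow> x \<in> J \<Longrightarrow> y \<in> J \<Longrightarrow> x - y \<in> J"
  using submod_add[of J x "- y"] submod_uminus[of J y] by simp

lemma submod_sum: "submod J \<Longrightarrow> (\<And>i. i \<in> I \<Longrightarrow> f i \<in> J) \<Longrightarrow> sum f I \<in> J"
  by (induction I rule: infinite_finite_induct) (auto simp: submod_zero submod_add)

lemma submod_D: "submod D"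
  by (auto intro: submodI)

lemma ideal_iff: "ideal I (ring_on D) \<longleftrightarrow> I \<subseteq> D \<and> submod I"
proof
  assume "ideal I (ring_on D)"
  then interpret ideal I "ring_on D" .
  show "I \<subseteq> D \<and> submod I"
    using a_subset a_closed I_l_closed zero_closed by (auto intro!: submodI)
next
  assume *: "I \<subseteq> D \<and> submod I"
  have "subgroup I (add_monoid (ring_on D))"
    by (rule D.add.subgroupI)
      (use * in \<open>auto simp: submod_add submod_uminus simp flip: a_inv_def dest: submod_zero\<close>)
  then show "ideal I (ring_on D)"
    using * by (intro idealI) (auto simp: D.ring_axioms intro: submod_mult submod_mult_right)
qed

lemma ideal_eq_D_iff: "I \<subseteq> D \<Longrightarrow> submod I \<Longrightarrow> I = D \<longleftrightarrow> 1 \<in> I"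
  using submod_mult[of I _ 1] by auto

lemma submod_insert_gen:
  assumes "submod p" "a \<in> D"
  shows "submod {x + d * a |x d. x \<in> p \<and> d \<in> D}"
proof (rule submodI)
  show "0 \<in> {x + d * a |x d. x \<in> p \<and> d \<in> D}"
    using submod_zero[OF assms(1)] by force
  fix x y assume "x \<in> {x + d * a |x d. x \<in> p \<and> d \<in> D}" "y \<in> {x + d * a |x d. x \<in> p \<and> d \<in> D}"
  then obtain u d v e where "x = u + d * a" "y = v + e * a" "u \<in> p" "v \<in> p" "d \<in> D" "e \<in> D" by auto
  then have "x + y = (u + v) + (d + e) * a \<and> u + v \<in> p \<and> d + e \<in> D"
    using submod_add[OF assms(1)] by (auto simp: algebra_simps)
  then show "x + y \<in> {x + d * a |x d. x \<in> p \<and> d \<in> D}" by blast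
next
  fix c x assume "c \<in> D" "x \<in> {x + d * a |x d. x \<in> p \<and> d \<in> D}"
  then obtain u d where "x = u + d * a" "u \<in> p" "d \<in> D" by auto
  then have "c * x = c * u + (c * d) * a \<and> c * u \<in> p \<and> c * d \<in> D"
    using submod_mult[OF assms(1)] \<open>c \<in> D\<close> by (auto simp: algebra_simps)
  then show "c * x \<in> {x + d * a |x d. x \<in> p \<and> d \<in> D}" by blast
qed

text \<open>Zorn's lemma shared by maximal and t-maximal ideals. The union of a chain is a proper
  ideal in both cases, since 1 lies in no member; only what is specific to \<open>P\<close> remains
  as the hypothesis \<open>Un\<close>.\<close>

lemma maximal_proper_ideal_exists:
  assumes "P I" and P: "\<And>J. P J \<Longrightarrow> J \<subseteq> D \<and> submod J \<and> 1 \<notin> J"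
    and Un: "\<And>C. C \<noteq> {} \<Longrightarrow> (\<And>J. J \<in> C \<Longrightarrow> P J) \<Longrightarrow> subset.chain {J. P J} C \<Longrightarrow>
      \<Union>C \<subseteq> D \<Longrightarrow> submod (\<Union>C) \<Longrightarrow> 1 \<notin> \<Union>C \<Longrightarrow> P (\<Union>C)"
  obtains M where "P M" "I \<subseteq> M" "\<And>J. P J \<Longrightarrow> M \<subseteq> J \<Longrightarrow> J = M"
proof -
  have "\<exists>M\<in>{J. P J \<and> I \<subseteq> J}. \<forall>X\<in>{J. P J \<and> I \<subseteq> J}. M \<subseteq> X \<longrightarrow> X = M"
  proof (rule subset_Zorn_nonempty)
    show "{J. P J \<and> I \<subseteq> J} \<noteq> {}" using assms(1) by auto
    fix C assume "C \<noteq> {}" and ch: "subset.chain {J. P J \<and> I \<subseteq> J} C"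
    have C: "P J" "I \<subseteq> J" if "J \<in> C" for J
      using ch that by (auto simp: subset_chain_def)
    have lin: "J \<subseteq> J' \<or> J' \<subseteq> J" if "J \<in> C" "J' \<in> C" for J J'
      using ch that by (auto simp: subset_chain_def)
    have "submod (\<Union>C)"
    proof (rule submodI)
      show "0 \<in> \<Union>C" using C P submod_zero \<open>C \<noteq> {}\<close> by blast
      fix x y assume "x \<in> \<Union>C" "y \<in> \<Union>C"
      then obtain J J' where "J \<in> C" "J' \<in> C" "x \<in> J" "y \<in> J'" by auto
      then show "x + y \<in> \<Union>C"
        using lin[of J J'] submod_add P C by blast
    next
      fix d x assume "d \<in> D" "x \<in> \<Union>C"
      then show "d * x \<in> \<Union>C" using P C submod_mult by blast
    qed
    moreover have "\<Union>C \<subseteq> D" "1 \<notin> \<Union>C" using C P by blast+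
    ultimately have "P (\<Union>C)"
      using C(1) ch \<open>C \<noteq> {}\<close> by (intro Un) (auto simp: subset_chain_def)
    then show "\<Union>C \<in> {J. P J \<and> I \<subseteq> J}" using C \<open>C \<noteq> {}\<close> by auto
  qed
  then show thesis using that assms(1) by (metis (mono_tags, lifting) mem_Collect_eq order_trans)
qed

text \<open>Maximality is expressed by inverses modulo \<open>M\<close>, the form in which it is
  used; \<open>max_ideal_exists\<close> obtains it from maximality under inclusion by adjoining
  x.\<close>

definition max_ideal :: "'k set \<Rightarrow> bool" where
  "max_ideal M \<longleftrightarrow> M \<subseteq> D \<and> submod M \<and> 1 \<notin> M \<and> (\<forall>x\<in>D - M. \<exists>y\<in>D. x * y - 1 \<in> M)"

lemma max_ideal_exists:
  assumes "I \<subseteq> D" "submod I" "1 \<notin> I"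
  obtains M where "max_ideal M" "I \<subseteq> M"
proof (rule maximal_proper_ideal_exists[of "\<lambda>J. J \<subseteq> D \<and> submod J \<and> 1 \<notin> J" I])
  fix M assume M: "M \<subseteq> D \<and> submod M \<and> 1 \<notin> M" and "I \<subseteq> M"
    and max: "\<And>J. J \<subseteq> D \<and> submod J \<and> 1 \<notin> J \<Longrightarrow> M \<subseteq> J \<Longrightarrow> J = M"
  have "\<exists>y\<in>D. x * y - 1 \<in> M" if "x \<in> D - M" for x
  proof -
    let ?J = "{u + d * x |u d. u \<in> M \<and> d \<in> D}"
    have "submod ?J" using M that by (intro submod_insert_gen) auto
    moreover have "?J \<subseteq> D" using M that by auto
    moreover have "M \<subseteq> ?J" using M by (force intro: exI[of _ 0])
    moreover have "x \<in> ?J" using submod_zero M by (force intro: exI[of _ 1] exI[of _ 0])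
    ultimately have "1 \<in> ?J" using max[of ?J] that by blast
    then obtain u d where "1 = u + d * x" "u \<in> M" "d \<in> D" by auto
    then have "x * d - 1 = - u" by (simp add: algebra_simps)
    then show ?thesis using submod_uminus M \<open>u \<in> M\<close> \<open>d \<in> D\<close> by metis
  qed
  then show thesis using that[of M] M \<open>I \<subseteq> M\<close> unfolding max_ideal_def by blast
qed (use assms in auto)

definition prime_id :: "'k set \<Rightarrow> bool" where
  "prime_id p \<longleftrightarrow> p \<subseteq> D \<and> submod p \<and> 1 \<notin> p \<and> (\<forall>x\<in>D. \<forall>y\<in>D. x * y \<in> p \<longrightarrow> x \<in> p \<or> y \<in> p)"

lemma max_ideal_prime:
  assumes "max_ideal M"
  shows "prime_id M"
  unfolding prime_id_def
proof (intro conjI ballI impI)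
  fix x y assume *: "x \<in> D" "y \<in> D" "x * y \<in> M"
  show "x \<in> M \<or> y \<in> M"
  proof (rule disjCI)
    assume "y \<notin> M"
    then obtain z where z: "z \<in> D" "y * z - 1 \<in> M" using assms * by (auto simp: max_ideal_def)
    have "submod M" using assms by (auto simp: max_ideal_def)
    then have "z * (x * y) - x * (y * z - 1) \<in> M"
      using * z submod_diff submod_mult by blast
    then show "x \<in> M" by (simp add: algebra_simps)
  qed
qed (use assms in \<open>auto simp: max_ideal_def\<close>)

lemma prime_id_prod:
  assumes "prime_id p" "finite I" "\<And>i. i \<in> I \<Longrightarrow> f i \<in> D" "prod f I \<in> p"
  shows "\<exists>i\<in>I. f i \<in> p"
  using assms(2-)
proof (induction I rule: finite_induct)
  case empty
  then show ?case using assms(1) by (simp add: prime_id_def)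
next
  case (insert i I)
  then have "f i \<in> p \<or> prod f I \<in> p"
    using assms(1) prod_mem[of I f] by (auto simp: prime_id_def)
  then show ?case using insert by auto
qed

lemma prime_id_power: "prime_id p \<Longrightarrow> x \<in> D \<Longrightarrow> x ^ n \<in> p \<Longrightarrow> x \<in> p"
proof (induction n)
  case (Suc n)
  then have "x \<in> p \<or> x ^ n \<in> p" using power_mem[of x n] by (simp add: prime_id_def)
  then show ?case using Suc by blast
qed (simp add: prime_id_def)

lemma primeideal_ring_onI:
  assumes "prime_id p"
  shows "primeideal p (ring_on D)"
proof (rule primeidealI)
  show "ideal p (ring_on D)" using assms by (simp add: ideal_iff prime_id_def)
  show "carrier (ring_on D) \<noteq> p" using assms one_mem by (auto simp: prime_id_def)
qed (use assms in \<open>auto simp: prime_id_def D.is_cring\<close>)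

end

context domain_in_field begin

section \<open>t-maximal ideals\<close>

lemma v_closure_iff: "y \<in> v_closure D J \<longleftrightarrow> (\<forall>x. (\<forall>z\<in>J. x * z \<in> D) \<longrightarrow> y * x \<in> D)"
  by (auto simp: v_closure_def ideal_inverse_def)

lemma v_closure_generated:
  assumes "finite F"
  shows "v_closure D {\<Sum>x\<in>F. c x * x |c. \<forall>x\<in>F. c x \<in> D} = v_closure D F"
proof -
  have "(\<forall>z\<in>{\<Sum>x\<in>F. c x * x |c. \<forall>x\<in>F. c x \<in> D}. x * z \<in> D) \<longleftrightarrow> (\<forall>z\<in>F. x * z \<in> D)" for x
  proof safe
    fix z assume *: "\<forall>z\<in>{\<Sum>x\<in>F. c x * x |c. \<forall>x\<in>F. c x \<in> D}. x * z \<in> D" and "z \<in> F"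
    have "z = (\<Sum>w\<in>F. (if w = z then 1 else 0) * w)"
      using \<open>z \<in> F\<close> assms by (simp add: if_distrib[of "\<lambda>t. t * _"] sum.delta cong: if_cong)
    then have "z \<in> {\<Sum>x\<in>F. c x * x |c. \<forall>x\<in>F. c x \<in> D}"
      by (intro CollectI exI[of _ "\<lambda>w. if w = z then 1 else 0"]) auto
    then show "x * z \<in> D" using * by blast
  next
    fix c assume *: "\<forall>z\<in>F. x * z \<in> D" "\<forall>x\<in>F. c x \<in> D"
    have "x * (\<Sum>x\<in>F. c x * x) = (\<Sum>z\<in>F. c z * (x * z))"
      by (simp add: sum_distrib_left mult_ac)
    also have "\<dots> \<in> D" using * by (intro sum_mem) auto
    finally show "x * (\<Sum>x\<in>F. c x * x) \<in> D" .
  qed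
  then show ?thesis by (auto simp: v_closure_iff)
qed

text \<open>The v-closure of a finitely generated ideal depends only on which x multiply the
  generators into \<open>D\<close>, so finite subsets of \<open>I\<close> can replace finitely
  generated ideals from here on.\<close>

lemma mem_t_closure_iff:
  assumes "submod I"
  shows "y \<in> t_closure D I \<longleftrightarrow>
    (\<exists>F. finite F \<and> F \<subseteq> I \<and> \<not> F \<subseteq> {0} \<and> (\<forall>x. (\<forall>z\<in>F. x * z \<in> D) \<longrightarrow> y * x \<in> D))"
    (is "?L \<longleftrightarrow> ?R")
proof
  assume ?L
  then obtain F where F: "finite F" and ne: "{\<Sum>x\<in>F. c x * x |c. \<forall>x\<in>F. c x \<in> D} \<noteq> {0}"
    and sub: "{\<Sum>x\<in>F. c x * x |c. \<forall>x\<in>F. c x \<in> D} \<subseteq> I"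
    and y: "y \<in> v_closure D {\<Sum>x\<in>F. c x * x |c. \<forall>x\<in>F. c x \<in> D}"
    unfolding t_closure_def finitely_generated_def by auto
  have "F \<subseteq> I"
  proof
    fix z assume "z \<in> F"
    then have "z = (\<Sum>w\<in>F. (if w = z then 1 else 0) * w)"
      using F by (simp add: if_distrib[of "\<lambda>t. t * _"] sum.delta cong: if_cong)
    then have "z \<in> {\<Sum>x\<in>F. c x * x |c. \<forall>x\<in>F. c x \<in> D}"
      by (intro CollectI exI[of _ "\<lambda>w. if w = z then 1 else 0"]) auto
    then show "z \<in> I" using sub by blast
  qed
  moreover have "\<not> F \<subseteq> {0}"
  proof
    assume "F \<subseteq> {0}"
    then have "{\<Sum>x\<in>F. c x * x |c. \<forall>x\<in>F. c x \<in> D} = {0}"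
      by (auto intro!: sum.neutral exI[of _ "\<lambda>_. 0"])
    with ne show False by simp
  qed
  ultimately show ?R using F y by (auto simp: v_closure_generated v_closure_iff)
next
  assume ?R
  then obtain F where F: "finite F" "F \<subseteq> I" "\<not> F \<subseteq> {0}" 
    and y: "\<forall>x. (\<forall>z\<in>F. x * z \<in> D) \<longrightarrow> y * x \<in> D" by auto
  let ?J = "{\<Sum>x\<in>F. c x * x |c. \<forall>x\<in>F. c x \<in> D}"
  have "?J \<subseteq> I" using F assms by (auto intro!: submod_sum submod_mult)
  moreover have "?J \<noteq> {0}"
  proof -
    obtain z where "z \<in> F" "z \<noteq> 0" using F by auto
    then have "z = (\<Sum>w\<in>F. (if w = z then 1 else 0) * w)"
      using F by (simp add: if_distrib[of "\<lambda>t. t * _"] sum.delta cong: if_cong)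
    then have "z \<in> ?J"
      by (intro CollectI exI[of _ "\<lambda>w. if w = z then 1 else 0"]) auto
    then show ?thesis using \<open>z \<noteq> 0\<close> by auto
  qed
  moreover have "finitely_generated D ?J"
    using F by (auto simp: finitely_generated_def)
  moreover have "y \<in> v_closure D ?J"
    using F y by (simp add: v_closure_generated v_closure_iff)
  ultimately show ?L unfolding t_closure_def by blast
qed

lemma t_closure_subset_D:
  assumes "I \<subseteq> D" "submod I"
  shows "t_closure D I \<subseteq> D"
proof
  fix y assume "y \<in> t_closure D I"
  then obtain F where "F \<subseteq> I" "\<forall>x. (\<forall>z\<in>F. x * z \<in> D) \<longrightarrow> y * x \<in> D"
    using assms by (auto simp: mem_t_closure_iff)
  then have "y * 1 \<in> D" using assms by (metis mult_1 subsetD)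
  then show "y \<in> D" by simp
qed

lemma t_closure_extensive:
  assumes "submod I" "I \<noteq> {0}"
  shows "I \<subseteq> t_closure D I"
proof
  fix y assume "y \<in> I"
  \<comment> \<open>A nonzero companion keeps the finite witness different from {0} when y =
    0.\<close>
  obtain w where "w \<in> I" "w \<noteq> 0" using assms submod_zero by blast
  then show "y \<in> t_closure D I"
    using \<open>y \<in> I\<close> assms unfolding mem_t_closure_iff[OF assms(1)]
    by (intro exI[of _ "{y, w}"]) (auto simp: mult.commute)
qed

lemma t_closure_submod:
  assumes "submod I" "I \<noteq> {0}"
  shows "submod (t_closure D I)"
proof (rule submodI)
  show "0 \<in> t_closure D I" using t_closure_extensive[OF assms] submod_zero[OF assms(1)] by auto
  fix x y assume "x \<in> t_closure D I" "y \<in> t_closure D I"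
  then obtain F G where "finite F" "F \<subseteq> I" "\<not> F \<subseteq> {0}" "\<forall>z. (\<forall>w\<in>F. z * w \<in> D) \<longrightarrow> x * z \<in> D"
    "finite G" "G \<subseteq> I" "\<forall>z. (\<forall>w\<in>G. z * w \<in> D) \<longrightarrow> y * z \<in> D"
    using assms by (auto simp: mem_t_closure_iff)
  then show "x + y \<in> t_closure D I"
    using assms unfolding mem_t_closure_iff[OF assms(1)]
    by (intro exI[of _ "F \<union> G"]) (auto simp: distrib_right)
next
  fix d x assume "d \<in> D" "x \<in> t_closure D I"
  then show "d * x \<in> t_closure D I"
    unfolding mem_t_closure_iff[OF assms(1)] by (metis mult.assoc mult_mem)
qed

lemma t_closure_idem:
  assumes "submod I" "I \<noteq> {0}"
  shows "t_closure D (t_closure D I) \<subseteq> t_closure D I"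
proof
  fix y assume "y \<in> t_closure D (t_closure D I)"
  then obtain F where F: "finite F" "F \<subseteq> t_closure D I" "\<not> F \<subseteq> {0}"
      "\<And>x. (\<forall>z\<in>F. x * z \<in> D) \<Longrightarrow> y * x \<in> D"
    unfolding mem_t_closure_iff[OF t_closure_submod[OF assms]] by auto
  have "\<forall>z\<in>F. \<exists>G. finite G \<and> G \<subseteq> I \<and> \<not> G \<subseteq> {0} \<and> (\<forall>x. (\<forall>w\<in>G. x * w \<in> D) \<longrightarrow> z * x \<in> D)"
    using F(2) assms unfolding mem_t_closure_iff[OF assms(1), symmetric] by auto
  then obtain G where G: "\<And>z. z \<in> F \<Longrightarrow> finite (G z)" "\<And>z. z \<in> F \<Longrightarrow> G z \<subseteq> I"
      "\<And>z. z \<in> F \<Longrightarrow> \<not> G z \<subseteq> {0}" "\<And>z x. z \<in> F \<Longrightarrow> (\<forall>w\<in>G z. x * w \<in> D) \<Longrightarrow> z * x \<in> D"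
    by metis
  have "y * x \<in> D" if "\<forall>w\<in>(\<Union>z\<in>F. G z). x * w \<in> D" for x
    using that F(4)[of x] G(4)[of _ x] by (auto simp: mult.commute)
  moreover have "\<not> (\<Union>z\<in>F. G z) \<subseteq> {0}" using F(3) G(3) by blast
  ultimately show "y \<in> t_closure D I"
    unfolding mem_t_closure_iff[OF assms(1)] using F(1) G by (intro exI[of _ "\<Union>z\<in>F. G z"]) blast
qed

lemma proper_t_ideal_iff:
  "proper_t_ideal D I \<longleftrightarrow> I \<subseteq> D \<and> submod I \<and> I \<noteq> {0} \<and> 1 \<notin> I \<and> t_closure D I \<subseteq> I"
  unfolding proper_t_ideal_def ideal_iff
  using t_closure_extensive[of I] ideal_eq_D_iff[of I] by blast

lemma t_maximal_proper: "t_maximal D p \<Longrightarrow> p \<subseteq> D \<and> submod p \<and> p \<noteq> {0} \<and> 1 \<notin> p"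
  by (auto simp: t_maximal_def proper_t_ideal_iff)

text \<open>The t-operation has finite character: a finite witness for membership in the t-closure
  of the union of a chain already lies in one member of the chain.\<close>

lemma t_maximal_exists:
  assumes "proper_t_ideal D I"
  obtains p where "t_maximal D p" "I \<subseteq> p"
proof (rule maximal_proper_ideal_exists[of "proper_t_ideal D" I])
  fix C assume C: "C \<noteq> {}" "\<And>J. J \<in> C \<Longrightarrow> proper_t_ideal D J"
    "subset.chain {J. proper_t_ideal D J} C" "\<Union>C \<subseteq> D" "submod (\<Union>C)" "1 \<notin> \<Union>C"
  have "t_closure D (\<Union>C) \<subseteq> \<Union>C"
  proof
    fix y assume "y \<in> t_closure D (\<Union>C)"
    then obtain F where F: "finite F" "F \<subseteq> \<Union>C" "\<not> F \<subseteq> {0}"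
        "\<forall>x. (\<forall>z\<in>F. x * z \<in> D) \<longrightarrow> y * x \<in> D"
      using mem_t_closure_iff[OF C(5)] by auto
    then obtain J where J: "J \<in> C" "F \<subseteq> J"
      using finite_subset_Union_chain[OF F(1,2) C(1,3)] by auto
    then have "submod J" "t_closure D J \<subseteq> J" using C(2) by (auto simp: proper_t_ideal_iff)
    then show "y \<in> \<Union>C" using J F mem_t_closure_iff[of J y] by blast
  qed
  moreover have "\<Union>C \<noteq> {0}"
  proof -
    obtain J where "J \<in> C" using C(1) by auto
    then have "submod J" "J \<noteq> {0}" using C(2) by (auto simp: proper_t_ideal_iff)
    then show ?thesis using \<open>J \<in> C\<close> submod_zero by blast
  qed
  ultimately show "proper_t_ideal D (\<Union>C)" using C by (auto simp: proper_t_ideal_iff)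
next
  fix M assume "proper_t_ideal D M" "I \<subseteq> M" "\<And>J. proper_t_ideal D J \<Longrightarrow> M \<subseteq> J \<Longrightarrow> J = M"
  then show thesis using that[of M] by (auto simp: t_maximal_def)
qed (use assms in \<open>auto simp: proper_t_ideal_iff\<close>)

text \<open>If ab lies in p but a does not, maximality puts 1 into the t-closure of p + aD.
  Multiplying the finite witness for this by b moves it into p and makes it a witness that b lies in
  the t-closure of p, which is p.\<close>

lemma t_maximal_prime:
  assumes "t_maximal D p"
  shows "prime_id p"
  unfolding prime_id_def
proof (intro conjI ballI impI)
  have p: "p \<subseteq> D" "submod p" "p \<noteq> {0}" "t_closure D p \<subseteq> p"
    using assms by (auto simp: t_maximal_def proper_t_ideal_iff)
  fix a b assume ab: "a \<in> D" "b \<in> D" "a * b \<in> p"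
  show "a \<in> p \<or> b \<in> p"
  proof (rule ccontr)
    assume *: "\<not> (a \<in> p \<or> b \<in> p)"
    let ?I = "{u + d * a |u d. u \<in> p \<and> d \<in> D}"
    have sub: "submod ?I" by (intro submod_insert_gen p ab)
    have "?I \<subseteq> D" using p ab by auto
    have pI: "p \<subseteq> ?I" by (force intro: exI[of _ 0])
    have aI: "a \<in> ?I" using submod_zero[OF p(2)] by (force intro: exI[of _ 1] exI[of _ 0])
    have ne: "?I \<noteq> {0}" using pI p submod_zero by blast
    have "1 \<in> t_closure D ?I"
    proof (rule ccontr)
      assume "1 \<notin> t_closure D ?I"
      then have "proper_t_ideal D (t_closure D ?I)"
        unfolding proper_t_ideal_iff
        using t_closure_subset_D[OF \<open>?I \<subseteq> D\<close> sub] t_closure_submod[OF sub ne] ne sub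
          t_closure_extensive[OF sub ne] t_closure_idem[OF sub ne] submod_zero[OF sub] by auto
      moreover have "p \<subseteq> t_closure D ?I" using pI t_closure_extensive[OF sub ne] by blast
      ultimately have "t_closure D ?I = p" using assms by (auto simp: t_maximal_def)
      then show False using aI t_closure_extensive[OF sub ne] * by blast
    qed
    then obtain F where F: "finite F" "F \<subseteq> ?I" "\<not> F \<subseteq> {0}"
        "\<And>x. (\<forall>z\<in>F. x * z \<in> D) \<Longrightarrow> 1 * x \<in> D"
      unfolding mem_t_closure_iff[OF sub] by blast
    have "b \<noteq> 0" using * submod_zero[OF p(2)] by auto
    have "b \<in> t_closure D p"
      unfolding mem_t_closure_iff[OF p(2)]
    proof (intro exI[of _ "(*) b ` F"] conjI allI impI)
      show "(*) b ` F \<subseteq> p"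
      proof safe
        fix z assume "z \<in> F"
        then have "z \<in> ?I" using F(2) by blast
        then obtain u d where "z = u + d * a" "u \<in> p" "d \<in> D" by auto
        then have "b * z = b * u + d * (a * b)" by (simp add: algebra_simps)
        then show "b * z \<in> p" using \<open>u \<in> p\<close> \<open>d \<in> D\<close> ab p submod_add submod_mult by metis
      qed
      fix x assume "\<forall>z\<in>(*) b ` F. x * z \<in> D"
      then show "b * x \<in> D" using F(4)[of "b * x"] by (simp add: mult_ac)
    qed (use F(1,3) \<open>b \<noteq> 0\<close> in auto)
    then show False using p(4) * by blast
  qed
qed (use t_maximal_proper[OF assms] in auto)

text \<open>\<open>D\<close> is the intersection of its localizations at t-maximal ideals: the ideal
  of denominators of y is a t-ideal, so if proper it is contained in a t-maximal ideal and leaves no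
  multiplier outside it.\<close>

lemma mem_D_if_locally:
  assumes "\<And>p. t_maximal D p \<Longrightarrow> \<exists>s\<in>D - p. s * y \<in> D"
  shows "y \<in> D"
proof (rule ccontr)
  assume "y \<notin> D"
  let ?I = "{d\<in>D. d * y \<in> D}"
  have sub: "submod ?I" by (intro submodI) (auto simp: distrib_right mult.assoc)
  obtain a b where "a \<in> D" "b \<in> D" "b \<noteq> 0" "y = a / b" by (rule fraction)
  then have "b \<in> ?I" by simp
  have "t_closure D ?I \<subseteq> ?I"
  proof
    fix w assume w: "w \<in> t_closure D ?I"
    then have "w \<in> D" using t_closure_subset_D[OF _ sub] by auto
    from w obtain F where "F \<subseteq> ?I" "\<forall>x. (\<forall>z\<in>F. x * z \<in> D) \<longrightarrow> w * x \<in> D"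
      unfolding mem_t_closure_iff[OF sub] by auto
    \<comment> \<open>Thus y itself is one of the multipliers against which \<open>w\<close> is
      tested.\<close>
    moreover have "\<forall>z\<in>F. y * z \<in> D"
      using \<open>F \<subseteq> ?I\<close> by (auto simp: mult.commute[of y])
    ultimately have "w * y \<in> D" by blast
    then show "w \<in> ?I" using \<open>w \<in> D\<close> by simp
  qed
  then have "proper_t_ideal D ?I"
    unfolding proper_t_ideal_iff using sub \<open>b \<in> ?I\<close> \<open>b \<noteq> 0\<close> \<open>y \<notin> D\<close> by auto
  then obtain p where "t_maximal D p" "?I \<subseteq> p" by (rule t_maximal_exists)
  then show False using assms[of p] by blast
qed

section \<open>Residue fields\<close>

lemma coset_eq_iff:
  assumes "p \<subseteq> D" "submod p" "x \<in> D" "y \<in> D"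
  shows "p +>\<^bsub>ring_on D\<^esub> x = p +>\<^bsub>ring_on D\<^esub> y \<longleftrightarrow> x - y \<in> p"
  using D.quotient_eq_iff_same_a_r_cos[of p x y] assms by (auto simp: ideal_iff)

lemma carrier_Quot: "carrier (ring_on D Quot p) = (\<lambda>x. p +>\<^bsub>ring_on D\<^esub> x) ` D"
  by (auto simp: FactRing_def A_RCOSETS_def')

text \<open>Finiteness in the form suited to interpolation: infinitely many residue classes would
  supply an infinite sequence of pairwise incongruent points.\<close>

lemma finite_normI:
  assumes "p \<subseteq> D" "submod p"
    "\<And>u::nat \<Rightarrow> 'k. (\<And>i. u i \<in> D) \<Longrightarrow> (\<And>i j. i \<noteq> j \<Longrightarrow> u i - u j \<notin> p) \<Longrightarrow> False"
  shows "finite_norm D p"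
proof (rule ccontr)
  assume "\<not> finite_norm D p"
  then have "infinite ((\<lambda>x. p +>\<^bsub>ring_on D\<^esub> x) ` D)" by (simp add: finite_norm_def carrier_Quot)
  then obtain f :: "nat \<Rightarrow> 'k set" where f: "inj f" "range f \<subseteq> (\<lambda>x. p +>\<^bsub>ring_on D\<^esub> x) ` D"
    using infinite_countable_subset by blast
  then have "\<forall>i. \<exists>x\<in>D. f i = p +>\<^bsub>ring_on D\<^esub> x" by auto
  then obtain u where u: "\<And>i. u i \<in> D" "\<And>i. f i = p +>\<^bsub>ring_on D\<^esub> u i" by metis
  have *: "u i - u j \<notin> p" if "i \<noteq> j" for i j :: nat
    using that f(1) u coset_eq_iff[OF assms(1,2), of "u i" "u j"] by (auto simp: inj_def)
  show False by (rule assms(3)[OF u(1) *])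
qed

lemma residues_of_finite_norm:
  assumes "p \<subseteq> D" "submod p" "finite_norm D p"
  obtains r where "\<And>i. r i \<in> D"
    "\<And>i j. i < ideal_norm D p \<Longrightarrow> j < ideal_norm D p \<Longrightarrow> i \<noteq> j \<Longrightarrow> r i - r j \<notin> p"
proof -
  let ?C = "(\<lambda>x. p +>\<^bsub>ring_on D\<^esub> x) ` D"
  have C: "finite ?C" "card ?C = ideal_norm D p"
    using assms by (simp_all add: finite_norm_def ideal_norm_def carrier_Quot)
  obtain f where f: "bij_betw f {0..<card ?C} ?C" using ex_bij_betw_nat_finite[OF C(1)] by auto
  have "\<exists>x\<in>D. i < card ?C \<longrightarrow> f i = p +>\<^bsub>ring_on D\<^esub> x" for i
  proof (cases "i < card ?C")
    case True
    then have "f i \<in> ?C" using bij_betw_apply[OF f, of i] by simp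
    then show ?thesis by blast
  qed (use zero_mem in blast)
  then obtain r where r: "\<And>i. r i \<in> D" "\<And>i. i < card ?C \<Longrightarrow> f i = p +>\<^bsub>ring_on D\<^esub> r i"
    by metis
  show thesis
  proof (rule that)
    fix i j assume "i < ideal_norm D p" "j < ideal_norm D p" "i \<noteq> j"
    moreover from this have "f i \<noteq> f j"
      using f C(2) by (metis atLeastLessThan_iff bij_betw_def inj_on_def zero_le)
    ultimately show "r i - r j \<notin> p"
      using r C(2) coset_eq_iff[OF assms(1,2), of "r i" "r j"] by metis
  qed (use r in auto)
qed

text \<open>A finite domain is a field: two congruent powers x^i and x^j with i < j give x^i (1 -
  x^(j-i)) in p, and by primality x^(j-i-1) is an inverse of x modulo p.\<close>

lemma prime_finite_norm_max:
  assumes p: "prime_id p" and fin: "finite_norm D p"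
  shows "max_ideal p"
  unfolding max_ideal_def
proof (intro conjI ballI)
  have p': "p \<subseteq> D" "submod p" "1 \<notin> p" using p by (auto simp: prime_id_def)
  fix x assume x: "x \<in> D - p"
  show "\<exists>y\<in>D. x * y - 1 \<in> p"
  proof (rule ccontr)
    assume no: "\<not> (\<exists>y\<in>D. x * y - 1 \<in> p)"
    have pw: "x ^ i - x ^ j \<notin> p" if "i < j" for i j
    proof
      assume "x ^ i - x ^ j \<in> p"
      moreover have "x ^ i - x ^ j = x ^ i * (1 - x * x ^ (j - i - 1))"
        using that by (simp add: algebra_simps flip: power_add power_Suc)
      moreover have "x ^ i \<notin> p" using prime_id_power[OF p, of x i] x by auto
      moreover have "x ^ i \<in> D" "1 - x * x ^ (j - i - 1) \<in> D"
        using x by (auto intro!: diff_mem mult_mem power_mem)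
      ultimately have "1 - x * x ^ (j - i - 1) \<in> p"
        using p by (metis prime_id_def)
      then have "x * x ^ (j - i - 1) - 1 \<in> p"
        using submod_uminus[OF p'(2), of "1 - x * x ^ (j - i - 1)"] by simp
      then show False using no x power_mem by auto
    qed
    then have pw': "x ^ i - x ^ j \<notin> p" if "i \<noteq> j" for i j
      using that submod_uminus[OF p'(2), of "x ^ i - x ^ j"] by (metis linorder_neqE_nat minus_diff_eq)
    have "inj (\<lambda>i. p +>\<^bsub>ring_on D\<^esub> x ^ i)"
      using pw' x coset_eq_iff[OF p'(1,2)] by (auto simp: inj_def power_mem)
    moreover have "range (\<lambda>i. p +>\<^bsub>ring_on D\<^esub> x ^ i) \<subseteq> carrier (ring_on D Quot p)"
      using x by (auto simp: carrier_Quot)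
    ultimately show False
      using fin unfolding finite_norm_def by (meson finite_subset finite_imageD infinite_UNIV_nat)
  qed
qed (use p in \<open>auto simp: prime_id_def\<close>)

lemma residue_field:
  assumes "max_ideal p"
  shows "field (ring_on D Quot p)"
proof -
  have pr: "prime_id p" by (rule max_ideal_prime[OF assms])
  then have p': "p \<subseteq> D" "submod p" "1 \<notin> p" by (auto simp: prime_id_def)
  interpret P: primeideal p "ring_on D" by (rule primeideal_ring_onI[OF pr])
  interpret Q: domain "ring_on D Quot p" by (rule P.quotient_is_domain)
  interpret h: ring_hom_cring "ring_on D" "ring_on D Quot p" "(+>\<^bsub>ring_on D\<^esub>) p"
    by (rule P.rcos_ring_hom_cring)
  show ?thesis
  proof (rule Q.cring_fieldI2)
    fix a assume a: "a \<in> carrier (ring_on D Quot p)" "a \<noteq> \<zero>\<^bsub>ring_on D Quot p\<^esub>"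
    then obtain x where x: "x \<in> D" "a = p +>\<^bsub>ring_on D\<^esub> x" by (auto simp: carrier_Quot)
    have "p +>\<^bsub>ring_on D\<^esub> x \<noteq> p +>\<^bsub>ring_on D\<^esub> 0"
      using a x h.hom_zero by simp
    then have "x \<notin> p" using coset_eq_iff[OF p'(1,2), of x 0] x by simp
    then obtain y where y: "y \<in> D" "x * y - 1 \<in> p" using assms x by (auto simp: max_ideal_def)
    then have "p +>\<^bsub>ring_on D\<^esub> (x * y) = p +>\<^bsub>ring_on D\<^esub> 1"
      using coset_eq_iff[OF p'(1,2), of "x * y" 1] x by auto
    then have "a \<otimes>\<^bsub>ring_on D Quot p\<^esub> (p +>\<^bsub>ring_on D\<^esub> y) = \<one>\<^bsub>ring_on D Quot p\<^esub>"
      using h.hom_mult[of x y] h.hom_one x y by simp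
    then show "\<exists>b\<in>carrier (ring_on D Quot p). a \<otimes>\<^bsub>ring_on D Quot p\<^esub> b = \<one>\<^bsub>ring_on D Quot p\<^esub>"
      using y by (auto simp: carrier_Quot)
  qed (rule Q.zero_not_one[symmetric] Q.zero_not_one)+
qed

lemma residue_hom:
  assumes "prime_id p"
  shows "ring_hom_cring (ring_on D) (ring_on D Quot p) ((+>\<^bsub>ring_on D\<^esub>) p)"
  by (rule primeideal.rcos_ring_hom_cring[OF primeideal_ring_onI[OF assms]])

lemma residue_power:
  assumes "prime_id p" "x \<in> D"
  shows "p +>\<^bsub>ring_on D\<^esub> (x ^ n) = (p +>\<^bsub>ring_on D\<^esub> x) [^]\<^bsub>ring_on D Quot p\<^esub> n"
proof -
  interpret h: ring_hom_cring "ring_on D" "ring_on D Quot p" "(+>\<^bsub>ring_on D\<^esub>) p"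
    by (rule residue_hom[OF assms(1)])
  show ?thesis using h.hom_pow[of x n] assms by simp
qed

end

hide_const (open) UnivPoly.coeff UnivPoly.monom

context domain_in_field begin

section \<open>Newton interpolation\<close>

definition newton_poly :: "(nat \<Rightarrow> 'k) \<Rightarrow> nat \<Rightarrow> 'k poly" where
  "newton_poly u n = (\<Prod>j<n. [:- u j, 1:])"

lemma poly_newton_poly: "poly (newton_poly u n) x = (\<Prod>j<n. x - u j)"
  by (simp add: newton_poly_def poly_prod)

lemma degree_newton_poly: "degree (newton_poly u n) = n"
  by (simp add: newton_poly_def degree_prod_eq_sum_degree)

lemma lead_coeff_newton_poly: "coeff (newton_poly u n) n = 1"
  using lead_coeff_prod[of "\<lambda>j. [:- u j, 1:]" "{..<n}"] degree_newton_poly[of u n]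
  by (simp add: newton_poly_def)

lemma newton_expansion:
  assumes "degree f \<le> n"
  shows "\<exists>a. f = (\<Sum>i\<le>n. Polynomial.smult (a i) (newton_poly u i)) \<and> a n = coeff f n"
  using assms
proof (induction n arbitrary: f)
  case 0
  then obtain c where "f = [:c:]" using degree_eq_zeroE[of f] by auto
  then show ?case
    by (intro exI[of _ "\<lambda>_. c"]) (simp add: newton_poly_def)
next
  case (Suc n)
  let ?c = "coeff f (Suc n)"
  let ?g = "f - Polynomial.smult ?c (newton_poly u (Suc n))"
  have "degree ?g \<le> n"
  proof (rule degree_le, intro allI impI)
    fix i assume "n < i"
    show "coeff ?g i = 0"
    proof (cases "i = Suc n")
      case True
      then show ?thesis by (simp add: lead_coeff_newton_poly)
    next
      case False
      then show ?thesis
        using \<open>n < i\<close> Suc.prems by (simp add: coeff_eq_0 degree_newton_poly)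
    qed
  qed
  then obtain a where a: "?g = (\<Sum>i\<le>n. Polynomial.smult (a i) (newton_poly u i))"
    using Suc.IH by blast
  have "f = ?g + Polynomial.smult ?c (newton_poly u (Suc n))" by simp
  also have "\<dots> = (\<Sum>i\<le>Suc n. Polynomial.smult ((a(Suc n := ?c)) i) (newton_poly u i))"
    unfolding a by simp
  finally show ?case by (intro exI[of _ "a(Suc n := ?c)"]) auto
qed

text \<open>The Newton coefficients are determined by a triangular system whose diagonal is \<open>t\<close>
  up to factors outside \<open>p\<close>.\<close>

lemma newton_coeff_mem:
  assumes p: "prime_id p" and J: "submod J"
    and t: "\<And>i m. i \<le> n \<Longrightarrow> m \<le> n \<Longrightarrow> \<exists>c\<in>D. (\<Prod>j<i. u m - u j) = t i * c"
      "\<And>i. i \<le> n \<Longrightarrow> \<exists>s\<in>D - p. (\<Prod>j<i. u i - u j) = t i * s"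
    and f: "degree f \<le> n" "\<And>i. i \<le> n \<Longrightarrow> poly f (u i) \<in> J"
  shows "\<exists>s\<in>D - p. s * t n * coeff f n \<in> J"
proof -
  obtain a where fa: "f = (\<Sum>i\<le>n. Polynomial.smult (a i) (newton_poly u i))" and an: "a n = coeff f n"
    using newton_expansion[OF f(1)] by blast
  have "\<exists>s\<in>D - p. s * t i * a i \<in> J" if "i \<le> n" for i
    using that
  proof (induction i rule: less_induct)
    case (less i)
    then have "\<forall>j\<in>{..<i}. \<exists>s. s \<in> D - p \<and> s * t j * a j \<in> J" by auto
    then obtain s where s: "\<And>j. j < i \<Longrightarrow> s j \<in> D - p" "\<And>j. j < i \<Longrightarrow> s j * t j * a j \<in> J"
      by (metis lessThan_iff)
    define S where "S = (\<Prod>j<i. s j)"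
    have SD: "S \<in> D" unfolding S_def using s by (intro prod_mem) auto
    have Sp: "S \<notin> p"
      using prime_id_prod[OF p, of "{..<i}" s] s unfolding S_def by auto
    obtain si where si: "si \<in> D - p" "(\<Prod>j<i. u i - u j) = t i * si" using t(2) less.prems by blast
    have "poly f (u i) = (\<Sum>j\<le>n. a j * (\<Prod>l<j. u i - u l))"
      unfolding fa by (simp add: poly_sum poly_newton_poly)
    \<comment> \<open>The sum stops at i because the Newton polynomials of higher index have u i as
      a root; this is the triangular shape.\<close>
    also have "\<dots> = (\<Sum>j\<le>i. a j * (\<Prod>l<j. u i - u l))"
      using less.prems by (intro sum.mono_neutral_right) (auto intro!: prod_zero bexI[of _ i])
    also have "\<dots> = a i * (t i * si) + (\<Sum>j<i. a j * (\<Prod>l<j. u i - u l))"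
      using si by (simp flip: lessThan_Suc_atMost)
    finally have "(S * si) * t i * a i = S * poly f (u i) - (\<Sum>j<i. S * (a j * (\<Prod>l<j. u i - u l)))"
      by (simp add: sum_distrib_left algebra_simps)
    also have "\<dots> \<in> J"
    proof (rule submod_diff[OF J])
      show "S * poly f (u i) \<in> J" using f(2) less.prems SD submod_mult[OF J] by auto
      show "(\<Sum>j<i. S * (a j * (\<Prod>l<j. u i - u l))) \<in> J"
      proof (rule submod_sum[OF J])
        fix j assume "j \<in> {..<i}"
        then have j: "j < i" "j \<le> n" using less.prems by auto
        obtain c where c: "c \<in> D" "(\<Prod>l<j. u i - u l) = t j * c" using t(1)[OF j(2) less.prems] by blast
        have "S = s j * prod s ({..<i} - {j})"
          unfolding S_def using j by (simp add: prod.remove[of _ j])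
        then have "S * (a j * (\<Prod>l<j. u i - u l)) = (prod s ({..<i} - {j}) * c) * (s j * t j * a j)"
          by (simp add: c mult_ac)
        moreover have "prod s ({..<i} - {j}) * c \<in> D" using c s by (intro mult_mem prod_mem) auto
        ultimately show "S * (a j * (\<Prod>l<j. u i - u l)) \<in> J"
          using submod_mult[OF J _ s(2)[OF j(1)]] by metis
      qed
    qed
    finally have "(S * si) * t i * a i \<in> J" .
    moreover have "S * si \<in> D - p" using SD Sp si p by (auto simp: prime_id_def)
    ultimately show ?case by blast
  qed
  from this[of n] show ?thesis using an by simp
qed

text \<open>The case t = 1: differences of pairwise incongruent points lie outside the prime ideal
  p. With J = M it rules out infinite residue fields on which X^q - X vanishes; with J = D it treats
  t-maximal ideals of infinite norm.\<close>

lemma newton_coeff_mem_distinct: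
  assumes p: "prime_id p" and J: "submod J"
    and u: "\<And>i. u i \<in> D" "\<And>i j. i \<noteq> j \<Longrightarrow> u i - u j \<notin> p"
    and f: "degree f \<le> n" "\<And>i. i \<le> n \<Longrightarrow> poly f (u i) \<in> J"
  shows "\<exists>s\<in>D - p. s * coeff f n \<in> J"
proof -
  have "\<exists>s\<in>D - p. s * 1 * coeff f n \<in> J"
  proof (rule newton_coeff_mem[OF p J _ _ f])
    fix i m :: nat
    show "\<exists>c\<in>D. (\<Prod>j<i. u m - u j) = 1 * c" using u by (auto intro!: prod_mem diff_mem)
    have "(\<Prod>j<i. u i - u j) \<notin> p"
      using prime_id_prod[OF p, of "{..<i}" "\<lambda>j. u i - u j"] u by (auto simp: diff_mem)
    moreover have "(\<Prod>j<i. u i - u j) \<in> D" using u by (auto intro!: prod_mem diff_mem)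
    ultimately show "\<exists>s\<in>D - p. (\<Prod>j<i. u i - u j) = 1 * s" by auto
  qed
  then show ?thesis by simp
qed

section \<open>Maximal ideals of finite norm\<close>

text \<open>If every element of \<open>D\<close> is a root of \<open>X\<^sup>q - X\<close> modulo \<open>\<pi>\<close>, then \<open>\<pi>\<close> generates \<open>p\<close>
  locally: \<open>(1 - z\<^sup>q\<^sup>-\<^sup>1) z\<close> is a multiple of \<open>\<pi>\<close>.\<close>

lemma frobenius_multiplier:
  assumes p: "prime_id p" and q: "q > 1"
    and frob: "\<And>x. x \<in> D \<Longrightarrow> \<exists>d\<in>D. x ^ q - x = \<pi> * d"
    and F: "finite F" "F \<subseteq> p"
  obtains s where "s \<in> D - p" "\<And>z. z \<in> F \<Longrightarrow> \<exists>d\<in>D. s * z = \<pi> * d"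
proof -
  have p': "p \<subseteq> D" "submod p" "1 \<notin> p" using p by (auto simp: prime_id_def)
  define s where "s = (\<Prod>z\<in>F. 1 - z ^ (q - 1))"
  have D: "1 - z ^ (q - 1) \<in> D" if "z \<in> F" for z
    using that F p' by (auto intro!: diff_mem power_mem)
  have np: "1 - z ^ (q - 1) \<notin> p" if "z \<in> F" for z
  proof
    assume *: "1 - z ^ (q - 1) \<in> p"
    have "z ^ (q - 1) = z ^ (q - 2) * z" using q by (simp flip: power_Suc2 add: numeral_2_eq_2 Suc_diff_Suc)
    moreover have "z \<in> p" "z \<in> D" using that F p' by auto
    ultimately have "z ^ (q - 1) \<in> p" using submod_mult[OF p'(2), of "z ^ (q - 2)" z] by simp
    then show False using submod_add[OF p'(2) *, of "z ^ (q - 1)"] p'(3) by simp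
  qed
  have "s \<in> D" unfolding s_def by (rule prod_mem) (rule D)
  moreover have "s \<notin> p" using prime_id_prod[OF p F(1), of "\<lambda>z. 1 - z ^ (q - 1)"] D np unfolding s_def by blast
  moreover have "\<exists>d\<in>D. s * z = \<pi> * d" if "z \<in> F" for z
  proof -
    let ?P = "\<Prod>w\<in>F - {z}. 1 - w ^ (q - 1)"
    have "z \<in> D" using that F p' by blast
    then obtain d where d: "d \<in> D" "z ^ q - z = \<pi> * d" using frob by blast
    have "z ^ q = z ^ (q - 1) * z" using q by (simp flip: power_Suc2)
    then have "(1 - z ^ (q - 1)) * z = - (z ^ q - z)" by (simp add: algebra_simps)
    moreover have "s = (1 - z ^ (q - 1)) * ?P"
      unfolding s_def using that F by (simp add: prod.remove)
    then have "s * z = ((1 - z ^ (q - 1)) * z) * ?P" by (simp only: mult_ac)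
    ultimately have "s * z = \<pi> * (- d * ?P)" by (simp add: d(2))
    moreover have "?P \<in> D" using D by (intro prod_mem) auto
    ultimately show ?thesis using d by (metis mult_mem uminus_mem)
  qed
  ultimately show thesis using that by blast
qed

text \<open>For a finite subset F of M, the multiplier s of \<open>frobenius_multiplier\<close>
  makes s / \<pi> an element that maps F into \<open>D\<close>. Hence y in the t-closure of M
  satisfies y s \<in> \<pi> D, so y s lies in M, and y lies in M because s does not.\<close>

lemma maximal_over_frobenius_t_maximal:
  assumes M: "max_ideal M" and pi: "\<pi> \<in> M" "\<pi> \<noteq> 0" and q: "q > 1"
    and frob: "\<And>x. x \<in> D \<Longrightarrow> \<exists>d\<in>D. x ^ q - x = \<pi> * d"
  shows "t_maximal D M"
proof -
  have M': "M \<subseteq> D" "submod M" "1 \<notin> M" using M by (auto simp: max_ideal_def)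
  have pr: "prime_id M" by (rule max_ideal_prime[OF M])
  have "t_closure D M \<subseteq> M"
  proof
    fix y assume y: "y \<in> t_closure D M"
    then obtain F where F: "finite F" "F \<subseteq> M" "\<And>x. (\<forall>z\<in>F. x * z \<in> D) \<Longrightarrow> y * x \<in> D"
      unfolding mem_t_closure_iff[OF M'(2)] by blast
    obtain s where s: "s \<in> D - M" "\<And>z. z \<in> F \<Longrightarrow> \<exists>d\<in>D. s * z = \<pi> * d"
      using frobenius_multiplier[OF pr q frob F(1,2)] by metis
    have "(s / \<pi>) * z \<in> D" if "z \<in> F" for z
    proof -
      from s(2)[OF that] obtain d where "d \<in> D" "s * z = \<pi> * d" by blast
      then show ?thesis using pi by simp
    qed
    then have "\<forall>z\<in>F. (s / \<pi>) * z \<in> D" by blast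
    then have "y * (s / \<pi>) \<in> D" by (rule F(3))
    then have "y * s \<in> M" using submod_mult[OF M'(2), of "y * (s / \<pi>)" \<pi>] pi by simp
    moreover have "y \<in> D" using y t_closure_subset_D M' by blast
    ultimately show "y \<in> M" using pr s by (auto simp: prime_id_def)
  qed
  then have t: "proper_t_ideal D M" using M' pi by (auto simp: proper_t_ideal_iff)
  show ?thesis
    unfolding t_maximal_def
  proof (intro conjI allI impI t)
    fix I assume "proper_t_ideal D I \<and> M \<subseteq> I"
    then have I: "I \<subseteq> D" "submod I" "1 \<notin> I" "M \<subseteq> I" by (auto simp: proper_t_ideal_iff)
    have "I \<subseteq> M"
    proof
      fix x assume "x \<in> I"
      show "x \<in> M"
      proof (rule ccontr)
        assume "x \<notin> M"
        then have "x \<in> D - M" using \<open>x \<in> I\<close> I(1) by blast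
        then obtain y where y: "y \<in> D" "x * y - 1 \<in> M" using M unfolding max_ideal_def by blast
        have "x * y - (x * y - 1) \<in> I"
          using submod_diff[OF I(2) submod_mult_right[OF I(2) \<open>x \<in> I\<close> y(1)]] y(2) I(4) by blast
        then show False using I(3) by simp
      qed
    qed
    then show "I = M" using I(4) by simp
  qed
qed

text \<open>Finiteness: the monic polynomial X^q - X has all its values in M, so by interpolation at
  infinitely many residue classes some s outside M would lie in M. Divisibility: a generator of the
  cyclic multiplicative group has order N - 1 and satisfies a^(q-1) = 1.\<close>

lemma maximal_over_frobenius_norm:
  assumes M: "max_ideal M" and q: "q > 1"
    and frob: "\<And>x. x \<in> D \<Longrightarrow> x ^ q - x \<in> M"
  shows "finite_norm D M" "ideal_norm D M - 1 dvd q - 1"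
proof -
  have pr: "prime_id M" by (rule max_ideal_prime[OF M])
  have M': "M \<subseteq> D" "submod M" "1 \<notin> M" using M by (auto simp: max_ideal_def)
  show fin: "finite_norm D M"
  proof (rule finite_normI[OF M'(1,2)])
    fix u :: "nat \<Rightarrow> 'k"
    assume u: "\<And>i. u i \<in> D" "\<And>i j. i \<noteq> j \<Longrightarrow> u i - u j \<notin> M"
    let ?f = "monom 1 q - monom 1 1 :: 'k poly"
    have deg: "degree ?f \<le> q" using q by (intro degree_diff_le) (auto simp: degree_monom_eq)
    have "poly ?f (u i) \<in> M" for i using frob[OF u(1)] by (simp add: poly_monom)
    then have "\<exists>s\<in>D - M. s * coeff ?f q \<in> M"
      by (intro newton_coeff_mem_distinct[OF pr M'(2) u deg])
    then show False using q by simp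
  qed
  interpret F: field "ring_on D Quot M" by (rule residue_field[OF M])
  interpret G: group "mult_of (ring_on D Quot M)" by (rule F.field_mult_group)
  have finF: "finite (carrier (ring_on D Quot M))" using fin by (simp add: finite_norm_def)
  obtain a where a: "a \<in> carrier (mult_of (ring_on D Quot M))"
    "carrier (mult_of (ring_on D Quot M)) = {a[^]\<^bsub>ring_on D Quot M\<^esub>i | i::nat . i \<in> UNIV}"
    using F.finite_field_mult_group_has_gen[OF finF] by blast
  interpret h: ring_hom_cring "ring_on D" "ring_on D Quot M" "(+>\<^bsub>ring_on D\<^esub>) M"
    by (rule residue_hom[OF pr])
  have zero: "M +>\<^bsub>ring_on D\<^esub> x = \<zero>\<^bsub>ring_on D Quot M\<^esub> \<longleftrightarrow> x \<in> M" if "x \<in> D" for x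
    using coset_eq_iff[OF M'(1,2) that, of 0] h.hom_zero by simp
  obtain x where x: "x \<in> D" "a = M +>\<^bsub>ring_on D\<^esub> x" "x \<notin> M"
    using a(1) zero by (auto simp: carrier_Quot)
  have "x * (x ^ (q - 1) - 1) = x ^ q - x"
    using q by (simp add: algebra_simps flip: power_Suc)
  then have "x * (x ^ (q - 1) - 1) \<in> M" using frob[OF x(1)] by simp
  then have "x ^ (q - 1) - 1 \<in> M"
    using pr x diff_mem[OF power_mem[OF x(1)] one_mem] by (auto simp: prime_id_def)
  then have "M +>\<^bsub>ring_on D\<^esub> x ^ (q - 1) = M +>\<^bsub>ring_on D\<^esub> 1"
    using coset_eq_iff[OF M'(1,2) power_mem[OF x(1)] one_mem] by simp
  then have "a [^]\<^bsub>ring_on D Quot M\<^esub> (q - 1) = \<one>\<^bsub>ring_on D Quot M\<^esub>"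
    using residue_power[OF pr x(1)] h.hom_one x(2) by simp
  then have "G.ord a dvd q - 1"
    using G.pow_eq_id[OF a(1), of "q - 1"] by (simp add: nat_pow_mult_of)
  moreover have "G.ord a = Coset.order (mult_of (ring_on D Quot M))"
    unfolding G.generate_pow_card[OF a(1)] Coset.order_def
    using G.generate_pow_on_finite_carrier[OF F.finite_mult_of[OF finF] a(1)] a(2)
    by (simp add: nat_pow_mult_of)
  moreover have "Coset.order (mult_of (ring_on D Quot M)) = ideal_norm D M - 1"
    using F.order_mult_of[OF finF] by (simp add: Coset.order_def ideal_norm_def)
  ultimately show "ideal_norm D M - 1 dvd q - 1" by simp
qed

context
  fixes M assumes M: "max_ideal M" and fin: "finite_norm D M"
begin

lemma max_norm_gt_1: "ideal_norm D M > 1"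
proof -
  interpret F: field "ring_on D Quot M" by (rule residue_field[OF M])
  have "card {\<zero>\<^bsub>ring_on D Quot M\<^esub>, \<one>\<^bsub>ring_on D Quot M\<^esub>} \<le> ideal_norm D M"
    unfolding ideal_norm_def using fin by (intro card_mono) (auto simp: finite_norm_def)
  then show ?thesis by simp
qed

lemma max_norm_frobenius:
  assumes "x \<in> D"
  shows "x ^ ideal_norm D M - x \<in> M"
proof -
  let ?N = "ideal_norm D M"
  have pr: "prime_id M" by (rule max_ideal_prime[OF M])
  have M': "M \<subseteq> D" "submod M" using M by (auto simp: max_ideal_def)
  interpret F: field "ring_on D Quot M" by (rule residue_field[OF M])
  interpret G: group "mult_of (ring_on D Quot M)" by (rule F.field_mult_group)
  have finF: "finite (carrier (ring_on D Quot M))" using fin by (simp add: finite_norm_def)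
  interpret h: ring_hom_cring "ring_on D" "ring_on D Quot M" "(+>\<^bsub>ring_on D\<^esub>) M"
    by (rule residue_hom[OF pr])
  show ?thesis
  proof (cases "x \<in> M")
    case True
    have "x ^ ?N = x ^ (?N - 1) * x" using max_norm_gt_1 by (simp flip: power_Suc2)
    then show ?thesis using True submod_mult[OF M'(2) power_mem[OF assms]] submod_diff[OF M'(2)] by metis
  next
    case False
    let ?a = "M +>\<^bsub>ring_on D\<^esub> x"
    have a: "?a \<in> carrier (mult_of (ring_on D Quot M))"
      using False coset_eq_iff[OF M' assms, of 0] h.hom_zero assms h.hom_closed[of x] by simp
    have "?a [^]\<^bsub>ring_on D Quot M\<^esub> (?N - 1) = \<one>\<^bsub>ring_on D Quot M\<^esub>"
      using G.pow_order_eq_1[OF a] F.order_mult_of[OF finF]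
      by (simp add: nat_pow_mult_of Coset.order_def ideal_norm_def)
    then have "M +>\<^bsub>ring_on D\<^esub> (x ^ (?N - 1)) = M +>\<^bsub>ring_on D\<^esub> 1"
      using residue_power[OF pr assms] h.hom_one by simp
    then have "x ^ (?N - 1) - 1 \<in> M"
      using coset_eq_iff[OF M' power_mem[OF assms] one_mem] by simp
    then have "x * (x ^ (?N - 1) - 1) \<in> M" using submod_mult[OF M'(2) assms] by simp
    then show ?thesis using max_norm_gt_1 by (simp add: algebra_simps flip: power_Suc)
  qed
qed

text \<open>By Cauchy's theorem in the additive group, every prime divisor of the norm is zero in the
  residue field; two of them would generate 1.\<close>

lemma max_norm_primepow: "primepow (ideal_norm D M)"
proof -
  let ?N = "ideal_norm D M" and ?F = "ring_on D Quot M"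
  have pr: "prime_id M" by (rule max_ideal_prime[OF M])
  have M': "M \<subseteq> D" "submod M" "1 \<notin> M" using M by (auto simp: max_ideal_def)
  interpret F: field "ring_on D Quot M" by (rule residue_field[OF M])
  interpret h: ring_hom_cring "ring_on D" "ring_on D Quot M" "(+>\<^bsub>ring_on D\<^esub>) M"
    by (rule residue_hom[OF pr])
  have finF: "finite (carrier ?F)" using fin by (simp add: finite_norm_def)
  have zero: "M +>\<^bsub>ring_on D\<^esub> x = \<zero>\<^bsub>?F\<^esub> \<longleftrightarrow> x \<in> M" if "x \<in> D" for x
    using coset_eq_iff[OF M'(1,2) that, of 0] h.hom_zero by simp
  have mem: "of_nat r \<in> M" if r: "prime r" "r dvd ?N" for r :: nat
  proof -
    interpret A: group "add_monoid ?F" by (rule F.a_group)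
    obtain m where "Coset.order (add_monoid ?F) = r ^ 1 * m"
      using r(2) by (auto simp: Coset.order_def ideal_norm_def)
    then obtain H where H: "subgroup H (add_monoid ?F)" "card H = r"
      using sylow_thm[OF r(1) F.a_group, of 1 m] finF by auto
    have "\<exists>y\<in>H. y \<noteq> \<zero>\<^bsub>?F\<^esub>"
    proof (rule ccontr)
      assume "\<not> ?thesis"
      then have "H \<subseteq> {\<zero>\<^bsub>?F\<^esub>}" by auto
      then have "card H \<le> 1" using card_mono[of "{\<zero>\<^bsub>?F\<^esub>}" H] by simp
      then show False using H(2) prime_gt_1_nat[OF r(1)] by simp
    qed
    then obtain y where y: "y \<in> H" "y \<noteq> \<zero>\<^bsub>?F\<^esub>" by blast
    have yF: "y \<in> carrier ?F" using subgroup.mem_carrier[OF H(1) y(1)] by simp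
    interpret H: group "(add_monoid ?F)\<lparr>carrier := H\<rparr>"
      by (rule subgroup.subgroup_is_group[OF H(1) F.a_group])
    have "y [^]\<^bsub>(add_monoid ?F)\<lparr>carrier := H\<rparr>\<^esub> r = \<one>\<^bsub>(add_monoid ?F)\<lparr>carrier := H\<rparr>\<^esub>"
      using H.pow_order_eq_1[of y] y(1) H(2) by (simp add: Coset.order_def)
    then have ry: "[r] \<cdot>\<^bsub>?F\<^esub> y = \<zero>\<^bsub>?F\<^esub>"
      by (simp add: add_pow_def nat_pow_def)
    obtain x where x: "x \<in> D" "y = M +>\<^bsub>ring_on D\<^esub> x" using yF by (auto simp: carrier_Quot)
    have "[r] \<cdot>\<^bsub>?F\<^esub> y = M +>\<^bsub>ring_on D\<^esub> (of_nat r * x)" for r :: nat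
    proof (induction r)
      case 0
      then show ?case using zero[of 0] submod_zero[OF M'(2)] by simp
    next
      case (Suc r)
      have "[Suc r] \<cdot>\<^bsub>?F\<^esub> y = [r] \<cdot>\<^bsub>?F\<^esub> y \<oplus>\<^bsub>?F\<^esub> y" using F.add.nat_pow_Suc by simp
      also have "\<dots> = M +>\<^bsub>ring_on D\<^esub> (of_nat r * x + x)"
        using h.hom_add[of "of_nat r * x" x] Suc x by (simp add: mult_mem)
      finally show ?case by (simp add: algebra_simps)
    qed
    then have "of_nat r * x \<in> M" using ry zero[of "of_nat r * x"] x by (simp add: mult_mem)
    moreover have "x \<notin> M" using y(2) x zero by auto
    ultimately show ?thesis using pr x(1) by (auto simp: prime_id_def)
  qed
  obtain r where r: "prime r" "r dvd ?N" using max_norm_gt_1 prime_factor_nat[of ?N] by auto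
  have "s = r" if "prime s" "s dvd ?N" for s
  proof (rule ccontr)
    assume "s \<noteq> r"
    then have "coprime (int s) (int r)" using that r by (simp add: primes_coprime)
    then obtain a b where "a * int s + b * int r = 1"
      using bezout_int[of "int s" "int r"] by auto
    then have "of_int a * of_nat s + of_int b * of_nat r = (1::'k)"
      by (metis of_int_1 of_int_add of_int_mult of_int_of_nat_eq)
    moreover have "of_int a \<in> D" for a :: int
      by (cases a) (auto simp del: of_nat_Suc intro: uminus_mem)
    ultimately have "1 \<in> M"
      using mem[OF that] mem[OF r] submod_add[OF M'(2)] submod_mult[OF M'(2)] by metis
    then show False using M' by simp
  qed
  then have "x \<in> prime_factors ?N \<longleftrightarrow> x = r" for x
    using r max_norm_gt_1 by (metis in_prime_factors_iff not_one_less_zero)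
  then have "prime_factors ?N = {r}" by blast
  then have "?N = r ^ multiplicity r ?N"
    using prime_factorization_nat[of ?N] max_norm_gt_1 by simp
  moreover have "multiplicity r ?N > 0"
    using r max_norm_gt_1 by (simp add: prime_multiplicity_gt_zero_iff)
  ultimately show ?thesis using r(1) by (metis primepow_prime_power)
qed

end

lemma t_maximal_finite_norm_max:
  "t_maximal D p \<Longrightarrow> finite_norm D p \<Longrightarrow> max_ideal p"
  by (rule prime_finite_norm_max[OF t_maximal_prime])

lemma Pi_ideal_frobenius:
  assumes "x \<in> D"
  shows "x ^ q - x \<in> Pi_ideal D q"
  unfolding Pi_ideal_def
  using max_norm_frobenius[OF t_maximal_finite_norm_max _ assms] assms by (auto intro!: diff_mem power_mem)

end

section \<open>Spans and subalgebras\<close>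

context algebra begin

text \<open>Growing a combination by one term at a time avoids finite sums over algebra records;
  \<open>lin_span_expansion\<close> recovers such sums where coefficients matter.\<close>

inductive_set lin_span :: "'c set \<Rightarrow> 'c set" for S where
  zero: "\<zero>\<^bsub>M\<^esub> \<in> lin_span S"
| step: "x \<in> lin_span S \<Longrightarrow> r \<in> carrier R \<Longrightarrow> s \<in> S \<Longrightarrow> x \<oplus>\<^bsub>M\<^esub> r \<odot>\<^bsub>M\<^esub> s \<in> lin_span S"

inductive_set alg_gen :: "'c set \<Rightarrow> 'c set" for G where
  one: "\<one>\<^bsub>M\<^esub> \<in> alg_gen G"
| gen: "g \<in> G \<Longrightarrow> g \<in> alg_gen G"
| add: "x \<in> alg_gen G \<Longrightarrow> y \<in> alg_gen G \<Longrightarrow> x \<oplus>\<^bsub>M\<^esub> y \<in> alg_gen G"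
| mult: "x \<in> alg_gen G \<Longrightarrow> y \<in> alg_gen G \<Longrightarrow> x \<otimes>\<^bsub>M\<^esub> y \<in> alg_gen G"
| smult: "r \<in> carrier R \<Longrightarrow> x \<in> alg_gen G \<Longrightarrow> r \<odot>\<^bsub>M\<^esub> x \<in> alg_gen G"

lemma smult_assoc2_right:
  assumes "r \<in> carrier R" "x \<in> carrier M" "y \<in> carrier M"
  shows "x \<otimes>\<^bsub>M\<^esub> (r \<odot>\<^bsub>M\<^esub> y) = r \<odot>\<^bsub>M\<^esub> (x \<otimes>\<^bsub>M\<^esub> y)"
  using smult_assoc2[of r y x] assms by (simp add: m_comm[of x])

lemma lin_span_closed:
  assumes "S \<subseteq> carrier M" "x \<in> lin_span S"
  shows "x \<in> carrier M"
  using assms(2,1) by induction auto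

lemma lin_span_base:
  assumes "S \<subseteq> carrier M" "s \<in> S"
  shows "s \<in> lin_span S"
  using lin_span.step[OF lin_span.zero R.one_closed assms(2)] assms by auto

lemma lin_span_add:
  assumes "S \<subseteq> carrier M" "x \<in> lin_span S" "y \<in> lin_span S"
  shows "x \<oplus>\<^bsub>M\<^esub> y \<in> lin_span S"
  using assms(3,1,2)
proof induction
  case zero
  then show ?case using lin_span_closed by auto
next
  case (step z r s)
  then have "(x \<oplus>\<^bsub>M\<^esub> z) \<oplus>\<^bsub>M\<^esub> r \<odot>\<^bsub>M\<^esub> s \<in> lin_span S" by (auto intro: lin_span.step)
  then show ?case
    using step lin_span_closed[OF step.prems(1)] by (subst (asm) M.a_assoc) auto
qed

lemma lin_span_smult:
  assumes "S \<subseteq> carrier M" "x \<in> lin_span S" "r \<in> carrier R"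
  shows "r \<odot>\<^bsub>M\<^esub> x \<in> lin_span S"
  using assms(2,1,3)
proof induction
  case zero
  then show ?case by (auto intro: lin_span.zero)
next
  case (step z t s)
  have "r \<odot>\<^bsub>M\<^esub> z \<oplus>\<^bsub>M\<^esub> (r \<otimes> t) \<odot>\<^bsub>M\<^esub> s \<in> lin_span S"
    using step by (auto intro: lin_span.step)
  moreover have "r \<odot>\<^bsub>M\<^esub> (z \<oplus>\<^bsub>M\<^esub> t \<odot>\<^bsub>M\<^esub> s) = r \<odot>\<^bsub>M\<^esub> z \<oplus>\<^bsub>M\<^esub> (r \<otimes> t) \<odot>\<^bsub>M\<^esub> s"
    using step lin_span_closed[OF step.prems(1)] by (auto simp: smult_r_distr smult_assoc1)
  ultimately show ?case by simp
qed

text \<open>Multiplication by x is linear, so only its effect on the spanning set has to be known;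
  distinct sets S and T let the span change under multiplication.\<close>

lemma lin_span_mult:
  assumes "S \<subseteq> carrier M" "T \<subseteq> carrier M" "x \<in> carrier M"
    and "\<And>s. s \<in> S \<Longrightarrow> x \<otimes>\<^bsub>M\<^esub> s \<in> lin_span T" "y \<in> lin_span S"
  shows "x \<otimes>\<^bsub>M\<^esub> y \<in> lin_span T"
  using assms(5)
proof induction
  case zero
  then show ?case using assms by (auto intro: lin_span.zero)
next
  case (step z r s)
  have s: "s \<in> carrier M" "z \<in> carrier M"
    using step assms lin_span_closed[OF assms(1)] by auto
  have "x \<otimes>\<^bsub>M\<^esub> (r \<odot>\<^bsub>M\<^esub> s) = r \<odot>\<^bsub>M\<^esub> (x \<otimes>\<^bsub>M\<^esub> s)"
    using step s assms(3) by (simp add: smult_assoc2_right)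
  then have "x \<otimes>\<^bsub>M\<^esub> (z \<oplus>\<^bsub>M\<^esub> r \<odot>\<^bsub>M\<^esub> s) = x \<otimes>\<^bsub>M\<^esub> z \<oplus>\<^bsub>M\<^esub> r \<odot>\<^bsub>M\<^esub> (x \<otimes>\<^bsub>M\<^esub> s)"
    using step s assms(3) by (simp add: r_distr)
  also have "\<dots> \<in> lin_span T"
    using step assms by (intro lin_span_add lin_span_smult) auto
  finally show ?case .
qed

lemma lin_span_subset:
  assumes "S \<subseteq> carrier M" "T \<subseteq> carrier M" "S \<subseteq> lin_span T"
  shows "lin_span S \<subseteq> lin_span T"
proof
  fix y assume "y \<in> lin_span S"
  then show "y \<in> lin_span T"
  proof induction
    case (step x r s)
    then have "s \<in> lin_span T" using assms(3) by blast
    then show ?case using step by (intro lin_span_add lin_span_smult assms(2))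
  qed (rule lin_span.zero)
qed

lemma alg_gen_closed:
  assumes "G \<subseteq> carrier M" "x \<in> alg_gen G"
  shows "x \<in> carrier M"
  using assms(2,1) by induction auto

lemma alg_gen_minus:
  assumes "G \<subseteq> carrier M" "x \<in> alg_gen G" "y \<in> alg_gen G"
  shows "x \<ominus>\<^bsub>M\<^esub> y \<in> alg_gen G"
proof -
  have "x \<oplus>\<^bsub>M\<^esub> (\<ominus>\<^bsub>R\<^esub> \<one>\<^bsub>R\<^esub>) \<odot>\<^bsub>M\<^esub> y \<in> alg_gen G"
    using assms by (auto intro: alg_gen.intros)
  then show ?thesis
    using alg_gen_closed[OF assms(1,3)] by (simp add: smult_l_minus a_minus_def)
qed

text \<open>The elements that multiply the span into itself form a subalgebra.\<close>

lemma alg_gen_subset_lin_span: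
  assumes S: "S \<subseteq> carrier M" and G: "G \<subseteq> carrier M" and one: "\<one>\<^bsub>M\<^esub> \<in> lin_span S"
    and closed: "\<And>g s. g \<in> G \<Longrightarrow> s \<in> S \<Longrightarrow> g \<otimes>\<^bsub>M\<^esub> s \<in> lin_span S"
  shows "alg_gen G \<subseteq> lin_span S"
proof
  fix x assume x: "x \<in> alg_gen G"
  note c = lin_span_closed[OF S] alg_gen_closed[OF G]
  have "x \<otimes>\<^bsub>M\<^esub> y \<in> lin_span S" if "y \<in> lin_span S" for y
    using x that
  proof (induction arbitrary: y)
    case one
    then show ?case using c by simp
  next
    case (gen g)
    then show ?case using lin_span_mult[OF S S _ closed] G by blast
  next
    case (add x z)
    then have "(x \<oplus>\<^bsub>M\<^esub> z) \<otimes>\<^bsub>M\<^esub> y = x \<otimes>\<^bsub>M\<^esub> y \<oplus>\<^bsub>M\<^esub> z \<otimes>\<^bsub>M\<^esub> y" using c by (simp add: l_distr)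
    then show ?case using add lin_span_add[OF S] by simp
  next
    case (mult x z)
    then have "(x \<otimes>\<^bsub>M\<^esub> z) \<otimes>\<^bsub>M\<^esub> y = x \<otimes>\<^bsub>M\<^esub> (z \<otimes>\<^bsub>M\<^esub> y)" using c by (simp add: m_assoc)
    then show ?case using mult by simp
  next
    case (smult r x)
    then have "(r \<odot>\<^bsub>M\<^esub> x) \<otimes>\<^bsub>M\<^esub> y = r \<odot>\<^bsub>M\<^esub> (x \<otimes>\<^bsub>M\<^esub> y)" using c by (simp add: smult_assoc2)
    then show ?case using smult lin_span_smult[OF S] by simp
  qed
  from this[OF one] show "x \<in> lin_span S" using c x by simp
qed

lemma alg_gen_mono: "x \<in> alg_gen G \<Longrightarrow> G \<subseteq> H \<Longrightarrow> x \<in> alg_gen H"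
  by (induction rule: alg_gen.induct) (auto intro: alg_gen.intros)

lemma alg_gen_power: "x \<in> alg_gen G \<Longrightarrow> x [^]\<^bsub>M\<^esub> (n::nat) \<in> alg_gen G"
  by (induction n) (auto intro: alg_gen.intros)

lemma smult_smult_mult:
  assumes "r \<in> carrier R" "t \<in> carrier R" "x \<in> carrier M" "y \<in> carrier M"
  shows "(r \<odot>\<^bsub>M\<^esub> x) \<otimes>\<^bsub>M\<^esub> (t \<odot>\<^bsub>M\<^esub> y) = (r \<otimes> t) \<odot>\<^bsub>M\<^esub> (x \<otimes>\<^bsub>M\<^esub> y)"
proof -
  have "(r \<odot>\<^bsub>M\<^esub> x) \<otimes>\<^bsub>M\<^esub> (t \<odot>\<^bsub>M\<^esub> y) = r \<odot>\<^bsub>M\<^esub> (x \<otimes>\<^bsub>M\<^esub> (t \<odot>\<^bsub>M\<^esub> y))"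
    using assms by (simp add: smult_assoc2)
  also have "x \<otimes>\<^bsub>M\<^esub> (t \<odot>\<^bsub>M\<^esub> y) = t \<odot>\<^bsub>M\<^esub> (x \<otimes>\<^bsub>M\<^esub> y)"
    using assms by (simp add: smult_assoc2_right)
  finally show ?thesis using assms by (simp add: smult_assoc1)
qed

end

section \<open>Homomorphisms from their graphs\<close>

lemma algebra_on_simps [simp]:
  "carrier (algebra_on s S) = S" "monoid.mult (algebra_on s S) = (*)" "monoid.one (algebra_on s S) = 1"
  "ring.zero (algebra_on s S) = 0" "ring.add (algebra_on s S) = (+)" "module.smult (algebra_on s S) = s"
  by (simp_all add: algebra_on_def)

lemma nat_pow_algebra_on [simp]: "x [^]\<^bsub>algebra_on s S\<^esub> (n::nat) = x ^ n"
  by (induction n) (simp_all add: nat_pow_def mult.commute)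

text \<open>Scalars act through a ring homomorphism \<iota>, so the module axioms reduce to ring
  laws, and only closure of the subset \<open>S\<close> remains to be checked.\<close>

lemma algebra_algebra_on:
  fixes \<iota> :: "'k::comm_ring_1 \<Rightarrow> 'r::comm_ring_1"
  assumes D: "cring (ring_on D)"
    and \<iota>: "\<And>a b. \<iota> (a + b) = \<iota> a + \<iota> b" "\<And>a b. \<iota> (a * b) = \<iota> a * \<iota> b" "\<iota> 1 = 1"
    and s: "\<And>c x. s c x = \<iota> c * x"
    and S: "0 \<in> S" "1 \<in> S" "\<And>x y. x \<in> S \<Longrightarrow> y \<in> S \<Longrightarrow> x + y \<in> S"
    "\<And>x y. x \<in> S \<Longrightarrow> y \<in> S \<Longrightarrow> x * y \<in> S" "\<And>x. x \<in> S \<Longrightarrow> - x \<in> S"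
    "\<And>c x. c \<in> D \<Longrightarrow> x \<in> S \<Longrightarrow> s c x \<in> S"
  shows "algebra (ring_on D) (algebra_on s S)"
proof (rule algebraI[OF D])
  show "cring (algebra_on s S)"
  proof (rule cringI)
    show "abelian_group (algebra_on s S)"
      by (rule abelian_groupI) (use S in \<open>auto simp: add_ac intro!: bexI[of _ "- _"]\<close>)
    show "comm_monoid (algebra_on s S)"
      by (rule comm_monoidI) (use S in \<open>auto simp: mult_ac\<close>)
  qed (auto simp: algebra_simps)
qed (use S in \<open>auto simp: s \<iota> algebra_simps\<close>)

definition prod_algebra ::
  "('k, 'r, 'm) module_scheme \<Rightarrow> ('k, 'a, 'n) module_scheme \<Rightarrow> ('k, 'r \<times> 'a) module" where
  "prod_algebra P A =
     \<lparr>carrier = carrier P \<times> carrier A,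
      monoid.mult = (\<lambda>x y. (fst x \<otimes>\<^bsub>P\<^esub> fst y, snd x \<otimes>\<^bsub>A\<^esub> snd y)), one = (\<one>\<^bsub>P\<^esub>, \<one>\<^bsub>A\<^esub>),
      zero = (\<zero>\<^bsub>P\<^esub>, \<zero>\<^bsub>A\<^esub>), add = (\<lambda>x y. (fst x \<oplus>\<^bsub>P\<^esub> fst y, snd x \<oplus>\<^bsub>A\<^esub> snd y)),
      module.smult = (\<lambda>r x. (r \<odot>\<^bsub>P\<^esub> fst x, r \<odot>\<^bsub>A\<^esub> snd x))\<rparr>"

lemma prod_algebra_simps [simp]:
  "carrier (prod_algebra P A) = carrier P \<times> carrier A"
  "x \<otimes>\<^bsub>prod_algebra P A\<^esub> y = (fst x \<otimes>\<^bsub>P\<^esub> fst y, snd x \<otimes>\<^bsub>A\<^esub> snd y)"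
  "\<one>\<^bsub>prod_algebra P A\<^esub> = (\<one>\<^bsub>P\<^esub>, \<one>\<^bsub>A\<^esub>)"
  "\<zero>\<^bsub>prod_algebra P A\<^esub> = (\<zero>\<^bsub>P\<^esub>, \<zero>\<^bsub>A\<^esub>)"
  "x \<oplus>\<^bsub>prod_algebra P A\<^esub> y = (fst x \<oplus>\<^bsub>P\<^esub> fst y, snd x \<oplus>\<^bsub>A\<^esub> snd y)"
  "r \<odot>\<^bsub>prod_algebra P A\<^esub> x = (r \<odot>\<^bsub>P\<^esub> fst x, r \<odot>\<^bsub>A\<^esub> snd x)"
  by (simp_all add: prod_algebra_def)

lemma nat_pow_prod_algebra [simp]:
  "x [^]\<^bsub>prod_algebra P A\<^esub> (n::nat) = (fst x [^]\<^bsub>P\<^esub> n, snd x [^]\<^bsub>A\<^esub> n)"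
  by (induction n) (simp_all add: nat_pow_def)

lemma algebra_prod_algebra:
  assumes "algebra R P" "algebra R A"
  shows "algebra R (prod_algebra P A)"
proof -
  interpret P: algebra R P by fact
  interpret A: algebra R A by fact
  show ?thesis
  proof (rule algebraI[OF P.R_cring])
    show "cring (prod_algebra P A)"
    proof (rule cringI)
      show "abelian_group (prod_algebra P A)"
      proof (rule abelian_groupI)
        fix x assume "x \<in> carrier (prod_algebra P A)"
        then show "\<exists>y\<in>carrier (prod_algebra P A). y \<oplus>\<^bsub>prod_algebra P A\<^esub> x = \<zero>\<^bsub>prod_algebra P A\<^esub>"
          by (intro bexI[of _ "(\<ominus>\<^bsub>P\<^esub> fst x, \<ominus>\<^bsub>A\<^esub> snd x)"]) (auto simp: P.M.l_neg A.M.l_neg)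
      qed (auto simp: P.M.a_ac A.M.a_ac)
      show "comm_monoid (prod_algebra P A)"
        by (rule comm_monoidI) (auto simp: P.m_ac A.m_ac)
    qed (auto simp: P.l_distr A.l_distr)
  qed (auto simp: P.smult_l_distr A.smult_l_distr P.smult_r_distr A.smult_r_distr
      P.smult_assoc1 A.smult_assoc1 P.smult_assoc2 A.smult_assoc2)
qed

lemma algebra_homI:
  assumes "\<And>x. x \<in> carrier A \<Longrightarrow> h x \<in> carrier B"
    "\<And>x y. x \<in> carrier A \<Longrightarrow> y \<in> carrier A \<Longrightarrow> h (x \<otimes>\<^bsub>A\<^esub> y) = h x \<otimes>\<^bsub>B\<^esub> h y"
    "\<And>x y. x \<in> carrier A \<Longrightarrow> y \<in> carrier A \<Longrightarrow> h (x \<oplus>\<^bsub>A\<^esub> y) = h x \<oplus>\<^bsub>B\<^esub> h y"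
    "h \<one>\<^bsub>A\<^esub> = \<one>\<^bsub>B\<^esub>"
    "\<And>r x. r \<in> carrier R \<Longrightarrow> x \<in> carrier A \<Longrightarrow> h (r \<odot>\<^bsub>A\<^esub> x) = r \<odot>\<^bsub>B\<^esub> h x"
  shows "h \<in> algebra_hom R A B"
  using assms by (auto simp: algebra_hom_def intro!: ring_hom_memI)

lemma algebra_homD:
  assumes "h \<in> algebra_hom R A B"
  shows "\<And>x. x \<in> carrier A \<Longrightarrow> h x \<in> carrier B"
    "\<And>x y. x \<in> carrier A \<Longrightarrow> y \<in> carrier A \<Longrightarrow> h (x \<otimes>\<^bsub>A\<^esub> y) = h x \<otimes>\<^bsub>B\<^esub> h y"
    "\<And>x y. x \<in> carrier A \<Longrightarrow> y \<in> carrier A \<Longrightarrow> h (x \<oplus>\<^bsub>A\<^esub> y) = h x \<oplus>\<^bsub>B\<^esub> h y"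
    "h \<one>\<^bsub>A\<^esub> = \<one>\<^bsub>B\<^esub>"
    "\<And>r x. r \<in> carrier R \<Longrightarrow> x \<in> carrier A \<Longrightarrow> h (r \<odot>\<^bsub>A\<^esub> x) = r \<odot>\<^bsub>B\<^esub> h x"
  using assms by (auto simp: algebra_hom_def ring_hom_mult ring_hom_add ring_hom_one intro: ring_hom_closed)

text \<open>Two elements of a fibre of the subalgebra over f differ by an element of the fibre over
  0, so a trivial fibre over 0 makes it a graph. \<open>Q\<close> shares the operations of
  \<open>P\<close>, and its carrier is covered by the projection.\<close>

lemma algebra_hom_of_graph:
  assumes P: "algebra R P" and A: "algebra R A" and G: "G \<subseteq> carrier P \<times> carrier A"
    and functional: "\<And>\<alpha>. (\<zero>\<^bsub>P\<^esub>, \<alpha>) \<in> algebra.alg_gen R (prod_algebra P A) G \<Longrightarrow> \<alpha> = \<zero>\<^bsub>A\<^esub>"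
    and img: "carrier Q \<subseteq> fst ` algebra.alg_gen R (prod_algebra P A) G"
    and Q: "monoid.mult Q = monoid.mult P" "monoid.one Q = monoid.one P" "ring.add Q = ring.add P"
      "module.smult Q = module.smult P"
  obtains h where "h \<in> algebra_hom R Q A"
    "\<And>f \<alpha>. (f, \<alpha>) \<in> algebra.alg_gen R (prod_algebra P A) G \<Longrightarrow> h f = \<alpha>"
proof -
  interpret P: algebra R P by fact
  interpret A: algebra R A by fact
  interpret B: algebra R "prod_algebra P A" by (rule algebra_prod_algebra[OF P A])
  let ?\<Gamma> = "B.alg_gen G"
  have G': "G \<subseteq> carrier (prod_algebra P A)" using G by simp
  have cl: "f \<in> carrier P" "\<alpha> \<in> carrier A" if "(f, \<alpha>) \<in> ?\<Gamma>" for f \<alpha>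
    using B.alg_gen_closed[OF G' that] by auto
  have uniq: "\<alpha> = \<beta>" if "(f, \<alpha>) \<in> ?\<Gamma>" "(f, \<beta>) \<in> ?\<Gamma>" for f \<alpha> \<beta>
  proof -
    have "(f, \<alpha>) \<oplus>\<^bsub>prod_algebra P A\<^esub> (\<ominus>\<^bsub>R\<^esub> \<one>\<^bsub>R\<^esub>) \<odot>\<^bsub>prod_algebra P A\<^esub> (f, \<beta>) \<in> ?\<Gamma>"
      by (intro B.alg_gen.add B.alg_gen.smult that) auto
    then have "(f \<ominus>\<^bsub>P\<^esub> f, \<alpha> \<ominus>\<^bsub>A\<^esub> \<beta>) \<in> ?\<Gamma>"
      using cl that by (simp add: P.smult_l_minus A.smult_l_minus a_minus_def)
    then have "\<alpha> \<ominus>\<^bsub>A\<^esub> \<beta> = \<zero>\<^bsub>A\<^esub>" using functional cl that by (simp add: P.M.r_neg a_minus_def)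
    then show ?thesis using cl that A.r_right_minus_eq by simp
  qed
  define h where "h f = (THE \<alpha>. (f, \<alpha>) \<in> ?\<Gamma>)" for f
  have h: "h f = \<alpha>" if "(f, \<alpha>) \<in> ?\<Gamma>" for f \<alpha>
    unfolding h_def using uniq that by blast
  have ex: "(f, h f) \<in> ?\<Gamma>" if "f \<in> carrier Q" for f
  proof -
    from that img obtain x where "x \<in> ?\<Gamma>" "f = fst x" by blast
    then have "(f, snd x) \<in> ?\<Gamma>" by simp
    then show ?thesis using h by metis
  qed
  have "h \<in> algebra_hom R Q A"
  proof (rule algebra_homI)
    fix x assume x: "x \<in> carrier Q"
    then show "h x \<in> carrier A" using ex cl by blast
    fix r assume "r \<in> carrier R"
    then show "h (r \<odot>\<^bsub>Q\<^esub> x) = r \<odot>\<^bsub>A\<^esub> h x"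
      using h B.alg_gen.smult[OF _ ex[OF x]] Q by simp
  next
    fix x y assume "x \<in> carrier Q" "y \<in> carrier Q"
    then show "h (x \<otimes>\<^bsub>Q\<^esub> y) = h x \<otimes>\<^bsub>A\<^esub> h y" "h (x \<oplus>\<^bsub>Q\<^esub> y) = h x \<oplus>\<^bsub>A\<^esub> h y"
      using h B.alg_gen.mult[OF ex ex] B.alg_gen.add[OF ex ex] Q by simp_all
  next
    show "h \<one>\<^bsub>Q\<^esub> = \<one>\<^bsub>A\<^esub>" using h B.alg_gen.one Q by simp
  qed
  with h that show thesis by blast
qed

text \<open>A polynomial expression in first components lifts by forming the same expression in the
  pairs. It is used to show that a projected graph is large enough.\<close>

lemma fst_alg_gen:
  assumes P: "algebra R P" and A: "algebra R A"
  shows "algebra.alg_gen R P (fst ` G) \<subseteq> fst ` algebra.alg_gen R (prod_algebra P A) G"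
proof -
  interpret P: algebra R P by fact
  interpret A: algebra R A by fact
  interpret B: algebra R "prod_algebra P A" by (rule algebra_prod_algebra[OF P A])
  have "\<exists>\<alpha>. (f, \<alpha>) \<in> B.alg_gen G" if "f \<in> P.alg_gen (fst ` G)" for f
    using that
  proof induction
    case one
    then show ?case using B.alg_gen.one by auto
  next
    case (gen g)
    then show ?case using B.alg_gen.gen by force
  next
    case (add x y)
    then obtain \<alpha> \<beta> where "(x, \<alpha>) \<in> B.alg_gen G" "(y, \<beta>) \<in> B.alg_gen G" by blast
    from B.alg_gen.add[OF this] show ?case by auto
  next
    case (mult x y)
    then obtain \<alpha> \<beta> where "(x, \<alpha>) \<in> B.alg_gen G" "(y, \<beta>) \<in> B.alg_gen G" by blast
    from B.alg_gen.mult[OF this] show ?case by auto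
  next
    case (smult r x)
    then obtain \<alpha> where "(x, \<alpha>) \<in> B.alg_gen G" by blast
    from B.alg_gen.smult[OF smult(1) this] show ?case by auto
  qed
  then show ?thesis by force
qed

text \<open>Both components receive the same index set and the same coefficients, and each m occurs
  once, so that independence of the \<open>E m\<close> can be applied to the first
  component.\<close>

lemma lin_span_expansion:
  assumes P: "algebra (ring_on D) (algebra_on s UNIV)" and A: "algebra (ring_on D) A"
    and \<mu>: "\<And>m. m \<in> I \<Longrightarrow> \<mu> m \<in> carrier A"
    and x: "x \<in> algebra.lin_span (ring_on D) (prod_algebra (algebra_on s UNIV) A) ((\<lambda>m. (E m, \<mu> m)) ` I)"
  shows "\<exists>F c. finite F \<and> F \<subseteq> I \<and> (\<forall>m\<in>F. c m \<in> D) \<and> fst x = (\<Sum>m\<in>F. s (c m) (E m)) \<and>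
           snd x = (\<Oplus>\<^bsub>A\<^esub>m\<in>F. c m \<odot>\<^bsub>A\<^esub> \<mu> m)"
proof -
  interpret P: algebra "ring_on D" "algebra_on s UNIV" by fact
  interpret A: algebra "ring_on D" A by fact
  interpret B: algebra "ring_on D" "prod_algebra (algebra_on s UNIV) A" by (rule algebra_prod_algebra[OF P A])
  from x show ?thesis
  proof induction
    case zero
    show ?case by (intro exI[of _ "{}"]) simp
  next
    case (step x r z)
    then obtain F c where F: "finite F" "F \<subseteq> I" "\<And>m. m \<in> F \<Longrightarrow> c m \<in> D" "fst x = (\<Sum>m\<in>F. s (c m) (E m))"
        "snd x = (\<Oplus>\<^bsub>A\<^esub>m\<in>F. c m \<odot>\<^bsub>A\<^esub> \<mu> m)" by auto
    obtain n where n: "n \<in> I" "z = (E n, \<mu> n)" using step by auto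
    have r: "r \<in> D" using step by simp
    have addD: "a + b \<in> D" if "a \<in> D" "b \<in> D" for a b
      using cring.cring_simprules(1)[OF A.R_cring, of a b] that by simp
    have cl: "c m \<odot>\<^bsub>A\<^esub> \<mu> m \<in> carrier A" if "m \<in> F" for m using that F \<mu> by auto
    \<comment> \<open>An index that already occurs has its coefficient raised by r; a new one starts
      with r.\<close>
    define c' where "c' = c(n := (if n \<in> F then c n + r else r))"
    have 1: "(\<Sum>m\<in>insert n F. s (c' m) (E m)) = (\<Sum>m\<in>F. s (c m) (E m)) + s r (E n)"
    proof (cases "n \<in> F")
      case True
      have "(\<Sum>m\<in>F - {n}. s (c' m) (E m)) = (\<Sum>m\<in>F - {n}. s (c m) (E m))"
        by (rule sum.cong) (auto simp: c'_def)
      moreover have "s (c n + r) (E n) = s (c n) (E n) + s r (E n)"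
        using P.smult_l_distr[of "c n" r "E n"] F r True by simp
      ultimately show ?thesis
        using True F(1) by (simp add: insert_absorb sum.remove[of F n] c'_def algebra_simps)
    next
      case False
      have "(\<Sum>m\<in>F. s (c' m) (E m)) = (\<Sum>m\<in>F. s (c m) (E m))"
        by (rule sum.cong) (use False in \<open>auto simp: c'_def\<close>)
      then show ?thesis using False F(1) by (simp add: c'_def add.commute)
    qed
    have 2: "(\<Oplus>\<^bsub>A\<^esub>m\<in>insert n F. c' m \<odot>\<^bsub>A\<^esub> \<mu> m) = (\<Oplus>\<^bsub>A\<^esub>m\<in>F. c m \<odot>\<^bsub>A\<^esub> \<mu> m) \<oplus>\<^bsub>A\<^esub> r \<odot>\<^bsub>A\<^esub> \<mu> n"
    proof -
      have eq: "(\<Oplus>\<^bsub>A\<^esub>m\<in>F - {n}. c' m \<odot>\<^bsub>A\<^esub> \<mu> m) = (\<Oplus>\<^bsub>A\<^esub>m\<in>F - {n}. c m \<odot>\<^bsub>A\<^esub> \<mu> m)"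
        by (rule A.M.finsum_cong') (use cl in \<open>auto simp: c'_def\<close>)
      have c'n: "c' n \<in> D" using F r by (auto simp: c'_def intro: addD)
      have c'cl: "c' m \<odot>\<^bsub>A\<^esub> \<mu> m \<in> carrier A" if "m \<in> F - {n}" for m
        using cl that by (auto simp: c'_def)
      have "(\<Oplus>\<^bsub>A\<^esub>m\<in>insert n F. c' m \<odot>\<^bsub>A\<^esub> \<mu> m) = c' n \<odot>\<^bsub>A\<^esub> \<mu> n \<oplus>\<^bsub>A\<^esub> (\<Oplus>\<^bsub>A\<^esub>m\<in>F - {n}. c m \<odot>\<^bsub>A\<^esub> \<mu> m)"
        using A.M.finsum_insert[of "F - {n}" n "\<lambda>m. c' m \<odot>\<^bsub>A\<^esub> \<mu> m"] F(1) c'cl c'n \<mu>[OF n(1)]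
        by (simp add: eq)
      also have "\<dots> = (\<Oplus>\<^bsub>A\<^esub>m\<in>F. c m \<odot>\<^bsub>A\<^esub> \<mu> m) \<oplus>\<^bsub>A\<^esub> r \<odot>\<^bsub>A\<^esub> \<mu> n"
      proof (cases "n \<in> F")
        case True
        then have F': "insert n (F - {n}) = F" by auto
        have "(\<Oplus>\<^bsub>A\<^esub>m\<in>F. c m \<odot>\<^bsub>A\<^esub> \<mu> m) = c n \<odot>\<^bsub>A\<^esub> \<mu> n \<oplus>\<^bsub>A\<^esub> (\<Oplus>\<^bsub>A\<^esub>m\<in>F - {n}. c m \<odot>\<^bsub>A\<^esub> \<mu> m)"
          using A.M.finsum_insert[of "F - {n}" n "\<lambda>m. c m \<odot>\<^bsub>A\<^esub> \<mu> m"] F(1) cl True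
          unfolding F' by simp
        moreover have "(c n + r) \<odot>\<^bsub>A\<^esub> \<mu> n = c n \<odot>\<^bsub>A\<^esub> \<mu> n \<oplus>\<^bsub>A\<^esub> r \<odot>\<^bsub>A\<^esub> \<mu> n"
          using A.smult_l_distr[of "c n" r "\<mu> n"] F r True \<mu> n by simp
        moreover have "(\<Oplus>\<^bsub>A\<^esub>m\<in>F - {n}. c m \<odot>\<^bsub>A\<^esub> \<mu> m) \<in> carrier A"
          by (rule A.M.finsum_closed) (use cl in auto)
        ultimately show ?thesis
          using True F r \<mu> n by (simp add: c'_def A.M.a_ac)
      next
        case False
        have "(\<Oplus>\<^bsub>A\<^esub>m\<in>F. c m \<odot>\<^bsub>A\<^esub> \<mu> m) \<in> carrier A"
          by (rule A.M.finsum_closed) (use cl in auto)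
        then show ?thesis using False r \<mu> n by (simp add: c'_def A.M.a_comm)
      qed
      finally show ?thesis .
    qed
    have 3: "\<forall>m\<in>insert n F. c' m \<in> D"
      using F r by (auto simp: c'_def intro: addD)
    show ?case
      using F(1,2) n 1 2 3 by (intro exI[of _ "insert n F"] exI[of _ c']) (simp add: F(4,5))
  qed
qed

text \<open>Independence of the first components forces all coefficients to be 0, and the second
  component then vanishes whatever relations hold among the \<open>\<mu> m\<close>.\<close>

lemma lin_span_functional:
  assumes P: "algebra (ring_on D) (algebra_on s UNIV)" and A: "algebra (ring_on D) A"
    and \<mu>: "\<And>m. m \<in> I \<Longrightarrow> \<mu> m \<in> carrier A"
    and indep: "\<And>F c m. finite F \<Longrightarrow> F \<subseteq> I \<Longrightarrow> (\<Sum>m\<in>F. s (c m) (E m)) = 0 \<Longrightarrow> m \<in> F \<Longrightarrow> c m = 0"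
    and x: "(0, \<alpha>) \<in> algebra.lin_span (ring_on D) (prod_algebra (algebra_on s UNIV) A) ((\<lambda>m. (E m, \<mu> m)) ` I)"
  shows "\<alpha> = \<zero>\<^bsub>A\<^esub>"
proof -
  interpret A: algebra "ring_on D" A by fact
  obtain F c where F: "finite F" "F \<subseteq> I" "0 = (\<Sum>m\<in>F. s (c m) (E m))" "\<alpha> = (\<Oplus>\<^bsub>A\<^esub>m\<in>F. c m \<odot>\<^bsub>A\<^esub> \<mu> m)"
    using lin_span_expansion[OF P A \<mu> x] by auto
  have "c m \<odot>\<^bsub>A\<^esub> \<mu> m = \<zero>\<^bsub>A\<^esub>" if "m \<in> F" for m
    using indep[OF F(1,2) F(3)[symmetric] that] A.smult_l_null \<mu> that F(2) by auto
  then have "\<alpha> = (\<Oplus>\<^bsub>A\<^esub>m\<in>F. \<zero>\<^bsub>A\<^esub>)"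
    unfolding F(4) by (intro A.M.finsum_cong') auto
  then show ?thesis by simp
qed

section \<open>Powers modulo ideals, and ideals extended to an algebra\<close>

lemma (in cring) pow_minus_mem_ideal:
  assumes I: "ideal I R" and a: "a \<in> carrier R" "(a [^] N) \<ominus> a \<in> I" and N: "N \<ge> 1"
    and q: "q \<ge> 1" "N - 1 dvd q - 1"
  shows "(a [^] (q::nat)) \<ominus> a \<in> I"
proof -
  interpret I: ideal I R by fact
  obtain u where u: "q = 1 + (N - 1) * u" using q by (metis dvdE le_add_diff_inverse)
  \<comment> \<open>The exponents q in question are the numbers 1 + (N-1)u. Raising u by one
    multiplies the power by a^(N-1), and a^(N-1) b - a = a^(N-1) (b - a) + (a^N - a).\<close>
  have "(a [^] (1 + (N - 1) * u)) \<ominus> a \<in> I" for u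
  proof (induction u)
    case 0
    have "(a [^] (1 + (N - 1) * 0)) \<ominus> a = \<zero>" using a by (simp add: a_minus_def r_neg)
    then show ?case by (simp only: I.zero_closed)
  next
    case (Suc u)
    let ?b = "a [^] (1 + (N - 1) * u)" and ?c = "a [^] (N - 1)"
    have e: "1 + (N - 1) * Suc u = (N - 1) + (1 + (N - 1) * u)" by simp
    have "a [^] (1 + (N - 1) * Suc u) = ?c \<otimes> ?b"
      using nat_pow_mult[OF a(1), of "N - 1" "1 + (N - 1) * u"] by (simp only: e)
    moreover have "a [^] N = ?c \<otimes> a"
      using a N nat_pow_mult[of a "N - 1" 1] by simp
    ultimately have "(a [^] (1 + (N - 1) * Suc u)) \<ominus> a =
        ?c \<otimes> (?b \<ominus> a) \<oplus> ((a [^] N) \<ominus> a)"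
      using a by (simp add: a_minus_def r_distr r_minus a_assoc l_neg r_neg2 r_neg1)
    moreover have "?c \<otimes> (?b \<ominus> a) \<in> I" using Suc a by (intro I.I_l_closed) auto
    ultimately show ?case using a(2) I.a_closed by simp
  qed
  then show ?thesis using u by simp
qed

context algebra begin

lemma smult_ideal:
  assumes "\<pi> \<in> carrier R"
  shows "ideal {\<pi> \<odot>\<^bsub>M\<^esub> a |a. a \<in> carrier M} M"
proof (rule idealI)
  show "ring M" using M_cring by (simp add: cring_def)
  have minus: "\<ominus>\<^bsub>M\<^esub> (\<pi> \<odot>\<^bsub>M\<^esub> a) = \<pi> \<odot>\<^bsub>M\<^esub> (\<ominus>\<^bsub>M\<^esub> a)" if "a \<in> carrier M" for a
    using smult_r_minus[OF assms that] by simp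
  show "subgroup {\<pi> \<odot>\<^bsub>M\<^esub> a |a. a \<in> carrier M} (add_monoid M)"
  proof (rule M.add.subgroupI)
    have "\<pi> \<odot>\<^bsub>M\<^esub> \<zero>\<^bsub>M\<^esub> \<in> {\<pi> \<odot>\<^bsub>M\<^esub> a |a. a \<in> carrier M}" by blast
    then show "{\<pi> \<odot>\<^bsub>M\<^esub> a |a. a \<in> carrier M} \<noteq> {}" by blast
    fix x y
    assume "x \<in> {\<pi> \<odot>\<^bsub>M\<^esub> a |a. a \<in> carrier M}"
    then obtain a where a: "x = \<pi> \<odot>\<^bsub>M\<^esub> a" "a \<in> carrier M" by blast
    then show "\<ominus>\<^bsub>M\<^esub> x \<in> {\<pi> \<odot>\<^bsub>M\<^esub> a |a. a \<in> carrier M}" using minus by blast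
    assume "y \<in> {\<pi> \<odot>\<^bsub>M\<^esub> a |a. a \<in> carrier M}"
    then obtain b where "y = \<pi> \<odot>\<^bsub>M\<^esub> b" "b \<in> carrier M" by blast
    then have "x \<oplus>\<^bsub>M\<^esub> y = \<pi> \<odot>\<^bsub>M\<^esub> (a \<oplus>\<^bsub>M\<^esub> b)" using a assms by (simp add: smult_r_distr)
    then show "x \<oplus>\<^bsub>M\<^esub> y \<in> {\<pi> \<odot>\<^bsub>M\<^esub> a |a. a \<in> carrier M}" using a \<open>b \<in> carrier M\<close> by blast
  qed (use assms in auto)
next
  fix x y assume "x \<in> {\<pi> \<odot>\<^bsub>M\<^esub> a |a. a \<in> carrier M}" "y \<in> carrier M"
  then obtain a where a: "x = \<pi> \<odot>\<^bsub>M\<^esub> a" "a \<in> carrier M" by blast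
  have yx: "y \<otimes>\<^bsub>M\<^esub> x = \<pi> \<odot>\<^bsub>M\<^esub> (y \<otimes>\<^bsub>M\<^esub> a)"
    using a assms \<open>y \<in> carrier M\<close> by (simp add: smult_assoc2_right)
  have xy: "x \<otimes>\<^bsub>M\<^esub> y = \<pi> \<odot>\<^bsub>M\<^esub> (a \<otimes>\<^bsub>M\<^esub> y)"
    using a assms \<open>y \<in> carrier M\<close> by (simp add: smult_assoc2)
  have cl: "a \<otimes>\<^bsub>M\<^esub> y \<in> carrier M" "y \<otimes>\<^bsub>M\<^esub> a \<in> carrier M" using a \<open>y \<in> carrier M\<close> by auto
  show "y \<otimes>\<^bsub>M\<^esub> x \<in> {\<pi> \<odot>\<^bsub>M\<^esub> a |a. a \<in> carrier M}" using yx cl by blast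
  show "x \<otimes>\<^bsub>M\<^esub> y \<in> {\<pi> \<odot>\<^bsub>M\<^esub> a |a. a \<in> carrier M}" using xy cl by blast
qed

lemma extended_ideal_ideal:
  assumes "I \<subseteq> carrier R"
  shows "ideal (extended_ideal I M) M"
  unfolding extended_ideal_def
  by (rule ring.genideal_ideal) (use assms M_cring in \<open>auto simp: cring_def\<close>)

lemma extended_ideal_base:
  assumes "I \<subseteq> carrier R" "r \<in> I" "a \<in> carrier M"
  shows "r \<odot>\<^bsub>M\<^esub> a \<in> extended_ideal I M"
  unfolding extended_ideal_def
  using ring.genideal_self[of M "{r \<odot>\<^bsub>M\<^esub> a |r a. r \<in> I \<and> a \<in> carrier M}"] assms M_cring
  by (fastforce simp: cring_def)

lemma extended_ideal_least:
  assumes "ideal J M" "\<And>r a. r \<in> I \<Longrightarrow> a \<in> carrier M \<Longrightarrow> r \<odot>\<^bsub>M\<^esub> a \<in> J"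
  shows "extended_ideal I M \<subseteq> J"
  unfolding extended_ideal_def
  by (rule ring.genideal_minimal) (use assms M_cring in \<open>auto simp: cring_def\<close>)

lemma extended_ideal_mono:
  assumes "I \<subseteq> J" "J \<subseteq> carrier R"
  shows "extended_ideal I M \<subseteq> extended_ideal J M"
  by (rule extended_ideal_least[OF extended_ideal_ideal])
    (use assms extended_ideal_base in blast)+

end

section \<open>Comparison of the congruences modulo t-maximal ideals and modulo the ideals
  \<Pi>_q\<close>

context domain_in_field begin

text \<open>A choice of generators, which \<open>class_D_principal_Pi\<close> and
  \<open>class_C_principal_Pi\<close> supply for the two classes; values at numbers that are not
  prime powers are arbitrary.\<close>

definition principal_Pi :: "(nat \<Rightarrow> 'k) \<Rightarrow> bool" where
  "principal_Pi \<pi> \<longleftrightarrow> (\<forall>q. primepow q \<longrightarrow> \<pi> q \<in> D \<and> \<pi> q \<noteq> 0 \<and> Pi_ideal D q = {\<pi> q * d |d. d \<in> D})"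

lemma Pi_ideal_subset_D: "Pi_ideal D q \<subseteq> D"
  by (auto simp: Pi_ideal_def)

lemma principal_Pi_frobenius:
  assumes "principal_Pi \<pi>" "primepow q" "x \<in> D"
  shows "\<exists>d\<in>D. x ^ q - x = \<pi> q * d"
  using Pi_ideal_frobenius[OF assms(3), of q] assms(1,2) by (auto simp: principal_Pi_def)

text \<open>The multiples of a single scalar already form an ideal of the algebra, so a congruence
  modulo this ideal becomes divisibility by \<pi>_q.\<close>

lemma extended_Pi_ideal:
  assumes A: "algebra (ring_on D) A" and "principal_Pi \<pi>" "primepow q"
  shows "extended_ideal (Pi_ideal D q) A = {\<pi> q \<odot>\<^bsub>A\<^esub> a |a. a \<in> carrier A}"
proof -
  interpret A: algebra "ring_on D" A by fact
  have pi: "\<pi> q \<in> D" "Pi_ideal D q = {\<pi> q * d |d. d \<in> D}" using assms by (auto simp: principal_Pi_def)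
  show ?thesis
  proof
    show "extended_ideal (Pi_ideal D q) A \<subseteq> {\<pi> q \<odot>\<^bsub>A\<^esub> a |a. a \<in> carrier A}"
    proof (rule A.extended_ideal_least[OF A.smult_ideal])
      fix r a assume "r \<in> Pi_ideal D q" and a: "a \<in> carrier A"
      then obtain d where d: "d \<in> D" "r = \<pi> q * d" using pi by auto
      then have "r \<odot>\<^bsub>A\<^esub> a = \<pi> q \<odot>\<^bsub>A\<^esub> (d \<odot>\<^bsub>A\<^esub> a)"
        using pi a A.smult_assoc1[of "\<pi> q" d a] by simp
      moreover have "d \<odot>\<^bsub>A\<^esub> a \<in> carrier A" using d a by simp
      ultimately show "r \<odot>\<^bsub>A\<^esub> a \<in> {\<pi> q \<odot>\<^bsub>A\<^esub> a |a. a \<in> carrier A}" by blast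
    qed (use pi in simp)
    have "\<pi> q = \<pi> q * 1" by simp
    then have "\<pi> q \<in> Pi_ideal D q" unfolding pi using one_mem by blast
    then show "{\<pi> q \<odot>\<^bsub>A\<^esub> a |a. a \<in> carrier A} \<subseteq> extended_ideal (Pi_ideal D q) A"
      using A.extended_ideal_base[of "Pi_ideal D q" "\<pi> q"] Pi_ideal_subset_D by auto
  qed
qed

text \<open>A maximal ideal \<open>M\<close> containing the conductor of \<open>a\<^sup>q - a\<close> into \<open>\<pi>\<^sub>q A\<close> contains
  \<open>\<Pi>\<^sub>q\<close>, so it is t-maximal and \<open>a\<^sup>q - a \<in> M A\<close>; but \<open>\<pi>\<^sub>q\<close> generates \<open>M\<close> locally.\<close>

lemma congruence_Pi_of_congruence_t_maximal:
  assumes A: "algebra (ring_on D) A" and pi: "principal_Pi \<pi>" and q: "primepow q"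
    and cong: "\<And>p. t_maximal D p \<Longrightarrow> finite_norm D p \<Longrightarrow>
      (a [^]\<^bsub>A\<^esub> ideal_norm D p) \<ominus>\<^bsub>A\<^esub> a \<in> extended_ideal p A"
    and a: "a \<in> carrier A"
  shows "(a [^]\<^bsub>A\<^esub> q) \<ominus>\<^bsub>A\<^esub> a \<in> extended_ideal (Pi_ideal D q) A"
proof -
  interpret A: algebra "ring_on D" A by fact
  have q1: "q > 1" using q by (simp add: primepow_gt_Suc_0)
  have piq: "\<pi> q \<in> D" "\<pi> q \<noteq> 0" using pi q by (auto simp: principal_Pi_def)
  have frob: "\<exists>d\<in>D. x ^ q - x = \<pi> q * d" if "x \<in> D" for x
    by (rule principal_Pi_frobenius[OF pi q that])
  define b where "b = (a [^]\<^bsub>A\<^esub> q) \<ominus>\<^bsub>A\<^esub> a"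
  define E where "E = {\<pi> q \<odot>\<^bsub>A\<^esub> x |x. x \<in> carrier A}"
  have b: "b \<in> carrier A" using a by (simp add: b_def)
  interpret E: ideal E A unfolding E_def by (rule A.smult_ideal) (use piq in simp)
  have EsI: "d \<odot>\<^bsub>A\<^esub> x \<in> E" if "d \<in> D" "x \<in> E" for d x
  proof -
    have xc: "x \<in> carrier A" using that E.a_subset by blast
    then have "d \<odot>\<^bsub>A\<^esub> x = (d \<odot>\<^bsub>A\<^esub> \<one>\<^bsub>A\<^esub>) \<otimes>\<^bsub>A\<^esub> x" using that A.smult_assoc2[of d "\<one>\<^bsub>A\<^esub>" x] by simp
    then show ?thesis using E.I_l_closed[OF that(2), of "d \<odot>\<^bsub>A\<^esub> \<one>\<^bsub>A\<^esub>"] that by simp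
  qed
  let ?J = "{d\<in>D. d \<odot>\<^bsub>A\<^esub> b \<in> E}"
  have J: "submod ?J"
  proof (rule submodI)
    show "0 \<in> ?J" using A.smult_l_null[OF b] E.zero_closed by simp
    fix x y assume "x \<in> ?J" "y \<in> ?J"
    then show "x + y \<in> ?J" using A.smult_l_distr[of x y b] b E.a_closed by simp
  next
    fix d x assume "d \<in> D" "x \<in> ?J"
    then show "d * x \<in> ?J" using A.smult_assoc1[of d x b] b EsI by simp
  qed
  have "1 \<in> ?J"
  proof (rule ccontr)
    assume "1 \<notin> ?J"
    then obtain M where M: "max_ideal M" "?J \<subseteq> M" using max_ideal_exists[OF _ J] by blast
    have M': "M \<subseteq> D" "submod M" "1 \<notin> M" using M by (auto simp: max_ideal_def)
    have "\<pi> q \<in> ?J" using piq b unfolding E_def by blast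
    then have piM: "\<pi> q \<in> M" using M by blast
    have tM: "t_maximal D M" by (rule maximal_over_frobenius_t_maximal[OF M(1) piM piq(2) q1 frob])
    have "x ^ q - x \<in> M" if "x \<in> D" for x
      using frob[OF that] submod_mult_right[OF M'(2) piM] by auto
    note norm = maximal_over_frobenius_norm[OF M(1) q1 this]
    \<comment> \<open>The elements of A that belong to \<pi>_q A locally at M. Being an ideal, this
      set contains M A as soon as it contains all r x with r in M, and for those
      \<open>frobenius_multiplier\<close> gives the multiplier.\<close>
    let ?Z = "{x \<in> carrier A. \<exists>s\<in>D - M. s \<odot>\<^bsub>A\<^esub> x \<in> E}"
    have prM: "x * y \<in> D - M" if "x \<in> D - M" "y \<in> D - M" for x y
      using max_ideal_prime[OF M(1)] that by (auto simp: prime_id_def)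
    have "ideal ?Z A"
    proof (rule idealI)
      show "ring A" using A.M_cring by (simp add: cring_def)
      show "subgroup ?Z (add_monoid A)"
      proof (rule A.M.add.subgroupI)
        have "1 \<in> D - M" using M'(3) by simp
        moreover have "1 \<odot>\<^bsub>A\<^esub> \<zero>\<^bsub>A\<^esub> \<in> E" using E.zero_closed A.smult_r_null[of 1] by simp
        ultimately have "\<zero>\<^bsub>A\<^esub> \<in> ?Z" using A.M.zero_closed by blast
        then show "?Z \<noteq> {}" by blast
        fix x y assume "x \<in> ?Z" 
        then obtain s where s: "x \<in> carrier A" "s \<in> D - M" "s \<odot>\<^bsub>A\<^esub> x \<in> E" by blast
        have "s \<odot>\<^bsub>A\<^esub> (\<ominus>\<^bsub>A\<^esub> x) = \<ominus>\<^bsub>A\<^esub> (s \<odot>\<^bsub>A\<^esub> x)" using s by (simp add: A.smult_r_minus)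
        then have "s \<odot>\<^bsub>A\<^esub> (\<ominus>\<^bsub>A\<^esub> x) \<in> E" using E.a_inv_closed[OF s(3)] by simp
        then show "\<ominus>\<^bsub>A\<^esub> x \<in> ?Z" using s by blast
        assume "y \<in> ?Z"
        then obtain t where t: "y \<in> carrier A" "t \<in> D - M" "t \<odot>\<^bsub>A\<^esub> y \<in> E" by blast
        have "(s * t) \<odot>\<^bsub>A\<^esub> (x \<oplus>\<^bsub>A\<^esub> y) = t \<odot>\<^bsub>A\<^esub> (s \<odot>\<^bsub>A\<^esub> x) \<oplus>\<^bsub>A\<^esub> s \<odot>\<^bsub>A\<^esub> (t \<odot>\<^bsub>A\<^esub> y)"
          using A.smult_assoc1[of t s x] A.smult_assoc1[of s t y] A.smult_r_distr[of "s * t" x y] s t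
          by (simp add: mult.commute)
        also have "\<dots> \<in> E" using s t EsI by (intro E.a_closed) auto
        finally show "x \<oplus>\<^bsub>A\<^esub> y \<in> ?Z" using prM[OF s(2) t(2)] s t by blast
      qed auto
      fix x y assume "x \<in> ?Z" and y: "y \<in> carrier A"
      then obtain s where s: "x \<in> carrier A" "s \<in> D - M" "s \<odot>\<^bsub>A\<^esub> x \<in> E" by blast
      have "s \<odot>\<^bsub>A\<^esub> (y \<otimes>\<^bsub>A\<^esub> x) = y \<otimes>\<^bsub>A\<^esub> (s \<odot>\<^bsub>A\<^esub> x)"
        using s y A.smult_assoc2_right[of s y x] by simp
      then have "s \<odot>\<^bsub>A\<^esub> (y \<otimes>\<^bsub>A\<^esub> x) \<in> E" using E.I_l_closed[OF s(3) y] by simp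
      then show *: "y \<otimes>\<^bsub>A\<^esub> x \<in> ?Z" using s y by blast
      then show "x \<otimes>\<^bsub>A\<^esub> y \<in> ?Z" using A.m_comm[OF s(1) y] by simp
    qed
    then have "extended_ideal M A \<subseteq> ?Z"
    proof (rule A.extended_ideal_least)
      fix r x assume r: "r \<in> M" and x: "x \<in> carrier A"
      obtain s where s: "s \<in> D - M" "\<And>z. z \<in> {r} \<Longrightarrow> \<exists>d\<in>D. s * z = \<pi> q * d"
        using frobenius_multiplier[OF max_ideal_prime[OF M(1)] q1 frob, of "{r}"] r by blast
      then obtain d where d: "d \<in> D" "s * r = \<pi> q * d" by blast
      have "s \<odot>\<^bsub>A\<^esub> (r \<odot>\<^bsub>A\<^esub> x) = \<pi> q \<odot>\<^bsub>A\<^esub> (d \<odot>\<^bsub>A\<^esub> x)"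
        using A.smult_assoc1[of s r x] A.smult_assoc1[of "\<pi> q" d x] d s(1) r M'(1) x piq by auto
      then have "s \<odot>\<^bsub>A\<^esub> (r \<odot>\<^bsub>A\<^esub> x) \<in> E" unfolding E_def using d x by auto
      then show "r \<odot>\<^bsub>A\<^esub> x \<in> ?Z" using s(1) r M'(1) x by auto
    qed
    moreover have "b \<in> extended_ideal M A"
      unfolding b_def
      by (rule cring.pow_minus_mem_ideal[OF A.M_cring A.extended_ideal_ideal a cong[OF tM norm(1)] _ _ norm(2)])
        (use M' q1 max_norm_gt_1[OF M(1) norm(1)] in auto)
    ultimately obtain s where "s \<in> D - M" "s \<odot>\<^bsub>A\<^esub> b \<in> E" by blast
    then show False using M(2) by blast
  qed
  then have "b \<in> E" using A.smult_one[OF b] by simp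
  then show ?thesis unfolding b_def E_def extended_Pi_ideal[OF A pi q] .
qed

text \<open>The norm of p is a prime power q, and p is one of the ideals intersected in \<Pi>_q, so
  the congruence for this one q suffices.\<close>

lemma congruence_t_maximal_of_congruence_Pi:
  assumes A: "algebra (ring_on D) A" and p: "t_maximal D p" "finite_norm D p"
    and cong: "\<And>q. primepow q \<Longrightarrow> (a [^]\<^bsub>A\<^esub> q) \<ominus>\<^bsub>A\<^esub> a \<in> extended_ideal (Pi_ideal D q) A"
  shows "(a [^]\<^bsub>A\<^esub> ideal_norm D p) \<ominus>\<^bsub>A\<^esub> a \<in> extended_ideal p A"
proof -
  interpret A: algebra "ring_on D" A by fact
  have "Pi_ideal D (ideal_norm D p) \<subseteq> p" using p by (auto simp: Pi_ideal_def)
  then have "extended_ideal (Pi_ideal D (ideal_norm D p)) A \<subseteq> extended_ideal p A"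
    using t_maximal_proper[OF p(1)] by (intro A.extended_ideal_mono) auto
  then show ?thesis
    using cong[OF max_norm_primepow[OF t_maximal_finite_norm_max[OF p] p(2)]] by blast
qed

section \<open>Integer-valued polynomials\<close>

lemma algebra_poly: "algebra (ring_on D) (algebra_on Polynomial.smult UNIV)"
  by (rule algebra_algebra_on[where \<iota> = "\<lambda>c. [:c:]", OF D.is_cring]) auto

lemma Int_algebra_simps [simp]:
  "carrier (Int_algebra D) = Int_poly D" "monoid.mult (Int_algebra D) = (*)"
  "monoid.one (Int_algebra D) = 1" "ring.zero (Int_algebra D) = 0" "ring.add (Int_algebra D) = (+)"
  "module.smult (Int_algebra D) = Polynomial.smult"
  by (simp_all add: Int_algebra_def)

lemma F_poly_eq: "\<pi> \<noteq> 0 \<Longrightarrow> Polynomial.smult \<pi> (F_poly \<pi> q) + [:0, 1:] = [:0, 1:] ^ q"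
  by (simp add: F_poly_def)

lemma F_poly_Int:
  assumes "principal_Pi \<pi>" "primepow q"
  shows "F_poly (\<pi> q) q \<in> Int_poly D"
  unfolding Int_poly_def
proof (intro CollectI ballI)
  fix x assume "x \<in> D"
  then obtain d where "d \<in> D" "x ^ q - x = \<pi> q * d" using principal_Pi_frobenius[OF assms] by blast
  moreover have "\<pi> q \<noteq> 0" using assms by (auto simp: principal_Pi_def)
  ultimately show "poly (F_poly (\<pi> q) q) x \<in> D" by (simp add: F_poly_def poly_power)
qed

text \<open>The homomorphism sending X to a turns the identity \<pi>_q F_q + X = X^q in Int(D) into
  one in A, and the image of F_q is the required quotient.\<close>

lemma WPC_imp_congruence_Pi:
  assumes A: "algebra (ring_on D) A" and pi: "principal_Pi \<pi>" and q: "primepow q"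
    and W: "WPC D A" and a: "a \<in> carrier A"
  shows "(a [^]\<^bsub>A\<^esub> q) \<ominus>\<^bsub>A\<^esub> a \<in> extended_ideal (Pi_ideal D q) A"
proof -
  interpret A: algebra "ring_on D" A by fact
  obtain h where h: "h \<in> algebra_hom (ring_on D) (Int_algebra D) A" "h [:0, 1:] = a"
    using W a by (auto simp: WPC_def)
  note hD = algebra_homD[OF h(1), simplified]
  have piq: "\<pi> q \<in> D" "\<pi> q \<noteq> 0" using pi q by (auto simp: principal_Pi_def)
  have X: "[:0, 1:] \<in> Int_poly D" by (simp add: Int_poly_def)
  have Xn: "[:0, 1:] ^ n \<in> Int_poly D" for n by (simp add: Int_poly_def poly_power)
  have pw: "h ([:0, 1:] ^ n) = a [^]\<^bsub>A\<^esub> n" for n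
  proof (induction n)
    case (Suc n)
    have "h ([:0, 1:] ^ n * [:0, 1:]) = a [^]\<^bsub>A\<^esub> n \<otimes>\<^bsub>A\<^esub> a" using hD(2)[OF Xn X] Suc h(2) by simp
    then show ?case by (simp only: power_Suc2 A.nat_pow_Suc)
  qed (use hD(4) in simp)
  let ?F = "F_poly (\<pi> q) q"
  have F: "?F \<in> Int_poly D" by (rule F_poly_Int[OF pi q])
  have sF: "Polynomial.smult (\<pi> q) ?F \<in> Int_poly D" using F piq by (auto simp: Int_poly_def)
  have "a [^]\<^bsub>A\<^esub> q = \<pi> q \<odot>\<^bsub>A\<^esub> h ?F \<oplus>\<^bsub>A\<^esub> a"
    using hD(3)[OF sF X] hD(5)[OF piq(1) F] pw[of q] h(2) F_poly_eq[OF piq(2), of q] by metis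
  then have "(a [^]\<^bsub>A\<^esub> q) \<ominus>\<^bsub>A\<^esub> a = \<pi> q \<odot>\<^bsub>A\<^esub> h ?F"
    using hD(1)[OF F] a piq by (simp add: a_minus_def A.M.a_assoc A.M.r_neg)
  then show ?thesis using hD(1)[OF F] by (auto simp: extended_Pi_ideal[OF A pi q])
qed

end

section \<open>Multivariate polynomials\<close>

definition monom_eval :: "('x \<Rightarrow> 'r::comm_ring_1) \<Rightarrow> ('x \<Rightarrow>\<^sub>0 nat) \<Rightarrow> 'r" where
  "monom_eval v m = (\<Prod>x\<in>Poly_Mapping.keys m. v x ^ Poly_Mapping.lookup m x)"

lemma monom_eval_superset:
  assumes "finite T" "Poly_Mapping.keys m \<subseteq> T"
  shows "monom_eval v m = (\<Prod>x\<in>T. v x ^ Poly_Mapping.lookup m x)"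
  unfolding monom_eval_def using assms
  by (intro prod.mono_neutral_left) (auto simp: in_keys_iff)

lemma monom_eval_0 [simp]: "monom_eval v 0 = 1"
  by (simp add: monom_eval_def)

lemma monom_eval_add: "monom_eval v (m + n) = monom_eval v m * monom_eval v n"
proof -
  let ?T = "Poly_Mapping.keys m \<union> Poly_Mapping.keys n"
  have T: "finite ?T" "Poly_Mapping.keys (m + n) \<subseteq> ?T" by (auto simp: Poly_Mapping.keys_add)
  show ?thesis
    by (simp add: monom_eval_superset[OF T] monom_eval_superset[of ?T m] monom_eval_superset[of ?T n]
        lookup_add power_add prod.distrib)
qed

lemma monom_eval_single [simp]: "monom_eval v (Poly_Mapping.single x k) = v x ^ k"
  by (subst monom_eval_superset[of "{x}"]) auto

lemma mpoly_eval_superset: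
  assumes "finite S" "Poly_Mapping.keys f \<subseteq> S" "\<phi> 0 = 0"
  shows "mpoly_eval \<phi> v f = (\<Sum>m\<in>S. \<phi> (Poly_Mapping.lookup f m) * monom_eval v m)"
  unfolding mpoly_eval_def monom_eval_def[symmetric] using assms
  by (intro sum.mono_neutral_left) (auto simp: in_keys_iff)

lemma poly_mapping_sum_single: "(\<Sum>m\<in>Poly_Mapping.keys f. Poly_Mapping.single m (Poly_Mapping.lookup f m)) = f"
proof (rule poly_mapping_eqI)
  fix k
  have "Poly_Mapping.lookup (\<Sum>m\<in>Poly_Mapping.keys f. Poly_Mapping.single m (Poly_Mapping.lookup f m)) k
      = (\<Sum>m\<in>Poly_Mapping.keys f. if m = k then Poly_Mapping.lookup f k else 0)"
    unfolding lookup_sum by (rule sum.cong) (auto simp: lookup_single when_def)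
  also have "\<dots> = Poly_Mapping.lookup f k" by (simp add: sum.delta in_keys_iff)
  finally show "Poly_Mapping.lookup (\<Sum>m\<in>Poly_Mapping.keys f. Poly_Mapping.single m (Poly_Mapping.lookup f m)) k
      = Poly_Mapping.lookup f k" .
qed

text \<open>One locale serves three coefficient maps: the identity for values in the field, the
  constants of \<open>'k poly\<close> for \<open>gen_hom\<close>, and \<open>mpoly_const\<close> for
  substitution into polynomials in several variables.\<close>

locale field_hom_into =
  fixes \<phi> :: "'k::field \<Rightarrow> 'r::comm_ring_1"
  assumes hom_add: "\<phi> (a + b) = \<phi> a + \<phi> b"
    and hom_mult: "\<phi> (a * b) = \<phi> a * \<phi> b"
    and hom_one [simp]: "\<phi> 1 = 1"
begin

lemma hom_zero [simp]: "\<phi> 0 = 0"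
  using hom_add[of 0 0] by simp

lemma mpoly_eval_0 [simp]: "mpoly_eval \<phi> v 0 = 0"
  by (simp add: mpoly_eval_def)

lemma mpoly_eval_add: "mpoly_eval \<phi> v (f + g) = mpoly_eval \<phi> v f + mpoly_eval \<phi> v g"
proof -
  let ?S = "Poly_Mapping.keys f \<union> Poly_Mapping.keys g"
  have S: "finite ?S" "Poly_Mapping.keys (f + g) \<subseteq> ?S" by (auto simp: Poly_Mapping.keys_add)
  show ?thesis
    by (simp add: mpoly_eval_superset[OF S] mpoly_eval_superset[of ?S f] mpoly_eval_superset[of ?S g]
        lookup_add hom_add distrib_right sum.distrib)
qed

lemma mpoly_eval_sum: "mpoly_eval \<phi> v (sum f I) = (\<Sum>i\<in>I. mpoly_eval \<phi> v (f i))"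
  by (induction I rule: infinite_finite_induct) (auto simp: mpoly_eval_add)

lemma mpoly_eval_single: "mpoly_eval \<phi> v (Poly_Mapping.single m c) = \<phi> c * monom_eval v m"
  by (subst mpoly_eval_superset[of "{m}"]) auto

lemma mpoly_eval_const [simp]: "mpoly_eval \<phi> v (mpoly_const c) = \<phi> c"
  by (simp add: mpoly_const_def mpoly_eval_single)

lemma mpoly_eval_var [simp]: "mpoly_eval \<phi> v (mpoly_var x) = v x"
  by (simp add: mpoly_var_def mpoly_eval_single)

lemma mpoly_eval_1 [simp]: "mpoly_eval \<phi> v 1 = 1"
  using mpoly_eval_const[of v 1] by (simp add: mpoly_const_def)

lemma mpoly_eval_mult: "mpoly_eval \<phi> v (f * g) = mpoly_eval \<phi> v f * mpoly_eval \<phi> v g"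
proof -
  let ?l = Poly_Mapping.lookup and ?s = Poly_Mapping.single
  have "f * g = (\<Sum>m\<in>Poly_Mapping.keys f. ?s m (?l f m)) * (\<Sum>n\<in>Poly_Mapping.keys g. ?s n (?l g n))"
    by (simp only: poly_mapping_sum_single)
  also have "\<dots> = (\<Sum>m\<in>Poly_Mapping.keys f. \<Sum>n\<in>Poly_Mapping.keys g. ?s (m + n) (?l f m * ?l g n))"
    by (simp add: sum_product mult_single)
  finally have "mpoly_eval \<phi> v (f * g) =
      (\<Sum>m\<in>Poly_Mapping.keys f. \<Sum>n\<in>Poly_Mapping.keys g.
        (\<phi> (?l f m) * monom_eval v m) * (\<phi> (?l g n) * monom_eval v n))"
    by (simp add: mpoly_eval_sum mpoly_eval_single hom_mult monom_eval_add mult_ac)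
  also have "\<dots> = mpoly_eval \<phi> v f * mpoly_eval \<phi> v g"
    by (simp add: mpoly_eval_def monom_eval_def sum_product)
  finally show ?thesis .
qed

lemma mpoly_eval_uminus: "mpoly_eval \<phi> v (- f) = - mpoly_eval \<phi> v f"
  using mpoly_eval_add[of v f "- f"] by (simp add: eq_neg_iff_add_eq_0 add.commute)

lemma mpoly_eval_diff: "mpoly_eval \<phi> v (f - g) = mpoly_eval \<phi> v f - mpoly_eval \<phi> v g"
  using mpoly_eval_add[of v f "- g"] by (simp add: mpoly_eval_uminus)

lemma mpoly_eval_smult: "mpoly_eval \<phi> v (mpoly_smult c f) = \<phi> c * mpoly_eval \<phi> v f"
  by (simp add: mpoly_smult_def mpoly_eval_mult)

end

lemma monom_eval_var: "monom_eval mpoly_var m = Poly_Mapping.single m (1::'k::field)"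
proof -
  let ?l = Poly_Mapping.lookup and ?s = Poly_Mapping.single
  have pw: "mpoly_var x ^ k = ?s (?s x k) (1::'k)" for x :: 'a and k
  proof (induction k)
    case (Suc k)
    then show ?case by (simp add: mpoly_var_def mult_single flip: single_add)
  qed simp
  have "(\<Prod>x\<in>T. mpoly_var x ^ k x) = ?s (\<Sum>x\<in>T. ?s x (k x)) (1::'k)" for T :: "'a set" and k
    by (induction T rule: infinite_finite_induct) (auto simp: pw mult_single)
  then show ?thesis unfolding monom_eval_def by (simp add: poly_mapping_sum_single)
qed

lemma mpoly_const_0 [simp]: "mpoly_const 0 = 0" and mpoly_const_1 [simp]: "mpoly_const 1 = 1"
  and mpoly_const_add: "mpoly_const (a + b) = mpoly_const a + mpoly_const b"
  and mpoly_const_mult: "mpoly_const (a * b) = mpoly_const a * mpoly_const b"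
  by (simp_all add: mpoly_const_def single_add mult_single)

lemma mpoly_smult_single: "mpoly_smult c (Poly_Mapping.single m d) = Poly_Mapping.single m (c * d)"
  by (simp add: mpoly_smult_def mpoly_const_def mult_single)

lemma mpoly_algebra_carrier:
  "carrier (mpoly_algebra D V) = {f. mpoly_vars f \<subseteq> V \<and> (\<forall>m. Poly_Mapping.lookup f m \<in> D)}"
  by (simp add: mpoly_algebra_def)

context domain_in_field begin

lemma algebra_mpoly: "algebra (ring_on D) (algebra_on mpoly_smult (UNIV :: ('x, 'k) mpoly set))"
  by (rule algebra_algebra_on[where \<iota> = mpoly_const, OF D.is_cring])
    (auto simp: mpoly_smult_def mpoly_const_add mpoly_const_mult)

lemma algebra_on_sum_mem:
  assumes "algebra (ring_on D) (algebra_on s UNIV)" "I \<noteq> {}" "finite I"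
    "\<And>i. i \<in> I \<Longrightarrow> f i \<in> algebra.alg_gen (ring_on D) (algebra_on s UNIV) G"
  shows "sum f I \<in> algebra.alg_gen (ring_on D) (algebra_on s UNIV) G"
proof -
  interpret P: algebra "ring_on D" "algebra_on s UNIV" by fact
  show ?thesis
    using assms(3,2,4)
  proof (induction I rule: finite_ne_induct)
    case (insert x F)
    then show ?case using P.alg_gen.add[of "f x" G "sum f F"] by simp
  qed simp
qed

lemma algebra_on_prod_mem:
  assumes "algebra (ring_on D) (algebra_on s UNIV)" "finite I"
    "\<And>i. i \<in> I \<Longrightarrow> f i \<in> algebra.alg_gen (ring_on D) (algebra_on s UNIV) G"
  shows "prod f I \<in> algebra.alg_gen (ring_on D) (algebra_on s UNIV) G"
proof -
  interpret P: algebra "ring_on D" "algebra_on s UNIV" by fact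
  show ?thesis
    using assms(2,3)
  proof (induction I rule: finite_induct)
    case empty
    then show ?case using P.alg_gen.one by simp
  next
    case (insert x F)
    then show ?case using P.alg_gen.mult[of "f x" G "prod f F"] by simp
  qed
qed

lemma mpoly_algebra_generated:
  "carrier (mpoly_algebra D (V :: 'x set)) \<subseteq> algebra.alg_gen (ring_on D) (algebra_on mpoly_smult UNIV) (mpoly_var ` V)"
proof
  interpret P: algebra "ring_on D" "algebra_on mpoly_smult (UNIV :: ('x, 'k) mpoly set)"
    by (rule algebra_mpoly)
  fix f assume "f \<in> carrier (mpoly_algebra D V)"
  then have f: "mpoly_vars f \<subseteq> V" "\<And>m. Poly_Mapping.lookup f m \<in> D"
    by (auto simp: mpoly_algebra_carrier)
  have mon: "Poly_Mapping.single m c \<in> P.alg_gen (mpoly_var ` V)"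
    if "Poly_Mapping.keys m \<subseteq> V" "c \<in> D" for m c
  proof -
    have "monom_eval mpoly_var m \<in> P.alg_gen (mpoly_var ` V)"
      unfolding monom_eval_def
    proof (rule algebra_on_prod_mem[OF algebra_mpoly])
      fix x assume "x \<in> Poly_Mapping.keys m"
      then have "mpoly_var x \<in> P.alg_gen (mpoly_var ` V)" using that by (auto intro: P.alg_gen.gen)
      from P.alg_gen_power[OF this]
      show "mpoly_var x ^ Poly_Mapping.lookup m x \<in> P.alg_gen (mpoly_var ` V)" by simp
    qed simp
    from P.alg_gen.smult[OF _ this, of c] that(2) show ?thesis
      by (simp add: monom_eval_var mpoly_smult_single)
  qed
  show "f \<in> P.alg_gen (mpoly_var ` V)"
  proof (cases "f = 0")
    case True
    then show ?thesis using P.alg_gen.smult[OF _ P.alg_gen.one, of 0] by (simp add: mpoly_smult_def)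
  next
    case False
    have "(\<Sum>m\<in>Poly_Mapping.keys f. Poly_Mapping.single m (Poly_Mapping.lookup f m)) \<in> P.alg_gen (mpoly_var ` V)"
    proof (rule algebra_on_sum_mem[OF algebra_mpoly])
      show "Poly_Mapping.keys f \<noteq> {}" using False by simp
      fix m assume "m \<in> Poly_Mapping.keys f"
      then have "Poly_Mapping.keys m \<subseteq> V" using f(1) by (auto simp: mpoly_vars_def)
      then show "Poly_Mapping.single m (Poly_Mapping.lookup f m) \<in> P.alg_gen (mpoly_var ` V)"
        using mon f(2) by blast
    qed simp
    then show ?thesis by (simp only: poly_mapping_sum_single)
  qed
qed

definition monom_val :: "('k, 'a, 'm) module_scheme \<Rightarrow> ('x \<Rightarrow> 'a) \<Rightarrow> ('x \<Rightarrow>\<^sub>0 nat) \<Rightarrow> 'a" where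
  "monom_val A v m = (\<Otimes>\<^bsub>A\<^esub>x\<in>Poly_Mapping.keys m. v x [^]\<^bsub>A\<^esub> Poly_Mapping.lookup m x)"

text \<open>Since the monomials are linearly independent, the subalgebra of \<open>D[V] \<times> A\<close> generated by the
  pairs \<open>(x, v x)\<close> is the graph of a map, the evaluation at \<open>v\<close>.\<close>

lemma mpoly_graph_subset_span:
  fixes A :: "('k, 'a, 'm) module_scheme" and V :: "'x set" and v :: "'x \<Rightarrow> 'a"
  assumes A: "algebra (ring_on D) A" and v: "\<And>x. x \<in> V \<Longrightarrow> v x \<in> carrier A"
  shows "algebra.alg_gen (ring_on D) (prod_algebra (algebra_on mpoly_smult UNIV) A) ((\<lambda>x. (mpoly_var x, v x)) ` V)
    \<subseteq> algebra.lin_span (ring_on D) (prod_algebra (algebra_on mpoly_smult UNIV) A)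
        ((\<lambda>m. (Poly_Mapping.single m 1, monom_val A v m)) ` {m. Poly_Mapping.keys m \<subseteq> V})"
    and "\<And>m. Poly_Mapping.keys m \<subseteq> V \<Longrightarrow> monom_val A v m \<in> carrier A"
proof -
  interpret A: algebra "ring_on D" A by fact
  let ?P = "algebra_on mpoly_smult (UNIV :: ('x, 'k) mpoly set)"
  let ?B = "prod_algebra ?P A"
  let ?S = "(\<lambda>m. (Poly_Mapping.single m 1, monom_val A v m)) ` {m. Poly_Mapping.keys m \<subseteq> V}"
  interpret B: algebra "ring_on D" ?B by (rule algebra_prod_algebra[OF algebra_mpoly A])
  show cl: "monom_val A v m \<in> carrier A" if "Poly_Mapping.keys m \<subseteq> V" for m
    unfolding monom_val_def by (rule A.finprod_closed) (use that v in auto)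
  have S: "?S \<subseteq> carrier ?B" using cl by auto
  have super: "monom_val A v m = (\<Otimes>\<^bsub>A\<^esub>x\<in>T. v x [^]\<^bsub>A\<^esub> Poly_Mapping.lookup m x)"
    if "finite T" "Poly_Mapping.keys m \<subseteq> T" "T \<subseteq> V" for m T
    unfolding monom_val_def using that v
    by (intro A.finprod_mono_neutral_cong_left) (auto simp: in_keys_iff)
  have step: "monom_val A v (Poly_Mapping.single x 1 + m) = v x \<otimes>\<^bsub>A\<^esub> monom_val A v m"
    if x: "x \<in> V" and m: "Poly_Mapping.keys m \<subseteq> V" for x m
  proof -
    let ?T = "insert x (Poly_Mapping.keys m)" and ?m = "Poly_Mapping.single x 1 + m"
    let ?R = "Poly_Mapping.keys m - {x}"
    have T: "insert x ?R = ?T" by auto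
    have rest: "(\<Otimes>\<^bsub>A\<^esub>y\<in>?R. v y [^]\<^bsub>A\<^esub> Poly_Mapping.lookup ?m y) = (\<Otimes>\<^bsub>A\<^esub>y\<in>?R. v y [^]\<^bsub>A\<^esub> Poly_Mapping.lookup m y)"
      by (rule A.finprod_cong') (use m v in \<open>auto simp: lookup_add lookup_single when_def\<close>)
    have restc: "(\<Otimes>\<^bsub>A\<^esub>y\<in>?R. v y [^]\<^bsub>A\<^esub> Poly_Mapping.lookup m y) \<in> carrier A"
      by (rule A.finprod_closed) (use m v in auto)
    have ins: "(\<Otimes>\<^bsub>A\<^esub>y\<in>?T. v y [^]\<^bsub>A\<^esub> Poly_Mapping.lookup n y) =
        v x [^]\<^bsub>A\<^esub> Poly_Mapping.lookup n x \<otimes>\<^bsub>A\<^esub> (\<Otimes>\<^bsub>A\<^esub>y\<in>?R. v y [^]\<^bsub>A\<^esub> Poly_Mapping.lookup n y)"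
      for n :: "_ \<Rightarrow>\<^sub>0 nat"
      unfolding T[symmetric] by (rule A.finprod_insert) (use x m v in auto)
    have "Poly_Mapping.keys ?m \<subseteq> ?T" using Poly_Mapping.keys_add[of "Poly_Mapping.single x 1" m] by auto
    then have "monom_val A v ?m = (\<Otimes>\<^bsub>A\<^esub>y\<in>?T. v y [^]\<^bsub>A\<^esub> Poly_Mapping.lookup ?m y)"
      using x m by (intro super) auto
    also have "\<dots> = v x [^]\<^bsub>A\<^esub> Suc (Poly_Mapping.lookup m x) \<otimes>\<^bsub>A\<^esub> (\<Otimes>\<^bsub>A\<^esub>y\<in>?R. v y [^]\<^bsub>A\<^esub> Poly_Mapping.lookup m y)"
      unfolding ins rest by (simp add: lookup_add)
    also have "\<dots> = v x \<otimes>\<^bsub>A\<^esub> (v x [^]\<^bsub>A\<^esub> Poly_Mapping.lookup m x \<otimes>\<^bsub>A\<^esub> (\<Otimes>\<^bsub>A\<^esub>y\<in>?R. v y [^]\<^bsub>A\<^esub> Poly_Mapping.lookup m y))"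
      using v[OF x] restc by (simp add: A.m_ac)
    also have "\<dots> = v x \<otimes>\<^bsub>A\<^esub> monom_val A v m"
      using super[of ?T m] x m subset_insertI[of "Poly_Mapping.keys m" x] unfolding ins by simp
    finally show ?thesis .
  qed
  show "B.alg_gen ((\<lambda>x. (mpoly_var x, v x)) ` V) \<subseteq> B.lin_span ?S"
  proof (rule B.alg_gen_subset_lin_span[OF S])
    show "(\<lambda>x. (mpoly_var x, v x)) ` V \<subseteq> carrier ?B" using v by auto
    have "(\<lambda>m. (Poly_Mapping.single m 1, monom_val A v m)) 0 \<in> B.lin_span ?S"
      by (intro B.lin_span_base[OF S] imageI) simp
    then show "\<one>\<^bsub>?B\<^esub> \<in> B.lin_span ?S" by (simp add: monom_val_def)
    fix g s :: "('x, 'k) mpoly \<times> 'a" assume "g \<in> (\<lambda>x. (mpoly_var x, v x)) ` V" "s \<in> ?S"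
    then obtain x m where x: "x \<in> V" "g = (mpoly_var x, v x)"
      and m: "Poly_Mapping.keys m \<subseteq> V" "s = (Poly_Mapping.single m 1, monom_val A v m)" by auto
    have "g \<otimes>\<^bsub>?B\<^esub> s = (\<lambda>m. (Poly_Mapping.single m 1, monom_val A v m)) (Poly_Mapping.single x 1 + m)"
      using step[OF x(1) m(1)] x m by (simp add: mpoly_var_def mult_single)
    moreover have "Poly_Mapping.keys (Poly_Mapping.single x 1 + m) \<subseteq> V"
      using Poly_Mapping.keys_add[of "Poly_Mapping.single x 1" m] x m by auto
    ultimately show "g \<otimes>\<^bsub>?B\<^esub> s \<in> B.lin_span ?S"
      using B.lin_span_base[OF S] by blast
  qed
qed

lemma mpoly_independent:
  assumes "finite F" "(\<Sum>m\<in>F. mpoly_smult (c m) (Poly_Mapping.single m 1)) = 0" "m \<in> F"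
  shows "c m = 0"
proof -
  have "Poly_Mapping.lookup (\<Sum>m\<in>F. mpoly_smult (c m) (Poly_Mapping.single m 1)) m = (\<Sum>n\<in>F. if n = m then c m else 0)"
    unfolding lookup_sum by (rule sum.cong) (auto simp: mpoly_smult_single lookup_single when_def)
  then show ?thesis using assms by (simp add: sum.delta)
qed

text \<open>\<open>mpoly_eval\<close> needs a type-class ring and a map defined on all of the
  quotient field. Here \<open>A\<close> is a record with scalars in \<open>D\<close> only, so
  evaluation is obtained from its graph.\<close>

lemma mpoly_evaluation_hom:
  fixes A :: "('k, 'a, 'm) module_scheme" and V :: "'x set" and v :: "'x \<Rightarrow> 'a"
  assumes A: "algebra (ring_on D) A" and v: "\<And>x. x \<in> V \<Longrightarrow> v x \<in> carrier A"
  obtains \<epsilon> where "\<epsilon> \<in> algebra_hom (ring_on D) (mpoly_algebra D V) A" "\<And>x. x \<in> V \<Longrightarrow> \<epsilon> (mpoly_var x) = v x"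
proof -
  interpret A: algebra "ring_on D" A by fact
  let ?P = "algebra_on mpoly_smult (UNIV :: ('x, 'k) mpoly set)"
  let ?B = "prod_algebra ?P A" and ?G = "(\<lambda>x. (mpoly_var x, v x)) ` V"
  interpret B: algebra "ring_on D" ?B by (rule algebra_prod_algebra[OF algebra_mpoly A])
  have img: "carrier (mpoly_algebra D V) \<subseteq> fst ` B.alg_gen ?G"
    using mpoly_algebra_generated[of V] fst_alg_gen[OF algebra_mpoly A, of ?G] by (simp add: image_image)
  obtain \<epsilon> where \<epsilon>: "\<epsilon> \<in> algebra_hom (ring_on D) (mpoly_algebra D V) A"
    "\<And>f \<alpha>. (f, \<alpha>) \<in> B.alg_gen ?G \<Longrightarrow> \<epsilon> f = \<alpha>"
  proof (rule algebra_hom_of_graph[OF algebra_mpoly A _ _ img])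
    show "?G \<subseteq> carrier ?P \<times> carrier A" using v by auto
    fix \<alpha> assume "(\<zero>\<^bsub>?P\<^esub>, \<alpha>) \<in> B.alg_gen ?G"
    moreover have "B.alg_gen ?G \<subseteq> B.lin_span ((\<lambda>m. (Poly_Mapping.single m 1, monom_val A v m)) ` {m. Poly_Mapping.keys m \<subseteq> V})"
      by (rule mpoly_graph_subset_span(1)[where v = v and V = V, OF A v])
    ultimately have "(0, \<alpha>) \<in> B.lin_span ((\<lambda>m. (Poly_Mapping.single m 1, monom_val A v m)) ` {m. Poly_Mapping.keys m \<subseteq> V})"
      by auto
    moreover have "monom_val A v m \<in> carrier A" if "m \<in> {m. Poly_Mapping.keys m \<subseteq> V}" for m
      using mpoly_graph_subset_span(2)[where v = v and V = V, OF A v] that by blast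
    ultimately show "\<alpha> = \<zero>\<^bsub>A\<^esub>"
      by (intro lin_span_functional[where E = "\<lambda>m. Poly_Mapping.single m 1" and \<mu> = "monom_val A v"
          and I = "{m. Poly_Mapping.keys m \<subseteq> V}" and s = mpoly_smult and D = D]
          algebra_mpoly A mpoly_independent)
  qed (auto simp: mpoly_algebra_def)
  have "\<epsilon> (mpoly_var x) = v x" if "x \<in> V" for x
    using that by (intro \<epsilon>(2) B.alg_gen.gen) auto
  with \<epsilon>(1) that show thesis by blast
qed

end

context domain_in_field begin

lemma alg_gen_subset_mpoly_algebra:
  "algebra.alg_gen (ring_on D) (algebra_on mpoly_smult UNIV) (mpoly_var ` V) \<subseteq> carrier (mpoly_algebra D (V :: 'x set))"
proof
  interpret P: algebra "ring_on D" "algebra_on mpoly_smult (UNIV :: ('x, 'k) mpoly set)"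
    by (rule algebra_mpoly)
  let ?S = "(\<lambda>m. Poly_Mapping.single m (1::'k)) ` {m. Poly_Mapping.keys m \<subseteq> V}"
  fix f assume "f \<in> P.alg_gen (mpoly_var ` V)"
  moreover have "P.alg_gen (mpoly_var ` V) \<subseteq> P.lin_span ?S"
  proof (rule P.alg_gen_subset_lin_span)
    have "Poly_Mapping.single 0 1 \<in> P.lin_span ?S" by (intro P.lin_span_base imageI) auto
    then show "\<one>\<^bsub>algebra_on mpoly_smult UNIV\<^esub> \<in> P.lin_span ?S" by simp
    fix g s :: "('x, 'k) mpoly" assume "g \<in> mpoly_var ` V" "s \<in> ?S"
    then obtain x m where x: "x \<in> V" "g = mpoly_var x"
      and m: "Poly_Mapping.keys m \<subseteq> V" "s = Poly_Mapping.single m 1" by auto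
    have "Poly_Mapping.keys (Poly_Mapping.single x 1 + m) \<subseteq> V"
      using Poly_Mapping.keys_add[of "Poly_Mapping.single x 1" m] x m by auto
    then have "Poly_Mapping.single (Poly_Mapping.single x 1 + m) 1 \<in> P.lin_span ?S"
      by (intro P.lin_span_base imageI) auto
    then show "g \<otimes>\<^bsub>algebra_on mpoly_smult UNIV\<^esub> s \<in> P.lin_span ?S"
      using x m by (simp add: mpoly_var_def mult_single)
  qed auto
  ultimately have "f \<in> P.lin_span ?S" by blast
  then show "f \<in> carrier (mpoly_algebra D V)"
  proof induction
    case zero
    then show ?case by (simp add: mpoly_algebra_carrier mpoly_vars_def)
  next
    case (step f c s)
    then obtain m where m: "Poly_Mapping.keys m \<subseteq> V" "s = Poly_Mapping.single m 1" by auto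
    have "Poly_Mapping.keys (f + Poly_Mapping.single m c) \<subseteq> Poly_Mapping.keys f \<union> {m}"
      using Poly_Mapping.keys_add[of f "Poly_Mapping.single m c"] by (auto split: if_splits)
    then have "mpoly_vars (f + Poly_Mapping.single m c) \<subseteq> mpoly_vars f \<union> Poly_Mapping.keys m"
      unfolding mpoly_vars_def by blast
    then show ?case
      using step m by (auto simp: mpoly_algebra_carrier mpoly_smult_single lookup_add lookup_single when_def)
  qed
qed

text \<open>With this description the closure properties of \<open>D[V]\<close> are the introduction
  rules of \<open>alg_gen\<close>.\<close>

lemma mpoly_algebra_eq:
  "carrier (mpoly_algebra D V) = algebra.alg_gen (ring_on D) (algebra_on mpoly_smult UNIV) (mpoly_var ` V)"
  using mpoly_algebra_generated alg_gen_subset_mpoly_algebra by (rule subset_antisym)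

lemma mpoly_algebra_simps [simp]:
  "monoid.mult (mpoly_algebra D V) = (*)" "monoid.one (mpoly_algebra D V) = 1"
  "ring.zero (mpoly_algebra D V) = 0" "ring.add (mpoly_algebra D V) = (+)"
  "module.smult (mpoly_algebra D V) = mpoly_smult"
  by (simp_all add: mpoly_algebra_def)

lemma algebra_mpoly_algebra: "algebra (ring_on D) (mpoly_algebra D (V :: 'x set))"
proof -
  interpret P: algebra "ring_on D" "algebra_on mpoly_smult (UNIV :: ('x, 'k) mpoly set)"
    by (rule algebra_mpoly)
  let ?C = "P.alg_gen (mpoly_var ` V)"
  have eq: "mpoly_algebra D V = algebra_on mpoly_smult ?C"
    using mpoly_algebra_eq[of V] by (simp add: mpoly_algebra_def)
  have sm: "mpoly_smult c f \<in> ?C" if "c \<in> D" "f \<in> ?C" for c f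
    using P.alg_gen.smult[of c f] that by simp
  show ?thesis
    unfolding eq
  proof (rule algebra_algebra_on[where \<iota> = mpoly_const, OF D.is_cring])
    show "1 \<in> ?C" using P.alg_gen.one by simp
    then show "0 \<in> ?C" using sm[of 0 1] by (simp add: mpoly_smult_def)
    show "- f \<in> ?C" if "f \<in> ?C" for f
      using sm[of "- 1" f] that by (simp add: mpoly_smult_def mpoly_const_def single_uminus)
    show "f + g \<in> ?C" if "f \<in> ?C" "g \<in> ?C" for f g using P.alg_gen.add[of f _ g] that by simp
    show "f * g \<in> ?C" if "f \<in> ?C" "g \<in> ?C" for f g using P.alg_gen.mult[of f _ g] that by simp
    show "mpoly_smult c f \<in> ?C" if "c \<in> D" "f \<in> ?C" for c f by (rule sm[OF that])
  qed (auto simp: mpoly_smult_def mpoly_const_add mpoly_const_mult)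
qed

lemma mpoly_var_mem: "x \<in> V \<Longrightarrow> mpoly_var x \<in> carrier (mpoly_algebra D V)"
  unfolding mpoly_algebra_eq
  by (rule algebra.alg_gen.gen[OF algebra_mpoly]) auto

section \<open>The class D\<close>

lemma const_poly_hom: "field_hom_into (\<lambda>c::'k. [:c:])"
  by unfold_locales (auto simp: one_pCons)

text \<open>The quotient by \<pi>_q need not be unique in A, so one choice function \<open>f\<close>
  is fixed and iterated. The element \<open>b k\<close> stands for the value of the k-th iterate of
  F_q at a.\<close>

lemma iterated_division:
  fixes A :: "('k, 'a, 'm) module_scheme"
  assumes A: "algebra (ring_on D) A" and pi: "principal_Pi \<pi>" and q: "primepow q"
    and cong: "\<And>a. a \<in> carrier A \<Longrightarrow> (a [^]\<^bsub>A\<^esub> q) \<ominus>\<^bsub>A\<^esub> a \<in> extended_ideal (Pi_ideal D q) A"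
    and a: "a \<in> carrier A"
  shows "\<exists>b :: nat \<Rightarrow> 'a. b 0 = a \<and> (\<forall>k. b k \<in> carrier A \<and>
    b k [^]\<^bsub>A\<^esub> q = b k \<oplus>\<^bsub>A\<^esub> \<pi> q \<odot>\<^bsub>A\<^esub> b (Suc k))"
proof -
  interpret A: algebra "ring_on D" A by fact
  have piq: "\<pi> q \<in> D" using pi q by (auto simp: principal_Pi_def)
  have "\<exists>y. y \<in> carrier A \<and> x [^]\<^bsub>A\<^esub> q = x \<oplus>\<^bsub>A\<^esub> \<pi> q \<odot>\<^bsub>A\<^esub> y" if x: "x \<in> carrier A" for x
  proof -
    obtain y where y: "y \<in> carrier A" "(x [^]\<^bsub>A\<^esub> q) \<ominus>\<^bsub>A\<^esub> x = \<pi> q \<odot>\<^bsub>A\<^esub> y"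
      using cong[OF x] unfolding extended_Pi_ideal[OF A pi q] by blast
    have "x [^]\<^bsub>A\<^esub> q = x \<oplus>\<^bsub>A\<^esub> ((x [^]\<^bsub>A\<^esub> q) \<ominus>\<^bsub>A\<^esub> x)"
      using x by (simp add: a_minus_def A.M.a_comm[of "x [^]\<^bsub>A\<^esub> q"] A.M.r_neg1 A.M.r_neg2)
    then show ?thesis using y by auto
  qed
  then obtain f where f: "\<And>x. x \<in> carrier A \<Longrightarrow> f x \<in> carrier A \<and> x [^]\<^bsub>A\<^esub> q = x \<oplus>\<^bsub>A\<^esub> \<pi> q \<odot>\<^bsub>A\<^esub> f x"
    by metis
  have "(f ^^ k) a \<in> carrier A" for k by (induction k) (use a f in auto)
  then show ?thesis using f by (intro exI[of _ "\<lambda>k. (f ^^ k) a"]) auto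
qed

lemma iterated_divisions:
  fixes A :: "('k, 'a, 'm) module_scheme"
  assumes A: "algebra (ring_on D) A" and pi: "principal_Pi \<pi>"
    and cong: "\<And>a q. a \<in> carrier A \<Longrightarrow> primepow q \<Longrightarrow>
      (a [^]\<^bsub>A\<^esub> q) \<ominus>\<^bsub>A\<^esub> a \<in> extended_ideal (Pi_ideal D q) A"
    and a: "a \<in> carrier A"
  obtains b :: "nat \<Rightarrow> nat \<Rightarrow> 'a" where "\<And>q. b q 0 = a" "\<And>q k. b q k \<in> carrier A"
    "\<And>q k. primepow q \<Longrightarrow> b q k [^]\<^bsub>A\<^esub> q = b q k \<oplus>\<^bsub>A\<^esub> \<pi> q \<odot>\<^bsub>A\<^esub> b q (Suc k)"
proof -
  have "\<exists>b :: nat \<Rightarrow> 'a. b 0 = a \<and> (\<forall>k. b k \<in> carrier A \<and>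
      (primepow q \<longrightarrow> b k [^]\<^bsub>A\<^esub> q = b k \<oplus>\<^bsub>A\<^esub> \<pi> q \<odot>\<^bsub>A\<^esub> b (Suc k)))" for q
  proof (cases "primepow q")
    case True
    then show ?thesis using iterated_division[OF A pi True cong a] by auto
  qed (use a in \<open>auto intro!: exI[of _ "\<lambda>_. a"]\<close>)
  then have "\<exists>b :: nat \<Rightarrow> nat \<Rightarrow> 'a. \<forall>q. b q 0 = a \<and> (\<forall>k. b q k \<in> carrier A \<and>
      (primepow q \<longrightarrow> b q k [^]\<^bsub>A\<^esub> q = b q k \<oplus>\<^bsub>A\<^esub> \<pi> q \<odot>\<^bsub>A\<^esub> b q (Suc k)))"
    by (intro choice allI)
  then show thesis using that by blast
qed

text \<open>Evaluation at a and the iterated quotients \<open>b q k\<close> annihilates the defining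
  relations. These generate the kernel of \<open>gen_hom \<pi>\<close>, so the evaluation factors
  through its image Int(D).\<close>

lemma class_D_congruence_imp_WPC:
  fixes A :: "('k, 'a, 'm) module_scheme"
  assumes A: "algebra (ring_on D) A" and cD: "class_D D"
    and cong: "\<And>a q. a \<in> carrier A \<Longrightarrow> primepow q \<Longrightarrow>
      (a [^]\<^bsub>A\<^esub> q) \<ominus>\<^bsub>A\<^esub> a \<in> extended_ideal (Pi_ideal D q) A"
  shows "WPC D A"
  unfolding WPC_def
proof
  fix a assume a: "a \<in> carrier A"
  interpret A: algebra "ring_on D" A by fact
  interpret c: field_hom_into "\<lambda>c::'k. [:c:]" by (rule const_poly_hom)
  obtain \<pi> where pi': "\<forall>q. primepow q \<longrightarrow> \<pi> q \<in> D \<and> \<pi> q \<noteq> 0 \<and> Pi_ideal D q = {\<pi> q * d |d. d \<in> D} \<and>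
        F_poly (\<pi> q) q \<in> Int_poly D"
    and img': "gen_hom \<pi> ` carrier (mpoly_algebra D gen_vars) = carrier (Int_algebra D)"
    and ker: "a_kernel (mpoly_algebra D gen_vars) (Int_algebra D) (gen_hom \<pi>) =
      genideal (mpoly_algebra D gen_vars) (gen_relations \<pi>)"
    using cD unfolding class_D_def by (elim exE conjE)
  have pi: "principal_Pi \<pi>" using pi' by (simp add: principal_Pi_def)
  have img: "gen_hom \<pi> ` carrier (mpoly_algebra D gen_vars) = Int_poly D" using img' by simp
  let ?V = "mpoly_algebra D gen_vars"
  interpret V: algebra "ring_on D" ?V by (rule algebra_mpoly_algebra)
  obtain b :: "nat \<Rightarrow> nat \<Rightarrow> 'a" where b: "\<And>q. b q 0 = a" "\<And>q k. b q k \<in> carrier A"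
    "\<And>q k. primepow q \<Longrightarrow> b q k [^]\<^bsub>A\<^esub> q = b q k \<oplus>\<^bsub>A\<^esub> \<pi> q \<odot>\<^bsub>A\<^esub> b q (Suc k)"
    using iterated_divisions[OF A pi cong a] by blast
  define v where "v x = (case x of VX \<Rightarrow> a | VQ q k \<Rightarrow> b q k)" for x
  have "v x \<in> carrier A" for x using a b by (auto simp: v_def split: gen_var.split)
  then obtain \<epsilon> where \<epsilon>: "\<epsilon> \<in> algebra_hom (ring_on D) ?V A" "\<And>x. x \<in> gen_vars \<Longrightarrow> \<epsilon> (mpoly_var x) = v x"
    using mpoly_evaluation_hom[OF A, of gen_vars v] by blast
  note eD = algebra_homD[OF \<epsilon>(1), unfolded mpoly_algebra_simps carrier_ring_on]
  interpret e: ring_hom_ring ?V A \<epsilon>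
    using \<epsilon>(1) V.M_cring A.M_cring by (auto simp: algebra_hom_def cring_def intro!: ring_hom_ringI2)
  have var: "mpoly_var x \<in> carrier ?V" if "x \<in> gen_vars" for x using that by (rule mpoly_var_mem)
  have cl: "f + g \<in> carrier ?V" "f * g \<in> carrier ?V" "f - g \<in> carrier ?V"
    if "f \<in> carrier ?V" "g \<in> carrier ?V" for f g
  proof -
    show "f + g \<in> carrier ?V" "f * g \<in> carrier ?V"
      using V.M.a_closed[OF that] V.m_closed[OF that] by simp_all
    have "f + (mpoly_smult (- 1) g) \<in> carrier ?V"
      using V.M.a_closed[OF that(1) V.smult_closed[of "- 1" g]] that by simp
    then show "f - g \<in> carrier ?V" by (simp add: mpoly_smult_def mpoly_const_def single_uminus)
  qed
  have smc: "mpoly_const c * f \<in> carrier ?V" "\<epsilon> (mpoly_const c * f) = c \<odot>\<^bsub>A\<^esub> \<epsilon> f"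
    if "c \<in> D" "f \<in> carrier ?V" for c f
    using V.smult_closed[of c f] eD(5)[of c f] that by (simp_all add: mpoly_smult_def)
  have pw: "mpoly_var x ^ n \<in> carrier ?V" "\<epsilon> (mpoly_var x ^ n) = v x [^]\<^bsub>A\<^esub> n" if "x \<in> gen_vars" for x and n :: nat
  proof -
    have "mpoly_var x ^ n \<in> carrier ?V \<and> \<epsilon> (mpoly_var x ^ n) = v x [^]\<^bsub>A\<^esub> n"
    proof (induction n)
      case 0
      then show ?case using V.one_closed eD(4) by simp
    next
      case (Suc n)
      then show ?case
        using cl(2)[OF _ var[OF that], of "mpoly_var x ^ n"] eD(2)[OF _ var[OF that], of "mpoly_var x ^ n"]
          \<epsilon>(2)[OF that] by (simp only: power_Suc2 A.nat_pow_Suc)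
    qed
    then show "mpoly_var x ^ n \<in> carrier ?V" "\<epsilon> (mpoly_var x ^ n) = v x [^]\<^bsub>A\<^esub> n" by auto
  qed
  have eminus: "\<epsilon> (f - g) = \<zero>\<^bsub>A\<^esub>" if "f \<in> carrier ?V" "g \<in> carrier ?V" "\<epsilon> f = \<epsilon> g" for f g
  proof -
    have "\<epsilon> f = \<epsilon> (f - g) \<oplus>\<^bsub>A\<^esub> \<epsilon> g" using eD(3)[OF cl(3)[OF that(1,2)] that(2)] by simp
    then show ?thesis
      using that(3) eD(1)[OF that(2)] eD(1)[OF cl(3)[OF that(1,2)]]
      by (metis A.M.add.r_cancel_one')
  qed
  have VX: "VX \<in> gen_vars" by (simp add: gen_vars_def)
  have VQ: "VQ q k \<in> gen_vars" if "primepow q" for q k using that by (simp add: gen_vars_def)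
  have rel: "gen_relations \<pi> \<subseteq> a_kernel ?V A \<epsilon>"
  proof
    fix f assume "f \<in> gen_relations \<pi>"
    then consider q where "primepow q" "f = mpoly_var (VQ q 0) - mpoly_var VX"
      | q k where "primepow q" "f = mpoly_var (VQ q k) ^ q - mpoly_var (VQ q k) - mpoly_const (\<pi> q) * mpoly_var (VQ q (Suc k))"
      unfolding gen_relations_def by blast
    then have "f \<in> carrier ?V \<and> \<epsilon> f = \<zero>\<^bsub>A\<^esub>"
    proof cases
      case 1
      then show ?thesis
        using cl(3)[OF var[OF VQ] var[OF VX]] eminus[OF var[OF VQ] var[OF VX]] \<epsilon>(2)[OF VX] \<epsilon>(2)[OF VQ] b
        by (simp add: v_def)
    next
      case 2
      have piq: "\<pi> q \<in> D" using pi 2 by (auto simp: principal_Pi_def)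
      let ?g = "mpoly_var (VQ q k) + mpoly_const (\<pi> q) * mpoly_var (VQ q (Suc k))"
      have g: "?g \<in> carrier ?V" "f = mpoly_var (VQ q k) ^ q - ?g"
        using 2 var[OF VQ] smc piq cl by auto
      have "\<epsilon> (mpoly_var (VQ q k) ^ q) = \<epsilon> ?g"
        using pw(2)[OF VQ[OF 2(1), of k], of q] eD(3)[OF var[OF VQ[OF 2(1), of k]] smc(1)[OF piq var[OF VQ[OF 2(1), of "Suc k"]]]]
          smc(2)[OF piq var[OF VQ[OF 2(1), of "Suc k"]]] \<epsilon>(2)[OF VQ[OF 2(1)]] b(3)[OF 2(1), of k]
        by (simp add: v_def)
      then show ?thesis
        using eminus[OF pw(1)[OF VQ[OF 2(1)]] g(1)] cl(3)[OF pw(1)[OF VQ[OF 2(1)]] g(1)] g(2) by simp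
    qed
    then show "f \<in> a_kernel ?V A \<epsilon>" unfolding a_kernel_def' by blast
  qed
  have "genideal ?V (gen_relations \<pi>) \<subseteq> a_kernel ?V A \<epsilon>"
    by (rule ring.genideal_minimal[OF _ e.kernel_is_ideal rel]) (use V.M_cring in \<open>simp add: cring_def\<close>)
  then have kk: "\<epsilon> f = \<zero>\<^bsub>A\<^esub>" if "f \<in> carrier ?V" "gen_hom \<pi> f = 0" for f
  proof -
    have "f \<in> a_kernel ?V (Int_algebra D) (gen_hom \<pi>)" using that unfolding a_kernel_def' by simp
    then show ?thesis using \<open>genideal _ _ \<subseteq> _\<close> ker unfolding a_kernel_def' by blast
  qed
  have gdiff: "gen_hom \<pi> (f - g) = gen_hom \<pi> f - gen_hom \<pi> g" for f g
    unfolding gen_hom_def by (rule c.mpoly_eval_diff)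
  have well: "\<epsilon> f = \<epsilon> g" if "f \<in> carrier ?V" "g \<in> carrier ?V" "gen_hom \<pi> f = gen_hom \<pi> g" for f g
  proof -
    have "\<epsilon> (f - g) = \<zero>\<^bsub>A\<^esub>" using kk[OF cl(3)[OF that(1,2)]] that(3) gdiff by simp
    then show ?thesis using eD(3)[OF cl(3)[OF that(1,2)] that(2)] eD(1)[OF that(2)] by simp
  qed
  \<comment> \<open>An arbitrary preimage: by \<open>well\<close>, the value of \<epsilon> does not
    depend on it, and this is what makes the composite additive and multiplicative.\<close>
  define P where "P f = (SOME g. g \<in> carrier ?V \<and> gen_hom \<pi> g = f)" for f
  have P: "P f \<in> carrier ?V" "gen_hom \<pi> (P f) = f" if "f \<in> Int_poly D" for f
  proof -
    have "f \<in> gen_hom \<pi> ` carrier ?V" using that img by simp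
    then obtain g where "f = gen_hom \<pi> g" "g \<in> carrier ?V" by (rule imageE)
    then have "g \<in> carrier ?V \<and> gen_hom \<pi> g = f" by simp
    from someI[of "\<lambda>g. g \<in> carrier ?V \<and> gen_hom \<pi> g = f", OF this]
    show "P f \<in> carrier ?V" "gen_hom \<pi> (P f) = f" unfolding P_def by simp_all
  qed
  have Pw: "\<epsilon> (P (gen_hom \<pi> g)) = \<epsilon> g" if "g \<in> carrier ?V" for g
  proof -
    have "gen_hom \<pi> g \<in> Int_poly D" using imageI[OF that, of "gen_hom \<pi>"] img by simp
    then show ?thesis using that by (intro well P)
  qed
  have "(\<lambda>f. \<epsilon> (P f)) \<in> algebra_hom (ring_on D) (Int_algebra D) A"
  proof (rule algebra_homI)
    fix f assume f: "f \<in> carrier (Int_algebra D)"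
    then show "\<epsilon> (P f) \<in> carrier A" using P eD(1) by simp
    fix c assume c: "c \<in> carrier (ring_on D)"
    have "gen_hom \<pi> (mpoly_const c * P f) = Polynomial.smult c f"
      using P f unfolding gen_hom_def by (simp add: c.mpoly_eval_mult)
    then show "\<epsilon> (P (c \<odot>\<^bsub>Int_algebra D\<^esub> f)) = c \<odot>\<^bsub>A\<^esub> \<epsilon> (P f)"
      using Pw[of "mpoly_const c * P f"] smc[of c "P f"] P f c by simp
  next
    fix f g assume fg: "f \<in> carrier (Int_algebra D)" "g \<in> carrier (Int_algebra D)"
    have "gen_hom \<pi> (P f * P g) = f * g" "gen_hom \<pi> (P f + P g) = f + g"
      using P fg unfolding gen_hom_def by (simp_all add: c.mpoly_eval_mult c.mpoly_eval_add)
    then show "\<epsilon> (P (f \<otimes>\<^bsub>Int_algebra D\<^esub> g)) = \<epsilon> (P f) \<otimes>\<^bsub>A\<^esub> \<epsilon> (P g)"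
      "\<epsilon> (P (f \<oplus>\<^bsub>Int_algebra D\<^esub> g)) = \<epsilon> (P f) \<oplus>\<^bsub>A\<^esub> \<epsilon> (P g)"
      using Pw[OF cl(2)[OF P(1) P(1)], of f g] Pw[OF cl(1)[OF P(1) P(1)], of f g] eD(2,3)[OF P(1) P(1), of f g] fg
      by simp_all
  next
    have "gen_hom \<pi> 1 = 1" unfolding gen_hom_def by simp
    then show "\<epsilon> (P \<one>\<^bsub>Int_algebra D\<^esub>) = \<one>\<^bsub>A\<^esub>"
      using Pw[of 1] V.one_closed eD(4) by simp
  qed
  moreover have "\<epsilon> (P [:0, 1:]) = a"
  proof -
    have "gen_hom \<pi> (mpoly_var VX) = [:0, 1:]" unfolding gen_hom_def by simp
    then show ?thesis using Pw[OF var[OF VX]] \<epsilon>(2)[OF VX] by (simp add: v_def)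
  qed
  ultimately show "\<exists>h\<in>algebra_hom (ring_on D) (Int_algebra D) A. h [:0, 1:] = a"
    by (intro bexI[of _ "\<lambda>f. \<epsilon> (P f)"])
qed

end

section \<open>Digit products\<close>

text \<open>\<open>digit_prod M q g n\<close> is the product of the \<open>g k ^ n\<^sub>k\<close>, where the \<open>n\<^sub>k\<close> are the digits of \<open>n\<close>
  in base \<open>q\<close>; the condition \<open>q < 2\<close> only ensures termination.\<close>

function digit_prod :: "('c, 'm) ring_scheme \<Rightarrow> nat \<Rightarrow> (nat \<Rightarrow> 'c) \<Rightarrow> nat \<Rightarrow> 'c" where
  "digit_prod M q g n = (if n = 0 \<or> q < 2 then \<one>\<^bsub>M\<^esub>
     else g 0 [^]\<^bsub>M\<^esub> (n mod q) \<otimes>\<^bsub>M\<^esub> digit_prod M q (\<lambda>k. g (Suc k)) (n div q))"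
  by auto
termination by (relation "measure (\<lambda>(M, q, g, n). n)") auto

declare digit_prod.simps [simp del]

context algebra begin

context
  fixes q :: nat
  assumes q: "q \<ge> 2"
begin

lemma digit_prod_closed:
  assumes "range g \<subseteq> carrier M"
  shows "digit_prod M q g n \<in> carrier M"
  using assms
proof (induction n arbitrary: g rule: less_induct)
  case (less n)
  have g': "range (\<lambda>k. g (Suc k)) \<subseteq> carrier M" and g0: "g 0 \<in> carrier M" using less.prems by auto
  show ?case
  proof (cases "n = 0")
    case True
    then show ?thesis by (simp add: digit_prod.simps[of _ _ _ 0])
  next
    case False
    then have "digit_prod M q (\<lambda>k. g (Suc k)) (n div q) \<in> carrier M" using less.IH[OF _ g'] q by simp
    then show ?thesis using g0 False q by (subst digit_prod.simps) simp
  qed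
qed

lemma digit_prod_unfold:
  assumes "range g \<subseteq> carrier M"
  shows "digit_prod M q g n = g 0 [^]\<^bsub>M\<^esub> (n mod q) \<otimes>\<^bsub>M\<^esub> digit_prod M q (\<lambda>k. g (Suc k)) (n div q)"
proof (cases "n = 0")
  case True
  then show ?thesis by (simp add: digit_prod.simps[of _ _ _ 0])
next
  case False
  then show ?thesis using q by (subst digit_prod.simps) auto
qed

lemma digit_prod_digits:
  assumes "range g \<subseteq> carrier M" "r < q"
  shows "digit_prod M q g (r + q * n) = g 0 [^]\<^bsub>M\<^esub> r \<otimes>\<^bsub>M\<^esub> digit_prod M q (\<lambda>k. g (Suc k)) n"
  using digit_prod_unfold[OF assms(1), of "r + q * n"] assms(2) q by simp

lemma digit_prod_alg_gen:
  assumes "range g \<subseteq> G"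
  shows "digit_prod M q g n \<in> alg_gen G"
  using assms
proof (induction n arbitrary: g rule: less_induct)
  case (less n)
  have g': "range (\<lambda>k. g (Suc k)) \<subseteq> G" and g0: "g 0 \<in> alg_gen G"
    using less.prems by (auto intro: alg_gen.gen)
  show ?case
  proof (cases "n = 0")
    case True
    then show ?thesis using alg_gen.one by (simp add: digit_prod.simps[of _ _ _ 0])
  next
    case False
    then have "digit_prod M q (\<lambda>k. g (Suc k)) (n div q) \<in> alg_gen G" using less.IH[OF _ g'] q by simp
    then show ?thesis
      using alg_gen_power[OF g0] alg_gen.mult False q by (subst digit_prod.simps) simp
  qed
qed

context
  fixes \<pi> assumes pi: "\<pi> \<in> carrier R"
begin

text \<open>The digits of q n are those of n moved up one place with lowest digit 0, so a digit
  product of the shifted sequence at n is one of g at q n.\<close>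

lemma digit_prod_shift_subset:
  assumes "range g \<subseteq> carrier M"
  shows "lin_span (range (digit_prod M q (\<lambda>k. g (Suc k)))) \<subseteq> lin_span (range (digit_prod M q g))"
proof -
  have cl: "range (digit_prod M q g) \<subseteq> carrier M" "range (digit_prod M q (\<lambda>k. g (Suc k))) \<subseteq> carrier M"
    using digit_prod_closed[of g] digit_prod_closed[of "\<lambda>k. g (Suc k)"] assms by blast+
  have "digit_prod M q (\<lambda>k. g (Suc k)) n \<in> lin_span (range (digit_prod M q g))" for n
  proof -
    have "digit_prod M q (\<lambda>k. g (Suc k)) n \<in> carrier M" using cl(2) by blast
    then    have "digit_prod M q (\<lambda>k. g (Suc k)) n = digit_prod M q g (0 + q * n)"
      using digit_prod_digits[OF assms, of 0 n] q by simp
    then show ?thesis using lin_span_base[OF cl(1)] by simp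
  qed
  then show ?thesis using lin_span_subset[OF cl(2,1)] by blast
qed

text \<open>Multiplying by \<open>g 0\<close> raises the lowest digit; on overflow \<open>g 0 ^ q = g 0 + \<pi> g 1\<close> moves the
  problem to the next digit.\<close>

lemma digit_prod_mult_0:
  assumes "range g \<subseteq> carrier M" "\<And>k. g k [^]\<^bsub>M\<^esub> q = g k \<oplus>\<^bsub>M\<^esub> \<pi> \<odot>\<^bsub>M\<^esub> g (Suc k)"
  shows "g 0 \<otimes>\<^bsub>M\<^esub> digit_prod M q g n \<in> lin_span (range (digit_prod M q g))"
  using assms
proof (induction n arbitrary: g rule: less_induct)
  case (less n)
  let ?g' = "\<lambda>k. g (Suc k)" and ?L = "lin_span (range (digit_prod M q g))"
  let ?X = "digit_prod M q ?g' (n div q)"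
  have g: "g k \<in> carrier M" for k using less.prems(1) by auto
  have g': "range ?g' \<subseteq> carrier M" using less.prems(1) by auto
  have X: "?X \<in> carrier M" by (rule digit_prod_closed[OF g'])
  have cl: "range (digit_prod M q g) \<subseteq> carrier M"
    using digit_prod_closed[OF less.prems(1)] by blast
  have base: "digit_prod M q g m \<in> ?L" for m by (rule lin_span_base[OF cl]) simp
  have step: "g 0 \<otimes>\<^bsub>M\<^esub> digit_prod M q g n = g 0 [^]\<^bsub>M\<^esub> Suc (n mod q) \<otimes>\<^bsub>M\<^esub> ?X"
    using digit_prod_unfold[OF less.prems(1), of n] g X by (simp add: m_ac)
  show ?case
  proof (cases "Suc (n mod q) < q")
    case True
    then show ?thesis
      using digit_prod_digits[OF less.prems(1) True, of "n div q"] base step by metis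
  next
    case False
    then have "Suc (n mod q) = q" using q mod_less_divisor[of q n] by linarith
    moreover from this have "n \<noteq> 0" using q by (cases "n = 0") auto
    ultimately have "g 0 \<otimes>\<^bsub>M\<^esub> digit_prod M q g n = (g 0 \<oplus>\<^bsub>M\<^esub> \<pi> \<odot>\<^bsub>M\<^esub> g (Suc 0)) \<otimes>\<^bsub>M\<^esub> ?X"
      using step less.prems(2)[of 0] by simp
    also have "\<dots> = g 0 \<otimes>\<^bsub>M\<^esub> ?X \<oplus>\<^bsub>M\<^esub> \<pi> \<odot>\<^bsub>M\<^esub> (g (Suc 0) \<otimes>\<^bsub>M\<^esub> ?X)"
      using g X pi by (simp add: l_distr smult_assoc2)
    also have "\<dots> \<in> ?L"
    proof (rule lin_span_add[OF cl])
      show "g 0 \<otimes>\<^bsub>M\<^esub> ?X \<in> ?L"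
        using digit_prod_digits[OF less.prems(1), of 1 "n div q"] base[of "1 + q * (n div q)"] q g by simp
      have "g (Suc 0) \<otimes>\<^bsub>M\<^esub> ?X \<in> lin_span (range (digit_prod M q ?g'))"
        using less.IH[of "n div q" ?g'] less.prems(2) g' q \<open>n \<noteq> 0\<close> by simp
      then have "g (Suc 0) \<otimes>\<^bsub>M\<^esub> ?X \<in> ?L" using digit_prod_shift_subset[OF less.prems(1)] by blast
      then show "\<pi> \<odot>\<^bsub>M\<^esub> (g (Suc 0) \<otimes>\<^bsub>M\<^esub> ?X) \<in> ?L" using lin_span_smult[OF cl] pi by blast
    qed
    finally show ?thesis .
  qed
qed

text \<open>A generator of positive index does not touch the lowest digit: the induction hypothesis
  for the shifted sequence handles the upper digits, and the power of \<open>g 0\<close> is put back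
  one factor at a time by \<open>digit_prod_mult_0\<close>.\<close>

lemma digit_prod_mult:
  assumes "range g \<subseteq> carrier M" "\<And>k. g k [^]\<^bsub>M\<^esub> q = g k \<oplus>\<^bsub>M\<^esub> \<pi> \<odot>\<^bsub>M\<^esub> g (Suc k)"
  shows "g j \<otimes>\<^bsub>M\<^esub> digit_prod M q g n \<in> lin_span (range (digit_prod M q g))"
  using assms
proof (induction j arbitrary: g n)
  case 0
  then show ?case by (rule digit_prod_mult_0)
next
  case (Suc j)
  let ?g' = "\<lambda>k. g (Suc k)" and ?L = "lin_span (range (digit_prod M q g))"
  let ?X = "digit_prod M q ?g' (n div q)"
  have g: "g k \<in> carrier M" for k using Suc.prems(1) by auto
  have g': "range ?g' \<subseteq> carrier M" using Suc.prems(1) by auto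
  have X: "?X \<in> carrier M" by (rule digit_prod_closed[OF g'])
  have cl: "range (digit_prod M q g) \<subseteq> carrier M"
    using digit_prod_closed[OF Suc.prems(1)] by blast
  have "g (Suc j) \<otimes>\<^bsub>M\<^esub> ?X \<in> lin_span (range (digit_prod M q ?g'))"
    using Suc.IH[of ?g' "n div q"] Suc.prems(2) g' by simp
  then have 1: "g (Suc j) \<otimes>\<^bsub>M\<^esub> ?X \<in> ?L" using digit_prod_shift_subset[OF Suc.prems(1)] by blast
  have g0: "g 0 \<otimes>\<^bsub>M\<^esub> y \<in> ?L" if "y \<in> ?L" for y
    by (rule lin_span_mult[OF cl cl g _ that]) (use digit_prod_mult_0[OF Suc.prems] in auto)
  have "g 0 [^]\<^bsub>M\<^esub> r \<otimes>\<^bsub>M\<^esub> y \<in> ?L" if "y \<in> ?L" for r :: nat and y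
  proof (induction r)
    case 0
    then show ?case using that lin_span_closed[OF cl that] by simp
  next
    case (Suc r)
    have "g 0 [^]\<^bsub>M\<^esub> Suc r \<otimes>\<^bsub>M\<^esub> y = g 0 \<otimes>\<^bsub>M\<^esub> (g 0 [^]\<^bsub>M\<^esub> r \<otimes>\<^bsub>M\<^esub> y)"
      using g lin_span_closed[OF cl that] by (simp add: m_ac)
    then show ?case using g0[OF Suc] by simp
  qed
  moreover have "g (Suc j) \<otimes>\<^bsub>M\<^esub> digit_prod M q g n = g 0 [^]\<^bsub>M\<^esub> (n mod q) \<otimes>\<^bsub>M\<^esub> (g (Suc j) \<otimes>\<^bsub>M\<^esub> ?X)"
    using digit_prod_unfold[OF Suc.prems(1), of n] g X by (simp add: m_ac)
  ultimately show ?case using 1 by simp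
qed

lemma alg_gen_subset_digit_prods:
  assumes "range g \<subseteq> carrier M" "\<And>k. g k [^]\<^bsub>M\<^esub> q = g k \<oplus>\<^bsub>M\<^esub> \<pi> \<odot>\<^bsub>M\<^esub> g (Suc k)"
  shows "alg_gen (range g) \<subseteq> lin_span (range (digit_prod M q g))"
proof (rule alg_gen_subset_lin_span)
  show cl: "range (digit_prod M q g) \<subseteq> carrier M"
    using digit_prod_closed[OF assms(1)] by blast
  have "digit_prod M q g 0 \<in> lin_span (range (digit_prod M q g))" by (rule lin_span_base[OF cl]) simp
  then show "\<one>\<^bsub>M\<^esub> \<in> lin_span (range (digit_prod M q g))" by (simp add: digit_prod.simps[of _ _ _ 0])
qed (use assms digit_prod_mult in auto)

end
end

text \<open>Clearing denominators: if scalars from the multiplicative set \<open>C\<close> bring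
  each generator into \<open>alg_gen H\<close>, products of such scalars do so for every polynomial
  expression in the generators.\<close>

lemma alg_gen_scaled:
  assumes C: "C \<subseteq> carrier R" "\<one> \<in> C" "\<And>c d. c \<in> C \<Longrightarrow> d \<in> C \<Longrightarrow> c \<otimes> d \<in> C"
    and H: "H \<subseteq> carrier M" and G: "\<And>g. g \<in> G \<Longrightarrow> g \<in> carrier M \<and> (\<exists>c\<in>C. c \<odot>\<^bsub>M\<^esub> g \<in> alg_gen H)"
    and x: "x \<in> alg_gen G"
  shows "\<exists>c\<in>C. c \<odot>\<^bsub>M\<^esub> x \<in> alg_gen H"
proof -
  have Gc: "G \<subseteq> carrier M" using G by blast
  from x show ?thesis
  proof induction
    case one
    then show ?case using C(2) alg_gen.one by (intro bexI[of _ \<one>]) (auto intro: alg_gen.intros)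
  next
    case (gen g)
    then show ?case using G by blast
  next
    case (add x y)
    then obtain c d where cd: "c \<in> C" "d \<in> C" "c \<odot>\<^bsub>M\<^esub> x \<in> alg_gen H" "d \<odot>\<^bsub>M\<^esub> y \<in> alg_gen H" by blast
    have xy: "x \<in> carrier M" "y \<in> carrier M" using alg_gen_closed[OF Gc] add by auto
    have R: "c \<in> carrier R" "d \<in> carrier R" using cd C by auto
    have "(c \<otimes> d) \<odot>\<^bsub>M\<^esub> x = d \<odot>\<^bsub>M\<^esub> (c \<odot>\<^bsub>M\<^esub> x)" "(c \<otimes> d) \<odot>\<^bsub>M\<^esub> y = c \<odot>\<^bsub>M\<^esub> (d \<odot>\<^bsub>M\<^esub> y)"
      using R xy smult_assoc1[of d c x] smult_assoc1[of c d y] by (simp_all add: R.m_comm)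
    then have "(c \<otimes> d) \<odot>\<^bsub>M\<^esub> (x \<oplus>\<^bsub>M\<^esub> y) \<in> alg_gen H"
      using R xy cd by (simp add: smult_r_distr alg_gen.intros)
    then show ?case using C(3) cd by blast
  next
    case (mult x y)
    then obtain c d where cd: "c \<in> C" "d \<in> C" "c \<odot>\<^bsub>M\<^esub> x \<in> alg_gen H" "d \<odot>\<^bsub>M\<^esub> y \<in> alg_gen H" by blast
    have xy: "x \<in> carrier M" "y \<in> carrier M" using alg_gen_closed[OF Gc] mult by auto
    have R: "c \<in> carrier R" "d \<in> carrier R" using cd C by auto
    have "(c \<otimes> d) \<odot>\<^bsub>M\<^esub> (x \<otimes>\<^bsub>M\<^esub> y) \<in> alg_gen H"
      using alg_gen.mult[OF cd(3,4)] smult_smult_mult[OF R xy] by simp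
    then show ?case using C(3) cd by blast
  next
    case (smult r x)
    then obtain c where c: "c \<in> C" "c \<odot>\<^bsub>M\<^esub> x \<in> alg_gen H" by blast
    have "x \<in> carrier M" "c \<in> carrier R" using alg_gen_closed[OF Gc] smult c C by auto
    then have "c \<odot>\<^bsub>M\<^esub> (r \<odot>\<^bsub>M\<^esub> x) = r \<odot>\<^bsub>M\<^esub> (c \<odot>\<^bsub>M\<^esub> x)"
      using smult_assoc1[of c r x] smult_assoc1[of r c x] smult(1) by (simp add: R.m_comm)
    then show ?case using c smult(1) by (metis alg_gen.smult)
  qed
qed

end

section \<open>Polynomials of prescribed degrees\<close>

lemma degree_independent:
  fixes e :: "nat \<Rightarrow> 'r::idom poly"
  assumes e: "\<And>n. degree (e n) = n" "\<And>n. e n \<noteq> 0"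
    and F: "finite F" "(\<Sum>m\<in>F. Polynomial.smult (c m) (e m)) = 0" "m \<in> F"
  shows "c m = 0"
proof (rule ccontr)
  assume "c m \<noteq> 0"
  let ?F = "{m\<in>F. c m \<noteq> 0}"
  define n where "n = Max ?F"
  have n: "n \<in> ?F" unfolding n_def by (rule Max_in) (use F \<open>c m \<noteq> 0\<close> in auto)
  have "coeff (Polynomial.smult (c i) (e i)) n = (if i = n then c n * lead_coeff (e n) else 0)" if "i \<in> F" for i
  proof -
    have "c i = 0 \<or> i \<le> n" using that F(1) unfolding n_def by (auto intro!: Max_ge)
    then consider "c i = 0" | "i = n" | "i < n" by linarith
    then show ?thesis using e(1) n by cases (auto simp: coeff_eq_0)
  qed
  then have "coeff (\<Sum>m\<in>F. Polynomial.smult (c m) (e m)) n = c n * lead_coeff (e n)"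
    using n F(1) by (simp add: coeff_sum sum.delta del: coeff_smult cong: sum.cong)
  then show False using F(2) n e(2)[of n] by simp
qed

text \<open>The digit product of the iterates of F, written as a recursion by composition, since
  composing with F advances every iterate by one (\<open>digit_prod_poly\<close>). In this form
  degree and leading coefficient can be computed.\<close>

function poly_digit :: "nat \<Rightarrow> 'k::field poly \<Rightarrow> nat \<Rightarrow> 'k poly" where
  "poly_digit q F n = (if n = 0 \<or> q < 2 then 1 else [:0, 1:] ^ (n mod q) * pcompose (poly_digit q F (n div q)) F)"
  by auto
termination by (relation "measure (\<lambda>(q, F, n). n)") auto

text \<open>Legendre's formula for the exponent of \<open>\<pi>\<^sub>q\<close> in the n-th generalized factorial.\<close>

function legendre_exp :: "nat \<Rightarrow> nat \<Rightarrow> nat" where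
  "legendre_exp q n = (if n = 0 \<or> q < 2 then 0 else n div q + legendre_exp q (n div q))"
  by auto
termination by (relation "measure (\<lambda>(q, n). n)") auto

declare poly_digit.simps [simp del] legendre_exp.simps [simp del]

lemma legendre_exp_less: "n < q \<Longrightarrow> legendre_exp q n = 0"
  by (simp add: legendre_exp.simps[of q n] legendre_exp.simps[of q 0])

text \<open>Composition with F multiplies the degree n div q by q and contributes the factor
  (1/\<pi>)^(n div q) to the leading coefficient, which is the recursion of
  \<open>legendre_exp\<close>; the remaining n mod q comes from the power of X.\<close>

lemma degree_lead_poly_digit:
  fixes F :: "'k::field poly"
  assumes q: "q \<ge> 2" and F: "degree F = q" "lead_coeff F = 1 / \<pi>"
  shows "degree (poly_digit q F n) = n \<and> lead_coeff (poly_digit q F n) = 1 / \<pi> ^ legendre_exp q n \<and> poly_digit q F n \<noteq> 0"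
proof (induction n rule: less_induct)
  case (less n)
  show ?case
  proof (cases "n = 0")
    case True
    then show ?thesis by (simp add: poly_digit.simps[of q F 0] legendre_exp.simps[of q 0])
  next
    case False
    let ?B = "poly_digit q F (n div q)"
    have IH: "degree ?B = n div q" "lead_coeff ?B = 1 / \<pi> ^ legendre_exp q (n div q)" "?B \<noteq> 0"
      using less[of "n div q"] False q by auto
    have eq: "poly_digit q F n = [:0, 1:] ^ (n mod q) * pcompose ?B F"
      using False q by (subst poly_digit.simps) auto
    have deg: "degree (pcompose ?B F) = (n div q) * q" using IH(1) F(1) by (simp add: degree_pcompose)
    have lead: "lead_coeff (pcompose ?B F) = 1 / \<pi> ^ legendre_exp q (n div q) * (1 / \<pi>) ^ (n div q)"
      using lead_coeff_comp[of F ?B] IH F q by simp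
    have "lead_coeff F \<noteq> 0" using F q by auto
    then have "\<pi> \<noteq> 0" using F by auto
    then have ne: "pcompose ?B F \<noteq> 0" using lead by auto
    have "degree (poly_digit q F n) = n"
      unfolding eq using ne by (subst degree_mult_eq) (auto simp: deg degree_power_eq)
    moreover have "lead_coeff (poly_digit q F n) = 1 / \<pi> ^ legendre_exp q n"
      unfolding eq lead_coeff_mult lead_coeff_power lead using False q
      by (simp add: legendre_exp.simps[of q n] power_add field_simps)
    moreover have "poly_digit q F n \<noteq> 0" unfolding eq using ne by simp
    ultimately show ?thesis by blast
  qed
qed

lemma poly_iterate_0 [simp]: "poly_iterate F 0 = [:0, 1:]"
  and poly_iterate_Suc: "poly_iterate F (Suc k) = pcompose F (poly_iterate F k)"
  by (simp_all add: poly_iterate_def)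

lemma pcompose_power: "pcompose (p ^ n) q = pcompose p q ^ n"
  by (induction n) (simp_all add: pcompose_mult pcompose_1)

text \<open>All starting indices k are needed because the recursion passes from k to k + 1; for k =
  0 the composition is with X.\<close>

lemma digit_prod_poly:
  assumes q: "q \<ge> 2"
  shows "digit_prod (algebra_on s UNIV) q (\<lambda>i. poly_iterate F (i + k)) n = pcompose (poly_digit q F n) (poly_iterate F k)"
proof (induction n arbitrary: k rule: less_induct)
  case (less n)
  show ?case
  proof (cases "n = 0")
    case True
    then show ?thesis by (simp add: digit_prod.simps[of _ _ _ 0] poly_digit.simps[of _ _ 0] pcompose_1)
  next
    case False
    have "digit_prod (algebra_on s UNIV) q (\<lambda>i. poly_iterate F (i + k)) n =
        poly_iterate F k ^ (n mod q) * digit_prod (algebra_on s UNIV) q (\<lambda>i. poly_iterate F (i + Suc k)) (n div q)"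
      using False q by (subst digit_prod.simps) simp
    also have "digit_prod (algebra_on s UNIV) q (\<lambda>i. poly_iterate F (i + Suc k)) (n div q) =
        pcompose (poly_digit q F (n div q)) (poly_iterate F (Suc k))"
      using less[of "n div q" "Suc k"] False q by simp
    also have "poly_iterate F k ^ (n mod q) * \<dots> = pcompose (poly_digit q F n) (poly_iterate F k)"
      using False q
      by (subst poly_digit.simps) (simp add: pcompose_mult pcompose_power poly_iterate_Suc pcompose_assoc pcompose_pCons)
    finally show ?thesis .
  qed
qed

lemma fst_digit_prod:
  "fst (digit_prod (prod_algebra P A) q g n) = digit_prod P q (\<lambda>k. fst (g k)) n"
  by (induction n arbitrary: g rule: less_induct)
    (subst digit_prod.simps, subst (2) digit_prod.simps, simp)

context domain_in_field begin

section \<open>The class C\<close>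

lemma prod_mem_Pi:
  assumes "finite {p. t_maximal D p \<and> finite_norm D p \<and> ideal_norm D p = q}"
    and x: "\<And>p. p \<in> {p. t_maximal D p \<and> finite_norm D p \<and> ideal_norm D p = q} \<Longrightarrow> x p \<in> p"
  shows "prod x {p. t_maximal D p \<and> finite_norm D p \<and> ideal_norm D p = q} \<in> Pi_ideal D q"
proof -
  let ?T = "{p. t_maximal D p \<and> finite_norm D p \<and> ideal_norm D p = q}"
  have xD: "x p \<in> D" if "p \<in> ?T" for p using x[OF that] t_maximal_proper that by blast
  have "prod x ?T \<in> p" if "p \<in> ?T" for p
  proof -
    have "submod p" using that t_maximal_proper by blast
    moreover have "prod x (?T - {p}) \<in> D" using xD by (intro prod_mem) auto
    ultimately have "x p * prod x (?T - {p}) \<in> p" using submod_mult_right x[OF that] by blast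
    then show ?thesis using prod.remove[OF assms(1) that, of x] by simp
  qed
  moreover have "prod x ?T \<in> D" using xD by (rule prod_mem)
  ultimately show ?thesis unfolding Pi_ideal_def by blast
qed

text \<open>A principal ideal could be zero. Here finitely many ideals are intersected, each with a
  nonzero element, and the product of these elements is a nonzero element of \<Pi>_q.\<close>

lemma class_C_principal_Pi:
  assumes "class_C D"
  obtains \<pi> where "principal_Pi \<pi>"
proof -
  have "\<exists>c. primepow q \<longrightarrow> c \<in> D \<and> c \<noteq> 0 \<and> Pi_ideal D q = {c * d |d. d \<in> D}" for q
  proof (cases "primepow q")
    case True
    then have "principalideal (Pi_ideal D q) (ring_on D)" using assms by (simp add: class_C_def)
    then obtain c where c: "c \<in> D" "Pi_ideal D q = genideal (ring_on D) {c}"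
      using principalideal.generate[of "Pi_ideal D q" "ring_on D"] by auto
    then have eq: "Pi_ideal D q = {c * d |d. d \<in> D}"
      using D.cgenideal_eq_genideal[of c] by (auto simp: cgenideal_def mult.commute)
    let ?T = "{p. t_maximal D p \<and> finite_norm D p \<and> ideal_norm D p = q}"
    have "?T \<subseteq> {p. t_maximal D p \<and> finite_norm D p \<and> ideal_norm D p \<le> q}" by auto
    then have fin: "finite ?T" using assms finite_subset unfolding class_C_def by blast
    have "\<forall>p\<in>?T. \<exists>x. x \<in> p \<and> x \<noteq> 0"
      using t_maximal_proper submod_zero by blast
    then obtain x where x: "\<And>p. p \<in> ?T \<Longrightarrow> x p \<in> p \<and> x p \<noteq> 0" by metis
    have "prod x ?T \<in> Pi_ideal D q" "prod x ?T \<noteq> 0"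
      using prod_mem_Pi[OF fin, of x] x fin by auto
    then have "c \<noteq> 0" using eq by auto
    then show ?thesis using c eq by blast
  qed simp
  then have "\<exists>\<pi>. \<forall>q. primepow q \<longrightarrow> \<pi> q \<in> D \<and> \<pi> q \<noteq> 0 \<and> Pi_ideal D q = {\<pi> q * d |d. d \<in> D}"
    by (intro choice allI)
  then obtain \<pi> where "principal_Pi \<pi>" unfolding principal_Pi_def by (elim exE)
  then show thesis by (rule that)
qed

lemma max_ideal_eqI:
  assumes "max_ideal p" "max_ideal M" "p \<subseteq> M"
  shows "p = M"
proof (rule ccontr)
  assume "p \<noteq> M"
  then obtain x where x: "x \<in> M" "x \<in> D - p" using assms by (auto simp: max_ideal_def)
  then obtain y where y: "y \<in> D" "x * y - 1 \<in> p" using assms(1) unfolding max_ideal_def by blast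
  have M: "submod M" "1 \<notin> M" using assms(2) by (auto simp: max_ideal_def)
  have "x * y - (x * y - 1) \<in> M"
    using submod_diff[OF M(1) submod_mult_right[OF M(1) x(1) y(1)]] y(2) assms(3) by blast
  then show False using M by simp
qed

text \<open>Scalars that avoid every maximal ideal containing \<pi>_q, and can therefore be cleared
  when only the index q matters.\<close>

inductive_set pi_products :: "(nat \<Rightarrow> 'k) \<Rightarrow> nat \<Rightarrow> 'k set" for \<pi> q where
  one: "1 \<in> pi_products \<pi> q"
| step: "c \<in> pi_products \<pi> q \<Longrightarrow> primepow q' \<Longrightarrow> q' \<noteq> q \<Longrightarrow> \<pi> q' * c \<in> pi_products \<pi> q"

lemma pi_products_mult:
  "c \<in> pi_products \<pi> q \<Longrightarrow> d \<in> pi_products \<pi> q \<Longrightarrow> c * d \<in> pi_products \<pi> q"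
  by (induction rule: pi_products.induct) (auto simp: mult.assoc intro: pi_products.intros)

lemma pi_products_prod:
  assumes "\<And>q'. q' \<in> Q \<Longrightarrow> primepow q' \<and> q' \<noteq> q"
  shows "(\<Prod>q'\<in>Q. \<pi> q' ^ N q') \<in> pi_products \<pi> q"
proof -
  have "\<pi> q' ^ n \<in> pi_products \<pi> q" if "q' \<in> Q" for q' n
    by (induction n) (use assms[OF that] in \<open>auto intro: pi_products.intros\<close>)
  then show ?thesis
    by (induction Q rule: infinite_finite_induct) (auto intro: pi_products.one pi_products_mult)
qed

end

locale principal_Pi_domain = domain_in_field D for D :: "'k::field set" +
  fixes \<pi> :: "nat \<Rightarrow> 'k"
  assumes pi: "principal_Pi \<pi>"
    and finitely_many: "finite {p. t_maximal D p \<and> finite_norm D p \<and> ideal_norm D p \<le> n}"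
begin

lemma pi_D: "primepow q \<Longrightarrow> \<pi> q \<in> D" and pi_nonzero: "primepow q \<Longrightarrow> \<pi> q \<noteq> 0"
  using pi by (auto simp: principal_Pi_def)

lemma pi_products_D: "c \<in> pi_products \<pi> q \<Longrightarrow> c \<in> D"
  by (induction rule: pi_products.induct) (auto simp: pi_D)

text \<open>M contains a finite intersection of ideals, hence one of them: otherwise a product of
  elements x p in p but outside M would lie in \<Pi>_q = \<pi>_q D, hence in the prime ideal M. The
  ideal found is itself maximal, so it equals M.\<close>

lemma norm_of_max_ideal:
  assumes M: "max_ideal M" and q: "primepow q" and piM: "\<pi> q \<in> M"
  shows "ideal_norm D M = q"
proof -
  let ?T = "{p. t_maximal D p \<and> finite_norm D p \<and> ideal_norm D p = q}"
  have "?T \<subseteq> {p. t_maximal D p \<and> finite_norm D p \<and> ideal_norm D p \<le> q}" by auto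
  then have fin: "finite ?T" using finitely_many finite_subset by blast
  have M': "submod M" "M \<subseteq> D" using M by (auto simp: max_ideal_def)
  have "\<exists>p\<in>?T. p \<subseteq> M"
  proof (rule ccontr)
    assume "\<not> ?thesis"
    then have "\<forall>p\<in>?T. \<exists>x. x \<in> p \<and> x \<notin> M" by blast
    then obtain x where x: "\<And>p. p \<in> ?T \<Longrightarrow> x p \<in> p \<and> x p \<notin> M" by metis
    have "prod x ?T \<in> Pi_ideal D q" using prod_mem_Pi[OF fin, of x] x by auto
    then obtain d where "d \<in> D" "prod x ?T = \<pi> q * d" using pi q by (auto simp: principal_Pi_def)
    then have "prod x ?T \<in> M" using submod_mult_right[OF M'(1) piM] by simp
    moreover have "x p \<in> D" if "p \<in> ?T" for p using x[OF that] t_maximal_proper that by blast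
    ultimately show False using prime_id_prod[OF max_ideal_prime[OF M] fin, of x] x by blast
  qed
  then obtain p where p: "t_maximal D p" "finite_norm D p" "ideal_norm D p = q" "p \<subseteq> M" by blast
  then have "p = M" using max_ideal_eqI[OF t_maximal_finite_norm_max M] by blast
  then show ?thesis using p by simp
qed

text \<open>The \<open>\<pi>\<^sub>q\<close> are pairwise comaximal: a maximal ideal containing \<open>\<pi>\<^sub>q\<close> has norm \<open>q\<close>.\<close>

lemma one_mem_if_pi_products:
  assumes J: "J \<subseteq> D" "submod J" and ex: "\<And>q. primepow q \<Longrightarrow> \<exists>c\<in>pi_products \<pi> q. c \<in> J"
  shows "1 \<in> J"
proof (rule ccontr)
  assume "1 \<notin> J"
  then obtain M where M: "max_ideal M" "J \<subseteq> M" using max_ideal_exists[OF J] by blast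
  have pr: "prime_id M" by (rule max_ideal_prime[OF M(1)])
  have "\<exists>q'. primepow q' \<and> q' \<noteq> q \<and> \<pi> q' \<in> M" if "c \<in> pi_products \<pi> q" "c \<in> M" for c q
    using that
  proof induction
    case one
    then show ?case using pr by (simp add: prime_id_def)
  next
    case (step c q')
    then have "\<pi> q' \<in> M \<or> c \<in> M" using pr pi_D pi_products_D by (auto simp: prime_id_def)
    then show ?case using step by blast
  qed
  then have "\<exists>q'. primepow q' \<and> q' \<noteq> q \<and> \<pi> q' \<in> M" if "primepow q" for q
    using ex[OF that] M(2) by blast
  \<comment> \<open>Any prime power can start the argument: it yields some \<pi>_{q'} in M, the case
    q = q' then yields another index, and M would have two norms.\<close>
  moreover have "primepow (2::nat)" by simp
  ultimately show False using norm_of_max_ideal[OF M(1)] by metis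
qed

abbreviation Fq :: "nat \<Rightarrow> 'k poly" where "Fq q \<equiv> F_poly (\<pi> q) q"

lemma degree_lead_F_poly:
  assumes "primepow q"
  shows "degree (Fq q) = q" "lead_coeff (Fq q) = 1 / \<pi> q"
proof -
  have q: "q > 1" using primepow_gt_Suc_0[OF assms] by simp
  have dX: "degree ([:0, 1:] ^ q :: 'k poly) = q" by (simp add: degree_power_eq)
  have "degree ([:0, 1:] ^ q + - [:0, 1:] :: 'k poly) = degree ([:0, 1:] ^ q :: 'k poly)"
    by (rule degree_add_eq_left) (use q dX in simp)
  then have "degree ([:0, 1:] ^ q - [:0, 1:] :: 'k poly) = q"
    unfolding diff_conv_add_uminus dX .
  then show deg: "degree (Fq q) = q"
    unfolding F_poly_def degree_smult_eq using pi_nonzero[OF assms] by (simp only: divide_eq_0_iff if_False) simp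
  have "coeff ([:0, 1:] ^ q :: 'k poly) q = 1"
    using lead_coeff_power[of "[:0, 1:] :: 'k poly" q] by (simp add: degree_power_eq)
  moreover have "coeff ([:0, 1:] :: 'k poly) q = 0" using q by (intro coeff_eq_0) simp
  ultimately show "lead_coeff (Fq q) = 1 / \<pi> q" unfolding deg by (simp add: F_poly_def)
qed

text \<open>Composition of \<pi>_q F_q + X = X^q with the k-th iterate. It is the relation that
  \<open>iterated_divisions\<close> imposes on the elements of A, so the pairs satisfy it in the
  product algebra.\<close>

lemma poly_iterate_power:
  assumes "primepow q"
  shows "poly_iterate (Fq q) k ^ q = poly_iterate (Fq q) k + Polynomial.smult (\<pi> q) (poly_iterate (Fq q) (Suc k))"
proof -
  have "pcompose (Polynomial.smult (\<pi> q) (Fq q) + [:0, 1:]) (poly_iterate (Fq q) k) = pcompose ([:0, 1:] ^ q) (poly_iterate (Fq q) k)"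
    using F_poly_eq[OF pi_nonzero[OF assms], of q] by simp
  then show ?thesis
    by (simp add: pcompose_add pcompose_smult pcompose_power pcompose_pCons poly_iterate_Suc add.commute)
qed

lemma poly_iterate_Int:
  assumes "primepow q"
  shows "poly_iterate (Fq q) k \<in> Int_poly D"
proof (induction k)
  case 0
  then show ?case by (simp add: Int_poly_def)
next
  case (Suc k)
  then show ?case using F_poly_Int[OF pi assms] by (simp add: Int_poly_def poly_iterate_Suc poly_pcompose)
qed

subsection \<open>A regular basis\<close>

abbreviation Int_gens :: "'k poly set" where
  "Int_gens \<equiv> {poly_iterate (Fq q) k |q k. primepow q}"

text \<open>The projection of \<Gamma> to polynomials. It lies in Int(D) because the iterates do;
  the opposite inclusion is \<open>Int_poly_subset_E_alg\<close>.\<close>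

abbreviation E_alg :: "'k poly set" where
  "E_alg \<equiv> algebra.alg_gen (ring_on D) (algebra_on Polynomial.smult UNIV) Int_gens"

lemma E_alg_closed:
  "1 \<in> E_alg" "f \<in> E_alg \<Longrightarrow> g \<in> E_alg \<Longrightarrow> f + g \<in> E_alg"
  "c \<in> D \<Longrightarrow> f \<in> E_alg \<Longrightarrow> Polynomial.smult c f \<in> E_alg"
proof -
  interpret P: algebra "ring_on D" "algebra_on Polynomial.smult (UNIV :: 'k poly set)" by (rule algebra_poly)
  show "1 \<in> E_alg" using P.alg_gen.one by simp
  show "f + g \<in> E_alg" if "f \<in> E_alg" "g \<in> E_alg" using P.alg_gen.add[OF that] by simp
  show "Polynomial.smult c f \<in> E_alg" if "c \<in> D" "f \<in> E_alg" using P.alg_gen.smult[of c f] that by simp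
qed

lemma E_alg_subset_Int: "E_alg \<subseteq> Int_poly D"
proof
  interpret P: algebra "ring_on D" "algebra_on Polynomial.smult (UNIV :: 'k poly set)" by (rule algebra_poly)
  fix f assume "f \<in> E_alg"
  then show "f \<in> Int_poly D"
  proof induction
    case (gen g)
    then show ?case using poly_iterate_Int by blast
  qed (auto simp: Int_poly_def)
qed

lemma poly_digit_mem:
  assumes q: "primepow q"
  shows "poly_digit q (Fq q) n \<in> E_alg"
proof -
  interpret P: algebra "ring_on D" "algebra_on Polynomial.smult (UNIV :: 'k poly set)" by (rule algebra_poly)
  have q2: "q \<ge> 2" using primepow_gt_Suc_0[OF q] by simp
  have "digit_prod (algebra_on Polynomial.smult UNIV) q (poly_iterate (Fq q)) n \<in> E_alg"
    by (rule P.digit_prod_alg_gen[OF q2]) (use q in auto)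
  then show ?thesis
    using digit_prod_poly[OF q2, of Polynomial.smult "Fq q" 0 n] by (simp add: pcompose_idR)
qed

text \<open>For the integers this is n! up to sign: \<pi>_q is a prime q up to sign, or a unit if q
  is a proper prime power. Indices q > n would contribute exponent 0.\<close>

definition gen_factorial :: "nat \<Rightarrow> 'k" where
  "gen_factorial n = (\<Prod>q\<in>{q. primepow q \<and> q \<le> n}. \<pi> q ^ legendre_exp q n)"

lemma finite_primepows: "finite {q::nat. primepow q \<and> q \<le> n}"
  by (rule finite_subset[of _ "{..n}"]) auto

lemma gen_factorial_D: "gen_factorial n \<in> D" and gen_factorial_nonzero: "gen_factorial n \<noteq> 0"
  using finite_primepows[of n] pi_D pi_nonzero by (auto simp: gen_factorial_def intro!: prod_mem)

text \<open>\<open>?J\<close> is the ideal of numerators, over the generalized factorial, of the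
  coefficients attained in degree n. For each q the digit polynomial contributes the product of the
  other prime-power factors, and comaximality makes the ideal contain 1.\<close>

lemma regular_basis_element:
  obtains e where "e \<in> E_alg" "degree e = n" "lead_coeff e = 1 / gen_factorial n"
proof -
  let ?u = "gen_factorial n" and ?Q = "{q. primepow q \<and> q \<le> n}"
  let ?J = "{d\<in>D. \<exists>f\<in>E_alg. degree f \<le> n \<and> coeff f n = d / ?u}"
  have "submod ?J"
  proof (rule submodI)
    show "0 \<in> ?J" using E_alg_closed(3)[OF zero_mem E_alg_closed(1)] by force
    fix x y assume "x \<in> ?J" "y \<in> ?J"
    then obtain f g where "x \<in> D" "y \<in> D" "f \<in> E_alg" "degree f \<le> n" "coeff f n = x / ?u"
      "g \<in> E_alg" "degree g \<le> n" "coeff g n = y / ?u" by blast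
    then show "x + y \<in> ?J"
      using E_alg_closed(2) by (auto simp: add_divide_distrib degree_add_le intro!: bexI[of _ "f + g"])
  next
    fix c x assume "c \<in> D" "x \<in> ?J"
    then obtain f where "x \<in> D" "f \<in> E_alg" "degree f \<le> n" "coeff f n = x / ?u" by blast
    then show "c * x \<in> ?J"
      using E_alg_closed(3)[OF \<open>c \<in> D\<close>] \<open>c \<in> D\<close>
      by (auto intro!: bexI[of _ "Polynomial.smult c f"] order.trans[OF degree_smult_le])
  qed
  moreover have "\<exists>c\<in>pi_products \<pi> q. c \<in> ?J" if q: "primepow q" for q
  proof -
    let ?c = "\<Prod>q'\<in>?Q - {q}. \<pi> q' ^ legendre_exp q' n"
    have c: "?c \<in> pi_products \<pi> q" by (rule pi_products_prod) auto
    have "?u = \<pi> q ^ legendre_exp q n * ?c"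
    proof (cases "q \<le> n")
      case True
      then show ?thesis
        unfolding gen_factorial_def using finite_primepows[of n] q by (intro prod.remove) auto
    next
      case False
      then have "?Q - {q} = ?Q" "legendre_exp q n = 0" by (auto simp: legendre_exp_less)
      then show ?thesis by (simp add: gen_factorial_def)
    qed
    then have "?c / ?u = 1 / \<pi> q ^ legendre_exp q n"
      using gen_factorial_nonzero[of n] by (auto simp: field_simps)
    moreover have "q \<ge> 2" using primepow_gt_Suc_0[OF q] by simp
    note degree_lead_poly_digit[OF this degree_lead_F_poly[OF q], of n]
    ultimately have "?c \<in> ?J"
      using poly_digit_mem[OF q, of n] pi_products_D[OF c] by (auto intro!: bexI[of _ "poly_digit q (Fq q) n"])
    then show ?thesis using c by blast
  qed
  ultimately have "1 \<in> ?J" by (intro one_mem_if_pi_products) auto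
  then obtain f where f: "f \<in> E_alg" "degree f \<le> n" "coeff f n = 1 / ?u" by blast
  then have "degree f = n" using gen_factorial_nonzero[of n] le_degree[of f n] by fastforce
  then show thesis using that f by blast
qed

end

subsection \<open>Interpolation points at a t-maximal ideal of finite norm\<close>

text \<open>The point number \<open>n\<close> has the digits of \<open>n\<close> in base \<open>q\<close> as coefficients of its expansion in
  powers of \<open>\<pi>\<close>, replaced by representatives of the residue classes.\<close>

function digit_point :: "(nat \<Rightarrow> 'k::field) \<Rightarrow> 'k \<Rightarrow> nat \<Rightarrow> nat \<Rightarrow> 'k" where
  "digit_point r \<pi> q n = (if n = 0 \<or> q < 2 then 0 else r (n mod q) + \<pi> * digit_point r \<pi> q (n div q))"
  by auto
termination by (relation "measure (\<lambda>(r, \<pi>, q, n). n)") auto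

declare digit_point.simps [simp del]

lemma digit_point_unfold:
  assumes "q \<ge> 2" "r 0 = 0"
  shows "digit_point r \<pi> q n = r (n mod q) + \<pi> * digit_point r \<pi> q (n div q)"
  using assms by (cases "n = 0") (simp_all add: digit_point.simps[of r \<pi> q n] digit_point.simps[of r \<pi> q 0])

context domain_in_field begin

text \<open>Two points are incongruent modulo p if the lowest digits of their indices differ, and
  otherwise their difference is \<pi> times that of the points with this digit removed. The product
  thus reduces from n to n div q.\<close>

lemma digit_point_prod:
  assumes p: "prime_id p" and pi: "\<pi> \<in> p" and q: "q \<ge> 2"
    and r: "\<And>i. r i \<in> D" "r 0 = 0" "\<And>i j. i < q \<Longrightarrow> j < q \<Longrightarrow> i \<noteq> j \<Longrightarrow> r i - r j \<notin> p"
  defines "u \<equiv> digit_point r \<pi> q"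
  shows "(\<forall>m. \<exists>c\<in>D. (\<Prod>j<n. u m - u j) = \<pi> ^ legendre_exp q n * c) \<and>
    (\<exists>s\<in>D - p. (\<Prod>j<n. u n - u j) = \<pi> ^ legendre_exp q n * s)"
proof (induction n rule: less_induct)
  case (less n)
  have p': "p \<subseteq> D" "submod p" "1 \<notin> p" using p by (auto simp: prime_id_def)
  have piD: "\<pi> \<in> D" using pi p' by auto
  have unf: "u m = r (m mod q) + \<pi> * u (m div q)" for m
    unfolding u_def by (rule digit_point_unfold[of q r, OF q r(2)])
  have uD: "u m \<in> D" for m
  proof (induction m rule: less_induct)
    case (less m)
    show ?case
    proof (cases "m = 0")
      case True
      then show ?thesis by (simp add: u_def digit_point.simps[of r \<pi> q 0])
    next
      case False
      then show ?thesis using less[of "m div q"] q r(1) piD by (subst unf) simp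
    qed
  qed
  have cong: "u (j + q * l) - u (j + q * l') = \<pi> * (u l - u l')" if "j < q" for j l l'
    using that q by (subst (1 2) unf) (simp add: algebra_simps)
  have incong: "u i - u j \<notin> p" if "i mod q \<noteq> j mod q" for i j
  proof
    assume *: "u i - u j \<in> p"
    have "\<pi> * (u (j div q) - u (i div q)) \<in> p" using submod_mult_right[OF p'(2) pi] uD by simp
    then have "(u i - u j) + \<pi> * (u (j div q) - u (i div q)) \<in> p" using submod_add[OF p'(2) *] by simp
    moreover have "(u i - u j) + \<pi> * (u (j div q) - u (i div q)) = r (i mod q) - r (j mod q)"
      by (subst (1 2) unf) (simp add: algebra_simps)
    ultimately show False using r(3)[of "i mod q" "j mod q"] that q by simp
  qed
  show ?case
  proof (cases "n = 0")
    case True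
    then show ?thesis using p' by (auto simp: legendre_exp.simps[of q 0] intro!: bexI[of _ 1])
  next
    case False
    let ?n' = "n div q"
    have n': "?n' < n" using False q by simp
    \<comment> \<open>The indices congruent to m are taken from the n div q complete blocks below n.
      For m = n these are all the congruent ones; for other m one more may remain in the last
      factor, where only membership in \<open>D\<close> is needed.\<close>
    have split: "(\<Prod>j<n. u m - u j) = \<pi> ^ ?n' * (\<Prod>l<?n'. u (m div q) - u l) *
        (\<Prod>j\<in>{..<n} - (\<lambda>l. m mod q + q * l) ` {..<?n'}. u m - u j)" for m
    proof -
      let ?T = "(\<lambda>l. m mod q + q * l) ` {..<?n'}"
      have mq: "m mod q < q" using q by simp
      have "m mod q + q * l < n" if "l < ?n'" for l
      proof -
        have "q * l + q \<le> q * ?n'" using that by (metis Suc_leI mult_Suc_right mult_le_mono2 add.commute)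
        moreover have "q * ?n' \<le> n" by simp
        ultimately show ?thesis using mq by linarith
      qed
      then have sub: "?T \<subseteq> {..<n}" by auto
      have inj: "inj_on (\<lambda>l. m mod q + q * l) {..<?n'}" using q by (auto simp: inj_on_def)
      have "(\<Prod>j\<in>?T. u m - u j) = (\<Prod>l<?n'. u (m mod q + q * (m div q)) - u (m mod q + q * l))"
        by (simp add: prod.reindex[OF inj])
      also have "\<dots> = (\<Prod>l<?n'. \<pi> * (u (m div q) - u l))"
        unfolding cong[OF mq] ..
      also have "\<dots> = \<pi> ^ ?n' * (\<Prod>l<?n'. u (m div q) - u l)" by (simp add: prod.distrib)
      finally show ?thesis using prod.subset_diff[OF sub, of "\<lambda>j. u m - u j"] by simp
    qed
    have leg: "legendre_exp q n = ?n' + legendre_exp q ?n'"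
      using False q by (simp add: legendre_exp.simps[of q n])
    note IH = less.IH[OF n']
    show ?thesis
    proof (intro conjI allI)
      fix m
      obtain c where c: "c \<in> D" "(\<Prod>l<?n'. u (m div q) - u l) = \<pi> ^ legendre_exp q ?n' * c" using IH by blast
      have "(\<Prod>j\<in>{..<n} - (\<lambda>l. m mod q + q * l) ` {..<?n'}. u m - u j) \<in> D"
        using uD by (intro prod_mem) simp
      then show "\<exists>c\<in>D. (\<Prod>j<n. u m - u j) = \<pi> ^ legendre_exp q n * c"
        unfolding split[of m] c(2) leg power_add using c(1)
        by (intro bexI[of _ "c * (\<Prod>j\<in>{..<n} - (\<lambda>l. m mod q + q * l) ` {..<?n'}. u m - u j)"]) simp_all
    next
      obtain s where s: "s \<in> D - p" "(\<Prod>l<?n'. u ?n' - u l) = \<pi> ^ legendre_exp q ?n' * s" using IH by blast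
      let ?T = "{..<n} - (\<lambda>l. n mod q + q * l) ` {..<?n'}"
      have "n mod q \<noteq> j mod q" if "j \<in> ?T" for j
      proof
        assume eq: "n mod q = j mod q"
        have j: "j = n mod q + q * (j div q)" unfolding eq by simp
        have n: "n = n mod q + q * ?n'" by simp
        have "j < n" using that by simp
        then have "q * (j div q) < q * ?n'" using j n by linarith
        then have "j div q \<in> {..<?n'}" by simp
        with j have "j \<in> (\<lambda>l. n mod q + q * l) ` {..<?n'}" by (rule image_eqI)
        then show False using that by blast
      qed
      then have "u n - u j \<notin> p" if "j \<in> ?T" for j using that incong by blast
      moreover have "finite ?T" by simp
      ultimately have "(\<Prod>j\<in>?T. u n - u j) \<notin> p"
        using prime_id_prod[OF p, of ?T "\<lambda>j. u n - u j"] uD by auto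
      moreover have "(\<Prod>j\<in>?T. u n - u j) \<in> D" using uD by (intro prod_mem) simp
      ultimately have "s * (\<Prod>j\<in>?T. u n - u j) \<in> D - p" using s p by (auto simp: prime_id_def)
      then show "\<exists>s\<in>D - p. (\<Prod>j<n. u n - u j) = \<pi> ^ legendre_exp q n * s"
        unfolding split[of n] s(2) leg power_add
        by (intro bexI[of _ "s * (\<Prod>j\<in>?T. u n - u j)"]) simp_all
    qed
  qed
qed

lemma Int_poly_coeff_finite_norm:
  assumes p: "t_maximal D p" "finite_norm D p" and pi: "\<pi> \<in> p"
    and f: "f \<in> Int_poly D" "degree f \<le> n"
  shows "\<exists>s\<in>D - p. s * \<pi> ^ legendre_exp (ideal_norm D p) n * coeff f n \<in> D"
proof -
  let ?q = "ideal_norm D p"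
  have pr: "prime_id p" by (rule t_maximal_prime[OF p(1)])
  have p': "p \<subseteq> D" "submod p" using t_maximal_proper[OF p(1)] by auto
  have q: "?q \<ge> 2" using max_norm_gt_1[OF t_maximal_finite_norm_max[OF p] p(2)] by simp
  obtain r0 where r0: "\<And>i. r0 i \<in> D" "\<And>i j. i < ?q \<Longrightarrow> j < ?q \<Longrightarrow> i \<noteq> j \<Longrightarrow> r0 i - r0 j \<notin> p"
    using residues_of_finite_norm[OF p' p(2)] by blast
  \<comment> \<open>The class of 0 must be represented by 0, since an index has infinitely many
    leading digits 0 and these must not contribute to its point.\<close>
  define r where "r i = r0 i - r0 0" for i
  have r: "\<And>i. r i \<in> D" "r 0 = 0" "\<And>i j. i < ?q \<Longrightarrow> j < ?q \<Longrightarrow> i \<noteq> j \<Longrightarrow> r i - r j \<notin> p"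
    using r0 by (auto simp: r_def)
  have pts: "(\<forall>m. \<exists>c\<in>D. (\<Prod>j<i. digit_point r \<pi> ?q m - digit_point r \<pi> ?q j) = \<pi> ^ legendre_exp ?q i * c) \<and>
    (\<exists>s\<in>D - p. (\<Prod>j<i. digit_point r \<pi> ?q i - digit_point r \<pi> ?q j) = \<pi> ^ legendre_exp ?q i * s)" for i
    by (rule digit_point_prod[where r = r, OF pr pi q r])
  have "digit_point r \<pi> ?q m \<in> D" for m
  proof (induction m rule: less_induct)
    case (less m)
    show ?case
    proof (cases "m = 0")
      case True
      then show ?thesis by (simp add: digit_point.simps[of r \<pi> ?q 0])
    next
      case False
      have "\<pi> \<in> D" using pi p' by auto
      then show ?thesis using less[of "m div ?q"] False q r(1) by (subst digit_point.simps) simp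
    qed
  qed
  then have vals: "poly f (digit_point r \<pi> ?q i) \<in> D" for i using f(1) by (simp add: Int_poly_def)
  show ?thesis
    by (rule newton_coeff_mem[OF pr submod_D, where u = "digit_point r \<pi> ?q" and t = "\<lambda>i. \<pi> ^ legendre_exp ?q i"])
      (use pts vals f(2) in blast)+
qed

lemma Int_poly_coeff_infinite_norm:
  assumes p: "t_maximal D p" "\<not> finite_norm D p" and f: "f \<in> Int_poly D" "degree f \<le> n"
  shows "\<exists>s\<in>D - p. s * coeff f n \<in> D"
proof -
  have pr: "prime_id p" by (rule t_maximal_prime[OF p(1)])
  have p': "p \<subseteq> D" "submod p" using t_maximal_proper[OF p(1)] by auto
  have "\<exists>u :: nat \<Rightarrow> 'k. (\<forall>i. u i \<in> D) \<and> (\<forall>i j. i \<noteq> j \<longrightarrow> u i - u j \<notin> p)"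
  proof (rule ccontr)
    assume *: "\<not> ?thesis"
    have "finite_norm D p" by (rule finite_normI[OF p']) (use * in blast)
    then show False using p by simp
  qed
  then obtain u :: "nat \<Rightarrow> 'k" where u: "\<And>i. u i \<in> D" "\<And>i j. i \<noteq> j \<Longrightarrow> u i - u j \<notin> p" by blast
  show ?thesis
    by (rule newton_coeff_mem_distinct[OF pr submod_D u f(2)]) (use f u in \<open>auto simp: Int_poly_def\<close>)
qed

end

context principal_Pi_domain begin

text \<open>This bounds leading coefficients from the other side: at infinite norm the coefficient
  is locally integral by itself, and at norm q the power of \<pi>_q in the factorial suffices, the
  cofactor being in \<open>D\<close>.\<close>

lemma Int_poly_coeff_gen_factorial:
  assumes f: "f \<in> Int_poly D" "degree f \<le> n"
  shows "coeff f n * gen_factorial n \<in> D"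
proof (rule mem_D_if_locally)
  fix p assume p: "t_maximal D p"
  show "\<exists>s\<in>D - p. s * (coeff f n * gen_factorial n) \<in> D"
  proof (cases "finite_norm D p")
    case False
    then obtain s where s: "s \<in> D - p" "s * coeff f n \<in> D" using Int_poly_coeff_infinite_norm[OF p _ f] by blast
    then have "s * (coeff f n * gen_factorial n) \<in> D"
      using mult_mem[OF s(2) gen_factorial_D[of n]] by (simp add: mult.assoc)
    then show ?thesis using s by blast
  next
    case True
    let ?q = "ideal_norm D p" and ?Q = "{q. primepow q \<and> q \<le> n}"
    have q: "primepow ?q" by (rule max_norm_primepow[OF t_maximal_finite_norm_max[OF p True] True])
    have "\<pi> ?q \<in> Pi_ideal D ?q" using pi q one_mem by (force simp: principal_Pi_def)
    then have "\<pi> ?q \<in> p" using p True by (auto simp: Pi_ideal_def)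
    then obtain s where s: "s \<in> D - p" "s * \<pi> ?q ^ legendre_exp ?q n * coeff f n \<in> D"
      using Int_poly_coeff_finite_norm[OF p True _ f] by blast
    have "\<exists>c\<in>D. gen_factorial n = \<pi> ?q ^ legendre_exp ?q n * c"
    proof (cases "?q \<le> n")
      case True
      have "gen_factorial n = \<pi> ?q ^ legendre_exp ?q n * (\<Prod>q'\<in>?Q - {?q}. \<pi> q' ^ legendre_exp q' n)"
        unfolding gen_factorial_def using finite_primepows[of n] q True by (intro prod.remove) auto
      moreover have "(\<Prod>q'\<in>?Q - {?q}. \<pi> q' ^ legendre_exp q' n) \<in> D" by (intro prod_mem) (auto simp: pi_D)
      ultimately show ?thesis by blast
    next
      case False
      then show ?thesis using gen_factorial_D[of n] by (auto simp: legendre_exp_less)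
    qed
    then obtain c where c: "c \<in> D" "gen_factorial n = \<pi> ?q ^ legendre_exp ?q n * c" by blast
    have "s * (coeff f n * gen_factorial n) = (s * \<pi> ?q ^ legendre_exp ?q n * coeff f n) * c"
      by (simp add: c(2) mult_ac)
    also have "\<dots> \<in> D" using s(2) c(1) by (rule mult_mem)
    finally show ?thesis using s(1) by blast
  qed
qed

text \<open>The normalization \<open>e 0 = 1\<close> makes products of the \<open>e n\<close> in several variables independent of
  the set of variables.\<close>

definition is_regular_basis :: "(nat \<Rightarrow> 'k poly) \<Rightarrow> bool" where
  "is_regular_basis e \<longleftrightarrow> e 0 = 1 \<and> (\<forall>n. e n \<in> E_alg \<and> degree (e n) = n \<and> e n \<noteq> 0 \<and>
     (\<forall>f\<in>Int_poly D. degree f \<le> n \<longrightarrow> coeff f n / lead_coeff (e n) \<in> D))"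

lemma regular_basis_exists: "\<exists>e. is_regular_basis e"
proof -
  have "\<exists>e. e \<in> E_alg \<and> degree e = n \<and> coeff e n = 1 / gen_factorial n \<and> (n = 0 \<longrightarrow> e = 1)" for n
  proof (cases "n = 0")
    case True
    have "gen_factorial 0 = 1" by (simp add: gen_factorial_def legendre_exp.simps[of _ 0])
    then show ?thesis using E_alg_closed(1) True by (intro exI[of _ 1]) simp
  next
    case False
    obtain e where "e \<in> E_alg" "degree e = n" "lead_coeff e = 1 / gen_factorial n"
      by (rule regular_basis_element)
    then show ?thesis using False by (intro exI[of _ e]) simp
  qed
  then have "\<exists>e. \<forall>n. e n \<in> E_alg \<and> degree (e n) = n \<and> coeff (e n) n = 1 / gen_factorial n \<and> (n = 0 \<longrightarrow> e n = 1)"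
    by (intro choice allI)
  then obtain e where e: "\<forall>n. e n \<in> E_alg \<and> degree (e n) = n \<and> coeff (e n) n = 1 / gen_factorial n \<and> (n = 0 \<longrightarrow> e n = 1)" ..
  have "e n \<noteq> 0" for n
  proof
    assume "e n = 0"
    then have "coeff (e n) n = 0" by simp
    then show False using e gen_factorial_nonzero[of n] by simp
  qed
  moreover have "coeff f n / lead_coeff (e n) \<in> D" if "f \<in> Int_poly D" "degree f \<le> n" for n f
  proof -
    have "lead_coeff (e n) = 1 / gen_factorial n" using e by simp
    then show ?thesis using Int_poly_coeff_gen_factorial[OF that] by simp
  qed
  ultimately have "is_regular_basis e" using e unfolding is_regular_basis_def by blast
  then show ?thesis by blast
qed

context
  fixes e :: "nat \<Rightarrow> 'k poly"
  assumes reg: "is_regular_basis e"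
begin

lemma regular_basis: "e n \<in> E_alg" "degree (e n) = n" "e n \<noteq> 0"
    "f \<in> Int_poly D \<Longrightarrow> degree f \<le> n \<Longrightarrow> coeff f n / lead_coeff (e n) \<in> D"
  using reg unfolding is_regular_basis_def by blast+

lemma regular_basis_Int: "e n \<in> Int_poly D"
  using regular_basis(1) E_alg_subset_Int by blast

lemma regular_basis_expansion:
  assumes "f \<in> Int_poly D" "degree f \<le> n"
  shows "\<exists>c. (\<forall>i. c i \<in> D) \<and> f = (\<Sum>i\<le>n. Polynomial.smult (c i) (e i))"
  using assms
proof (induction n arbitrary: f)
  case 0
  let ?c = "coeff f 0 / lead_coeff (e 0)"
  have c: "?c \<in> D" by (rule regular_basis(4)[OF 0])
  obtain a where a: "f = [:a:]" using 0 degree_eq_zeroE[of f] by auto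
  obtain b where b: "e 0 = [:b:]" using regular_basis(2)[of 0] degree_eq_zeroE[of "e 0"] by auto
  have "b \<noteq> 0" using regular_basis(3)[of 0] b by auto
  then have "f = Polynomial.smult ?c (e 0)" using a b by simp
  then show ?case using c by (intro exI[of _ "\<lambda>_. ?c"]) simp
next
  case (Suc n)
  let ?c = "coeff f (Suc n) / lead_coeff (e (Suc n))"
  have c: "?c \<in> D" by (rule regular_basis(4)[OF Suc.prems])
  let ?g = "f - Polynomial.smult ?c (e (Suc n))"
  have "e (Suc n) \<in> Int_poly D" by (rule regular_basis_Int)
  then have "poly f x - ?c * poly (e (Suc n)) x \<in> D" if "x \<in> D" for x
    using Suc.prems(1) c that by (intro diff_mem mult_mem) (auto simp: Int_poly_def)
  then have "?g \<in> Int_poly D" by (simp only: Int_poly_def mem_Collect_eq poly_diff poly_smult) blast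
  moreover have "degree ?g \<le> n"
  proof (rule degree_le, intro allI impI)
    fix i assume "n < i"
    show "coeff ?g i = 0"
    proof (cases "i = Suc n")
      case True
      have "lead_coeff (e (Suc n)) \<noteq> 0" using regular_basis(3) by simp
      then show ?thesis using True by (simp add: regular_basis(2))
    next
      case False
      then show ?thesis using \<open>n < i\<close> Suc.prems(2) regular_basis(2)[of "Suc n"] by (simp add: coeff_eq_0)
    qed
  qed
  ultimately obtain d where d: "\<forall>i. d i \<in> D" "?g = (\<Sum>i\<le>n. Polynomial.smult (d i) (e i))"
    using Suc.IH by blast
  have "f = ?g + Polynomial.smult ?c (e (Suc n))" by simp
  also have "\<dots> = (\<Sum>i\<le>Suc n. Polynomial.smult ((d(Suc n := ?c)) i) (e i))" unfolding d(2) by simp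
  finally show ?case using c d(1) by (intro exI[of _ "d(Suc n := ?c)"]) auto
qed

text \<open>The coefficients are a priori in the quotient field. Comparison with an expansion over
  \<open>D\<close>, unique because the degrees are distinct, shows that they lie in
  \<open>D\<close>.\<close>

lemma regular_basis_coeff_mem:
  assumes F: "finite F" "(\<Sum>i\<in>F. Polynomial.smult (c i) (e i)) \<in> Int_poly D" "m \<in> F"
  shows "c m \<in> D"
proof -
  let ?f = "\<Sum>i\<in>F. Polynomial.smult (c i) (e i)"
  let ?n = "max (degree ?f) (Max F)"
  obtain d where d: "\<forall>i. d i \<in> D" "?f = (\<Sum>i\<le>?n. Polynomial.smult (d i) (e i))"
    using regular_basis_expansion[OF F(2), of ?n] by auto
  have sub: "F \<subseteq> {..?n}" using F(1) Max_ge by (auto simp: max.coboundedI2)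
  let ?c = "\<lambda>i. if i \<in> F then c i else 0"
  have "?f = (\<Sum>i\<in>F. Polynomial.smult (?c i) (e i))" by (intro sum.cong) auto
  also have "\<dots> = (\<Sum>i\<le>?n. Polynomial.smult (?c i) (e i))"
    using sub by (intro sum.mono_neutral_left) auto
  finally have "(\<Sum>i\<le>?n. Polynomial.smult (?c i - d i) (e i)) = 0"
    using d(2) by (simp add: smult_diff_left sum_subtractf)
  from degree_independent[OF regular_basis(2,3) _ this, of m] have "?c m - d m = 0" using sub F(3) by auto
  then show ?thesis using F(3) d(1) by simp
qed

end

lemma Int_poly_subset_E_alg: "Int_poly D \<subseteq> E_alg"
proof
  fix f assume f: "f \<in> Int_poly D"
  obtain e where e: "is_regular_basis e" using regular_basis_exists ..
  obtain c where c: "\<forall>i. c i \<in> D" "f = (\<Sum>i\<le>degree f. Polynomial.smult (c i) (e i))"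
    using regular_basis_expansion[OF e f order.refl] by (elim exE conjE)
  have "(\<Sum>i\<le>n. Polynomial.smult (c i) (e i)) \<in> E_alg" for n
    by (induction n) (use c(1) regular_basis(1)[OF e] E_alg_closed in auto)
  from this[of "degree f"] show "f \<in> E_alg" by (simp only: c(2)[symmetric])
qed

subsection \<open>The universal property\<close>

lemma alg_gen_functional:
  fixes A :: "('k, 'a, 'm) module_scheme"
  assumes A: "algebra (ring_on D) A" and b: "\<And>q. b q 0 = a" "\<And>q k. b q k \<in> carrier A"
    "\<And>q k. primepow q \<Longrightarrow> b q k [^]\<^bsub>A\<^esub> q = b q k \<oplus>\<^bsub>A\<^esub> \<pi> q \<odot>\<^bsub>A\<^esub> b q (Suc k)"
    and \<alpha>: "(0, \<alpha>) \<in> algebra.alg_gen (ring_on D) (prod_algebra (algebra_on Polynomial.smult UNIV) A)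
      {(poly_iterate (Fq q) k, b q k) |q k. primepow q}"
  shows "\<alpha> = \<zero>\<^bsub>A\<^esub>"
proof -
  interpret A: algebra "ring_on D" A by fact
  let ?P = "algebra_on Polynomial.smult (UNIV :: 'k poly set)"
  let ?B = "prod_algebra ?P A"
  interpret B: algebra "ring_on D" ?B by (rule algebra_prod_algebra[OF algebra_poly A])
  define g where "g q k = (poly_iterate (Fq q) k, b q k)" for q k
  let ?G = "{g q k |q k. primepow q}"
  have \<alpha>': "(0, \<alpha>) \<in> B.alg_gen ?G" using \<alpha> by (simp add: g_def)
  have gB: "g q k \<in> carrier ?B" for q k using b(2) by (simp add: g_def)
  have rg: "range (g q) \<subseteq> carrier ?B" for q using gB by blast
  have rel: "g q k [^]\<^bsub>?B\<^esub> q = g q k \<oplus>\<^bsub>?B\<^esub> \<pi> q \<odot>\<^bsub>?B\<^esub> g q (Suc k)" if "primepow q" for q k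
    using poly_iterate_power[OF that, of k] b(3)[OF that, of k] by (simp add: g_def)
  have \<alpha>c: "\<alpha> \<in> carrier A"
  proof -
    have "?G \<subseteq> carrier ?B" using gB by blast
    from B.alg_gen_closed[OF this \<alpha>'] show ?thesis by simp
  qed
  \<comment> \<open>The annihilator of \<alpha>; the goal is that it contains 1.\<close>
  let ?J = "{d\<in>D. d \<odot>\<^bsub>A\<^esub> \<alpha> = \<zero>\<^bsub>A\<^esub>}"
  have "submod ?J"
  proof (rule submodI)
    show "0 \<in> ?J" using A.smult_l_null[OF \<alpha>c] by simp
    show "x + y \<in> ?J" if "x \<in> ?J" "y \<in> ?J" for x y
      using A.smult_l_distr[of x y \<alpha>] that \<alpha>c by simp
    show "d * x \<in> ?J" if "d \<in> D" "x \<in> ?J" for d x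
      using A.smult_assoc1[of d x \<alpha>] that \<alpha>c by simp
  qed
  moreover have "\<exists>c\<in>pi_products \<pi> q. c \<in> ?J" if q: "primepow q" for q
  proof -
    have q2: "q \<ge> 2" using primepow_gt_Suc_0[OF q] by simp
    have one_smult: "1 \<odot>\<^bsub>?B\<^esub> g q k \<in> B.alg_gen (range (g q))" for k
      using B.alg_gen.gen[OF rangeI, of "g q" k] B.smult_one[OF gB[of q k]] by (simp only: one_ring_on)
    have gens: "\<exists>c\<in>pi_products \<pi> q. c \<odot>\<^bsub>?B\<^esub> g q' k \<in> B.alg_gen (range (g q))" if q': "primepow q'" for q' k
    proof (cases "q' = q")
      case True
      then show ?thesis using pi_products.one one_smult[of k] by blast
    next
      case False
      show ?thesis
      \<comment> \<open>The relation expresses \<pi>_{q'} times the next pair through the current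
        one, so each step costs one factor. The start is free: the pair of index 0 is (X, a) for
        every prime power, hence it belongs to the family of q.\<close>
      proof (induction k)
        case 0
        have "g q' 0 = g q 0" by (simp add: g_def b(1))
        then show ?case using pi_products.one one_smult[of 0] by metis
      next
        case (Suc k)
        have "\<exists>c\<in>pi_products \<pi> q. c \<odot>\<^bsub>?B\<^esub> ((g q' k [^]\<^bsub>?B\<^esub> q') \<ominus>\<^bsub>?B\<^esub> g q' k) \<in> B.alg_gen (range (g q))"
        proof (rule B.alg_gen_scaled[OF _ _ _ rg])
          show "(g q' k [^]\<^bsub>?B\<^esub> q') \<ominus>\<^bsub>?B\<^esub> g q' k \<in> B.alg_gen {g q' k}"
            by (intro B.alg_gen_minus B.alg_gen_power B.alg_gen.gen) (use gB in auto)
          fix h assume "h \<in> {g q' k}"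
          then show "h \<in> carrier ?B \<and> (\<exists>c\<in>pi_products \<pi> q. c \<odot>\<^bsub>?B\<^esub> h \<in> B.alg_gen (range (g q)))"
            using Suc gB[of q' k] by simp
        qed (auto simp: pi_products_D pi_products.one pi_products_mult)
        then obtain c where c: "c \<in> pi_products \<pi> q"
          "c \<odot>\<^bsub>?B\<^esub> ((g q' k [^]\<^bsub>?B\<^esub> q') \<ominus>\<^bsub>?B\<^esub> g q' k) \<in> B.alg_gen (range (g q))" by blast
        have "(g q' k [^]\<^bsub>?B\<^esub> q') \<ominus>\<^bsub>?B\<^esub> g q' k = \<pi> q' \<odot>\<^bsub>?B\<^esub> g q' (Suc k)"
        proof -
          have s: "\<pi> q' \<odot>\<^bsub>?B\<^esub> g q' (Suc k) \<in> carrier ?B"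
            using B.smult_closed[OF _ gB[of q' "Suc k"], of "\<pi> q'"] pi_D[OF q'] by (simp only: carrier_ring_on)
          show ?thesis
            unfolding rel[OF q', of k] a_minus_def
            using B.M.a_comm[OF gB[of q' k] s] B.M.a_assoc[OF s gB[of q' k], of "\<ominus>\<^bsub>?B\<^esub> g q' k"]
              B.M.r_neg[OF gB[of q' k]] B.M.r_zero[OF s] B.M.a_inv_closed[OF gB[of q' k]] by metis
        qed
        then have "(\<pi> q' * c) \<odot>\<^bsub>?B\<^esub> g q' (Suc k) \<in> B.alg_gen (range (g q))"
          using c B.smult_assoc1[OF _ _ gB[of q' "Suc k"], of c "\<pi> q'"] pi_products_D[OF c(1)] pi_D[OF q']
          by (metis carrier_ring_on mult.commute mult_ring_on)
        then show ?case using pi_products.step[where \<pi> = \<pi>, OF c(1) q' False] by blast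
      qed
    qed
    have "\<exists>c\<in>pi_products \<pi> q. c \<odot>\<^bsub>?B\<^esub> (0, \<alpha>) \<in> B.alg_gen (range (g q))"
    proof (rule B.alg_gen_scaled[OF _ _ _ rg _ \<alpha>'])
      fix h assume "h \<in> ?G"
      then show "h \<in> carrier ?B \<and> (\<exists>c\<in>pi_products \<pi> q. c \<odot>\<^bsub>?B\<^esub> h \<in> B.alg_gen (range (g q)))"
        using gens gB by blast
    qed (auto simp: pi_products_D pi_products.one pi_products_mult)
    then obtain c where c: "c \<in> pi_products \<pi> q" "(0, c \<odot>\<^bsub>A\<^esub> \<alpha>) \<in> B.alg_gen (range (g q))" by auto
    let ?dp = "digit_prod ?B q (g q)"
    have "(0, c \<odot>\<^bsub>A\<^esub> \<alpha>) \<in> B.lin_span (range ?dp)"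
      using B.alg_gen_subset_digit_prods[OF q2 _ rg rel[OF q]] c(2) pi_D[OF q] by auto
    moreover have fst_dp: "fst (?dp n) = poly_digit q (Fq q) n" for n
      using digit_prod_poly[OF q2, of Polynomial.smult "Fq q" 0 n]
      by (simp add: fst_digit_prod g_def pcompose_idR)
    then have "?dp n = (poly_digit q (Fq q) n, snd (?dp n))" for n by (metis prod.collapse)
    then have "range ?dp = (\<lambda>n. (poly_digit q (Fq q) n, snd (?dp n))) ` UNIV" by (rule image_cong[OF refl])
    ultimately have mem: "(0, c \<odot>\<^bsub>A\<^esub> \<alpha>) \<in> B.lin_span ((\<lambda>n. (poly_digit q (Fq q) n, snd (?dp n))) ` UNIV)" by simp
    \<comment> \<open>First components have degrees 0, 1, 2, ..., so they are independent, although
      nothing is known about the second components.\<close>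
    have "c \<odot>\<^bsub>A\<^esub> \<alpha> = \<zero>\<^bsub>A\<^esub>"
    proof (rule lin_span_functional[OF algebra_poly A _ _ mem])
      show "snd (?dp n) \<in> carrier A" for n using B.digit_prod_closed[OF q2 rg, of q n] by (auto simp: mem_Times_iff)
      note dl = degree_lead_poly_digit[OF q2 degree_lead_F_poly[OF q]]
      show "c m = 0" if "finite F" "(\<Sum>m\<in>F. Polynomial.smult (c m) (poly_digit q (Fq q) m)) = 0" "m \<in> F" for F c m
        by (rule degree_independent[OF _ _ that]) (use dl in blast)+
    qed
    then show ?thesis using c(1) pi_products_D by blast
  qed
  ultimately have "1 \<in> ?J" by (intro one_mem_if_pi_products) auto
  then show ?thesis using A.smult_one[OF \<alpha>c] by simp
qed

lemma congruence_imp_WPC: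
  fixes A :: "('k, 'a, 'm) module_scheme"
  assumes A: "algebra (ring_on D) A"
    and cong: "\<And>a q. a \<in> carrier A \<Longrightarrow> primepow q \<Longrightarrow>
      (a [^]\<^bsub>A\<^esub> q) \<ominus>\<^bsub>A\<^esub> a \<in> extended_ideal (Pi_ideal D q) A"
  shows "WPC D A"
  unfolding WPC_def
proof
  fix a assume a: "a \<in> carrier A"
  let ?P = "algebra_on Polynomial.smult (UNIV :: 'k poly set)"
  let ?B = "prod_algebra ?P A"
  obtain b :: "nat \<Rightarrow> nat \<Rightarrow> 'a" where b: "\<And>q. b q 0 = a" "\<And>q k. b q k \<in> carrier A"
    "\<And>q k. primepow q \<Longrightarrow> b q k [^]\<^bsub>A\<^esub> q = b q k \<oplus>\<^bsub>A\<^esub> \<pi> q \<odot>\<^bsub>A\<^esub> b q (Suc k)"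
    using iterated_divisions[OF A pi cong a] by blast
  let ?G = "{(poly_iterate (Fq q) k, b q k) |q k. primepow q}"
  have "fst ` ?G = Int_gens" by force
  then have img: "carrier (Int_algebra D) \<subseteq> fst ` algebra.alg_gen (ring_on D) ?B ?G"
    using fst_alg_gen[OF algebra_poly A, of ?G] Int_poly_subset_E_alg by simp
  obtain h where h: "h \<in> algebra_hom (ring_on D) (Int_algebra D) A"
    "\<And>f \<alpha>. (f, \<alpha>) \<in> algebra.alg_gen (ring_on D) ?B ?G \<Longrightarrow> h f = \<alpha>"
  proof (rule algebra_hom_of_graph[OF algebra_poly A _ _ img])
    show "?G \<subseteq> carrier ?P \<times> carrier A" using b(2) by auto
    show "\<alpha> = \<zero>\<^bsub>A\<^esub>" if "(\<zero>\<^bsub>?P\<^esub>, \<alpha>) \<in> algebra.alg_gen (ring_on D) ?B ?G" for \<alpha>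
      using alg_gen_functional[OF A b] that by simp
  qed auto
  \<comment> \<open>The number 2 stands for any prime power: all iterates of index 0 are X.\<close>
  have "(poly_iterate (Fq 2) 0, b 2 0) \<in> ?G" by (rule CollectI, intro exI conjI) auto
  then have "([:0, 1:], a) \<in> ?G" by (simp only: poly_iterate_0 b(1))
  then have "h [:0, 1:] = a"
    by (intro h(2) algebra.alg_gen.gen[OF algebra_prod_algebra[OF algebra_poly A]])
  with h(1) show "\<exists>h\<in>algebra_hom (ring_on D) (Int_algebra D) A. h [:0, 1:] = a" by blast
qed

end

section \<open>Integer-valued polynomials in several variables\<close>

text \<open>With the coefficient map \<open>mpoly_const\<close> this is substitution of a polynomial
  in several variables into a univariate one.\<close>

definition peval :: "('k::field \<Rightarrow> 'r::comm_ring_1) \<Rightarrow> 'k poly \<Rightarrow> 'r \<Rightarrow> 'r" where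
  "peval \<phi> f y = poly (map_poly \<phi> f) y"

context field_hom_into begin

lemma peval_0 [simp]: "peval \<phi> 0 y = 0"
  by (simp add: peval_def)

lemma peval_pCons [simp]: "peval \<phi> (pCons a f) y = \<phi> a + y * peval \<phi> f y"
  by (simp add: peval_def map_poly_pCons)

lemma peval_1 [simp]: "peval \<phi> 1 y = 1"
  by (simp add: one_pCons)

lemma peval_add: "peval \<phi> (f + g) y = peval \<phi> f y + peval \<phi> g y"
  by (induction f g rule: poly_induct2) (simp_all add: hom_add algebra_simps)

lemma peval_smult: "peval \<phi> (Polynomial.smult c f) y = \<phi> c * peval \<phi> f y"
  by (induction f) (simp_all add: hom_mult algebra_simps)

lemma peval_mult: "peval \<phi> (f * g) y = peval \<phi> f y * peval \<phi> g y"
  by (induction f) (simp_all add: peval_add peval_smult algebra_simps)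

end

lemma const_mpoly_hom: "field_hom_into mpoly_const"
  by unfold_locales (simp_all add: mpoly_const_add mpoly_const_mult)

lemma id_hom: "field_hom_into (\<lambda>c. c)"
  by unfold_locales auto

lemma peval_id: "peval (\<lambda>c. c) f y = poly f y"
  by (simp add: peval_def map_poly_idI)

lemma (in field_hom_into) mpoly_eval_peval:
  "mpoly_eval \<phi> v (peval mpoly_const f g) = peval \<phi> f (mpoly_eval \<phi> v g)"
proof -
  interpret c: field_hom_into mpoly_const by (rule const_mpoly_hom)
  show ?thesis by (induction f) (simp_all add: mpoly_eval_add mpoly_eval_mult)
qed

lemma mpoly_vars_add: "mpoly_vars (f + g) \<subseteq> mpoly_vars f \<union> mpoly_vars g"
  using Poly_Mapping.keys_add[of f g] unfolding mpoly_vars_def by blast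

lemma mpoly_vars_mult: "mpoly_vars (f * g) \<subseteq> mpoly_vars f \<union> mpoly_vars g"
proof
  fix x assume "x \<in> mpoly_vars (f * g)"
  then obtain m where m: "m \<in> Poly_Mapping.keys (f * g)" "x \<in> Poly_Mapping.keys m"
    by (auto simp: mpoly_vars_def)
  then obtain a b where ab: "m = a + b" "a \<in> Poly_Mapping.keys f" "b \<in> Poly_Mapping.keys g"
    using Poly_Mapping.keys_mult[of f g] by blast
  then have "x \<in> Poly_Mapping.keys a \<or> x \<in> Poly_Mapping.keys b"
    using m(2) Poly_Mapping.keys_add[of a b] by blast
  then show "x \<in> mpoly_vars f \<union> mpoly_vars g" using ab by (auto simp: mpoly_vars_def)
qed

lemma mpoly_vars_const [simp]: "mpoly_vars (mpoly_const c) = {}"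
  by (simp add: mpoly_vars_def mpoly_const_def)

lemma mpoly_vars_0 [simp]: "mpoly_vars 0 = {}" and mpoly_vars_1 [simp]: "mpoly_vars 1 = {}"
  using mpoly_vars_const[of 0] mpoly_vars_const[of 1] by simp_all

lemma mpoly_vars_var [simp]: "mpoly_vars (mpoly_var x) = {x}"
  by (simp add: mpoly_vars_def mpoly_var_def)

lemma mpoly_vars_smult: "mpoly_vars (mpoly_smult c f) \<subseteq> mpoly_vars f"
  using mpoly_vars_mult[of "mpoly_const c" f] by (simp add: mpoly_smult_def)

lemma uminus_mpoly: "- f = mpoly_smult (- 1) f"
  by (simp add: mpoly_smult_def mpoly_const_def single_uminus)

lemma mpoly_vars_peval: "mpoly_vars (peval mpoly_const f g) \<subseteq> mpoly_vars g"
proof -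
  interpret c: field_hom_into mpoly_const by (rule const_mpoly_hom)
  show ?thesis
  proof (induction f)
    case (pCons a f)
    then show ?case
      using mpoly_vars_add[of "mpoly_const a" "g * peval mpoly_const f g"]
        mpoly_vars_mult[of g "peval mpoly_const f g"] by auto
  qed simp
qed

definition basis_mon :: "(nat \<Rightarrow> 'k::field poly) \<Rightarrow> ('x \<Rightarrow>\<^sub>0 nat) \<Rightarrow> ('x, 'k) mpoly" where
  "basis_mon e m = (\<Prod>x\<in>Poly_Mapping.keys m. peval mpoly_const (e (Poly_Mapping.lookup m x)) (mpoly_var x))"

definition delete_var :: "'x \<Rightarrow> ('x \<Rightarrow>\<^sub>0 nat) \<Rightarrow> ('x \<Rightarrow>\<^sub>0 nat)" where
  "delete_var x m = m - Poly_Mapping.single x (Poly_Mapping.lookup m x)"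

lemma lookup_delete_var: "Poly_Mapping.lookup (delete_var x m) y = (if y = x then 0 else Poly_Mapping.lookup m y)"
  by (simp add: delete_var_def lookup_minus lookup_single when_def)

lemma keys_delete_var: "Poly_Mapping.keys (delete_var x m) = Poly_Mapping.keys m - {x}"
  by (auto simp: in_keys_iff lookup_delete_var split: if_splits)

lemma delete_var_add: "delete_var x m + Poly_Mapping.single x (Poly_Mapping.lookup m x) = m"
  by (rule poly_mapping_eqI) (simp add: lookup_add lookup_delete_var lookup_single when_def)

context field_hom_into begin

lemma mpoly_eval_prod: "mpoly_eval \<phi> v (prod f I) = (\<Prod>i\<in>I. mpoly_eval \<phi> v (f i))"
  by (induction I rule: infinite_finite_induct) (auto simp: mpoly_eval_mult)

lemma mpoly_eval_basis_mon:
  "mpoly_eval \<phi> v (basis_mon e m) = (\<Prod>x\<in>Poly_Mapping.keys m. peval \<phi> (e (Poly_Mapping.lookup m x)) (v x))"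
  by (simp add: basis_mon_def mpoly_eval_peval mpoly_eval_prod)

lemma basis_mon_split:
  assumes "e 0 = 1"
  shows "mpoly_eval \<phi> v (basis_mon e m) =
    mpoly_eval \<phi> v (basis_mon e (delete_var x m)) * peval \<phi> (e (Poly_Mapping.lookup m x)) (v x)"
proof -
  have "(\<Prod>y\<in>Poly_Mapping.keys m. peval \<phi> (e (Poly_Mapping.lookup m y)) (v y)) =
      (\<Prod>y\<in>insert x (Poly_Mapping.keys m). peval \<phi> (e (Poly_Mapping.lookup m y)) (v y))"
    by (rule prod.mono_neutral_left) (auto simp: in_keys_iff assms)
  also have "\<dots> = peval \<phi> (e (Poly_Mapping.lookup m x)) (v x) *
      (\<Prod>y\<in>Poly_Mapping.keys m - {x}. peval \<phi> (e (Poly_Mapping.lookup m y)) (v y))"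
    by (simp add: prod.insert_remove)
  also have "(\<Prod>y\<in>Poly_Mapping.keys m - {x}. peval \<phi> (e (Poly_Mapping.lookup m y)) (v y)) =
      (\<Prod>y\<in>Poly_Mapping.keys m - {x}. peval \<phi> (e (Poly_Mapping.lookup (delete_var x m) y)) (v y))"
    by (rule prod.cong) (auto simp: lookup_delete_var)
  finally show ?thesis by (simp add: mpoly_eval_basis_mon keys_delete_var)
qed

text \<open>Membership of all values of a combination of the basis products in \<open>T\<close> passes to the
  coefficients one variable at a time. It is used for \<open>T = D\<close>, and for \<open>T = {0}\<close> in \<open>K[X]\<close>, which
  is infinite even if \<open>K\<close> is not.\<close>

lemma basis_coeff_mem:
  assumes e0: "e 0 = 1"
    and uni: "\<And>N b n. finite N \<Longrightarrow> (\<And>d. d \<in> S \<Longrightarrow> (\<Sum>n\<in>N. b n * peval \<phi> (e n) d) \<in> T) \<Longrightarrow> n \<in> N \<Longrightarrow> b n \<in> T"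
    and V: "finite V" and F: "finite F" "\<And>m. m \<in> F \<Longrightarrow> Poly_Mapping.keys m \<subseteq> V"
    and val: "\<And>v. (\<And>x. x \<in> V \<Longrightarrow> v x \<in> S) \<Longrightarrow> (\<Sum>m\<in>F. \<phi> (c m) * mpoly_eval \<phi> v (basis_mon e m)) \<in> T"
    and m: "m \<in> F"
  shows "\<phi> (c m) \<in> T"
  using V F val m
proof (induction V arbitrary: F c m rule: finite_induct)
  case empty
  have "m' = 0" if "m' \<in> F" for m'
    using empty.prems(2)[OF that] by simp
  then have F0: "F = {0}" "m = 0" using empty.prems(4) by auto
  have "(\<Sum>m\<in>F. \<phi> (c m) * mpoly_eval \<phi> v (basis_mon e m)) \<in> T" for v by (rule empty.prems(3)) simp
  then show ?case by (simp add: F0 mpoly_eval_basis_mon)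
next
  case (insert x V)
  let ?l = "\<lambda>m. Poly_Mapping.lookup m x"
  let ?n = "?l m"
  let ?Fn = "\<lambda>n. {m\<in>F. ?l m = n}"
  have inj: "inj_on (delete_var x) (?Fn n)" for n
  proof (rule inj_onI)
    fix m m' assume mm: "m \<in> ?Fn n" "m' \<in> ?Fn n" "delete_var x m = delete_var x m'"
    then have "?l m = ?l m'" by simp
    then show "m = m'" using mm(3) by (metis delete_var_add)
  qed
  \<comment> \<open>Among monomials with the same exponent of x, deletion of x is injective, so the
    coefficients can be indexed by the shortened monomials.\<close>
  let ?c = "\<lambda>m'. c (m' + Poly_Mapping.single x ?n)"
  have c_eq: "?c (delete_var x m') = c m'" if "m' \<in> ?Fn ?n" for m'
    using that delete_var_add[of x m'] by simp
  have "\<phi> (?c (delete_var x m)) \<in> T"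
  proof (rule insert.IH[where c = ?c and m = "delete_var x m"])
    show "finite (delete_var x ` ?Fn ?n)" using insert.prems(1) by simp
    show "Poly_Mapping.keys m' \<subseteq> V" if "m' \<in> delete_var x ` ?Fn ?n" for m'
      using that insert.prems(2) by (force simp: keys_delete_var)
    show "delete_var x m \<in> delete_var x ` ?Fn ?n" using insert.prems(4) by simp
    fix v assume v: "\<And>y. y \<in> V \<Longrightarrow> v y \<in> S"
    \<comment> \<open>For a fixed choice of the other variables, the coefficient of
      \<open>e n\<close> when the combination is read as a function of x alone.\<close>
    let ?b = "\<lambda>n. \<Sum>m\<in>?Fn n. \<phi> (c m) * mpoly_eval \<phi> v (basis_mon e (delete_var x m))"
    have "?b ?n \<in> T"
    proof (rule uni[of "?l ` F"])
      show "finite (?l ` F)" "?n \<in> ?l ` F" using insert.prems by auto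
      fix d assume d: "d \<in> S"
      have cong: "mpoly_eval \<phi> (v(x := d)) (basis_mon e (delete_var x m)) = mpoly_eval \<phi> v (basis_mon e (delete_var x m))" for m
        unfolding mpoly_eval_basis_mon by (rule prod.cong) (auto simp: keys_delete_var)
      have "(\<Sum>n\<in>?l ` F. ?b n * peval \<phi> (e n) d) =
          (\<Sum>n\<in>?l ` F. \<Sum>m\<in>?Fn n. \<phi> (c m) * mpoly_eval \<phi> (v(x := d)) (basis_mon e m))"
        unfolding sum_distrib_right
      proof (intro sum.cong refl)
        fix n m assume "m \<in> ?Fn n"
        then have "?l m = n" by simp
        then show "\<phi> (c m) * mpoly_eval \<phi> v (basis_mon e (delete_var x m)) * peval \<phi> (e n) d =
            \<phi> (c m) * mpoly_eval \<phi> (v(x := d)) (basis_mon e m)"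
          using basis_mon_split[where e = e, OF e0, of "v(x := d)" m x] cong[of m] by (simp add: mult.assoc)
      qed
      also have "\<dots> = (\<Sum>m\<in>F. \<phi> (c m) * mpoly_eval \<phi> (v(x := d)) (basis_mon e m))"
        by (rule sum.image_gen[symmetric]) (rule insert.prems(1))
      also have "\<dots> \<in> T" by (rule insert.prems(3)) (use v d in auto)
      finally show "(\<Sum>n\<in>?l ` F. ?b n * peval \<phi> (e n) d) \<in> T" .
    qed
    also have "?b ?n = (\<Sum>m'\<in>?Fn ?n. \<phi> (?c (delete_var x m')) * mpoly_eval \<phi> v (basis_mon e (delete_var x m')))"
      by (rule sum.cong[OF refl]) (use c_eq in simp)
    also have "\<dots> = (\<Sum>m'\<in>delete_var x ` ?Fn ?n. \<phi> (?c m') * mpoly_eval \<phi> v (basis_mon e m'))"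
      by (simp add: sum.reindex[OF inj])
    finally show "(\<Sum>m'\<in>delete_var x ` ?Fn ?n. \<phi> (?c m') * mpoly_eval \<phi> v (basis_mon e m')) \<in> T" .
  qed
  then show ?case using c_eq[of m] insert.prems(4) by simp
qed

end

text \<open>In one variable, vanishing at all points of K[X] makes the polynomial over K[X] zero,
  and its terms have distinct degrees. \<open>basis_coeff_mem\<close> carries this to several
  variables.\<close>

lemma basis_mon_independent:
  fixes e :: "nat \<Rightarrow> 'k::field poly"
  assumes e: "e 0 = 1" "\<And>n. degree (e n) = n" "\<And>n. e n \<noteq> 0"
    and F: "finite F" "(\<Sum>m\<in>F. mpoly_smult (c m) (basis_mon e m)) = 0" "m \<in> F"
  shows "c m = 0"
proof -
  interpret c: field_hom_into "\<lambda>c::'k. [:c:]" by unfold_locales (auto simp: one_pCons)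
  have "[:c m:] \<in> {0}"
  proof (rule c.basis_coeff_mem[where e = e and S = UNIV and c = c])
    show "finite (\<Union>m\<in>F. Poly_Mapping.keys m)" using F by simp
    show "(\<Sum>m\<in>F. [:c m:] * mpoly_eval (\<lambda>c. [:c:]) v (basis_mon e m)) \<in> {0}" for v
      using arg_cong[OF F(2), of "mpoly_eval (\<lambda>c. [:c:]) v"] by (simp add: c.mpoly_eval_sum c.mpoly_eval_smult)
    fix N and b :: "nat \<Rightarrow> 'k poly" and n
    assume N: "finite N" "\<And>d. d \<in> UNIV \<Longrightarrow> (\<Sum>n\<in>N. b n * peval (\<lambda>c. [:c:]) (e n) d) \<in> {0}" "n \<in> N"
    let ?e = "\<lambda>n. map_poly (\<lambda>c. [:c:]) (e n)"
    let ?P = "\<Sum>n\<in>N. Polynomial.smult (b n) (?e n)"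
    have "poly ?P d = 0" for d using N(2)[of d] by (simp add: poly_sum peval_def)
    moreover have "infinite (UNIV :: 'k poly set)"
    proof -
      have "inj (\<lambda>n. monom (1::'k) n)" by (rule injI) (metis degree_monom_eq zero_neq_one)
      then show ?thesis using finite_subset[OF subset_UNIV] infinite_UNIV_nat finite_imageD by (metis rangeI)
    qed
    ultimately have "?P = 0" using poly_roots_finite[of ?P] by auto
    moreover have "degree (?e n) = n" "?e n \<noteq> 0" for n
    proof -
      show d: "degree (?e n) = n" using e(2) by (subst degree_map_poly) auto
      have "coeff (?e n) n = [:lead_coeff (e n):]" using e(2) by (simp add: coeff_map_poly)
      then show "?e n \<noteq> 0" using e(3)[of n] by auto
    qed
    ultimately show "b n \<in> {0}" using degree_independent[of ?e N b n] N by simp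
  qed (use F e in auto)
  then show ?thesis by simp
qed

section \<open>Quotients of algebras\<close>

text \<open>The first isomorphism theorem seen from A: a goes to its fibre under H, which is the
  coset of any preimage. This also makes the union defining scalar multiplication collapse to one
  coset.\<close>

lemma algebra_isomorphic_quotient:
  assumes B: "algebra R B" and A: "algebra R A" and H: "H \<in> algebra_hom R B A"
    and surj: "carrier A \<subseteq> H ` carrier B"
  shows "\<exists>I. ideal I B \<and> algebra_isomorphic R A (quotient_algebra B I)"
proof -
  interpret B: algebra R B by fact
  interpret A: algebra R A by fact
  note hD = algebra_homD[OF H]
  interpret h: ring_hom_ring B A H
    using H B.M_cring A.M_cring by (auto simp: algebra_hom_def cring_def intro!: ring_hom_ringI2)
  let ?I = "a_kernel B A H"
  have I: "ideal ?I B" by (rule h.kernel_is_ideal)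
  interpret I: ideal ?I B by (rule I)
  have coset: "?I +>\<^bsub>B\<^esub> f = {g \<in> carrier B. H g = H f}" if f: "f \<in> carrier B" for f
    using h.rcos_eq_homeq[OF f] by auto
  define s where "s a = (SOME f. f \<in> carrier B \<and> H f = a)" for a
  have s: "s a \<in> carrier B" "H (s a) = a" if "a \<in> carrier A" for a
  proof -
    have "a \<in> H ` carrier B" using that surj by blast
    then have "\<exists>f. f \<in> carrier B \<and> H f = a" by blast
    then have "s a \<in> carrier B \<and> H (s a) = a" unfolding s_def by (rule someI_ex)
    then show "s a \<in> carrier B" "H (s a) = a" by auto
  qed
  let ?h = "\<lambda>a. ?I +>\<^bsub>B\<^esub> s a"
  have h: "?h a = {g \<in> carrier B. H g = a}" if "a \<in> carrier A" for a
    using coset[OF s(1)[OF that]] s(2)[OF that] by simp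
  have hH: "?h (H f) = ?I +>\<^bsub>B\<^esub> f" if "f \<in> carrier B" for f
    using h[OF hD(1)[OF that]] coset[OF that] by simp
  have Q: "carrier (quotient_algebra B ?I) = (\<lambda>f. ?I +>\<^bsub>B\<^esub> f) ` carrier B"
    by (auto simp: quotient_algebra_def FactRing_def A_RCOSETS_def')
  have "?h \<in> algebra_hom R A (quotient_algebra B ?I)"
  proof (rule algebra_homI)
    fix a assume a: "a \<in> carrier A"
    show "?h a \<in> carrier (quotient_algebra B ?I)" unfolding Q using s(1)[OF a] by (rule imageI)
    fix r assume r: "r \<in> carrier R"
    have "r \<odot>\<^bsub>quotient_algebra B ?I\<^esub> ?h a = (\<Union>f\<in>?h a. ?I +>\<^bsub>B\<^esub> (r \<odot>\<^bsub>B\<^esub> f))"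
      by (simp add: quotient_algebra_def)
    also have "\<dots> = (\<Union>f\<in>?h a. ?h (r \<odot>\<^bsub>A\<^esub> a))"
    proof (rule SUP_cong[OF refl])
      fix f assume "f \<in> ?h a"
      then have f: "f \<in> carrier B" "H f = a" using h[OF a] by auto
      then show "?I +>\<^bsub>B\<^esub> (r \<odot>\<^bsub>B\<^esub> f) = ?h (r \<odot>\<^bsub>A\<^esub> a)"
        using hH[OF B.smult_closed[OF r f(1)]] hD(5)[OF r f(1)] by simp
    qed
    also have "\<dots> = ?h (r \<odot>\<^bsub>A\<^esub> a)" using h[OF a] s[OF a] by blast
    finally show "?h (r \<odot>\<^bsub>A\<^esub> a) = r \<odot>\<^bsub>quotient_algebra B ?I\<^esub> ?h a" by simp
  next
    fix a b assume ab: "a \<in> carrier A" "b \<in> carrier A"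
    note sa = s[OF ab(1)] and sb = s[OF ab(2)]
    have "?h a \<otimes>\<^bsub>quotient_algebra B ?I\<^esub> ?h b = ?I +>\<^bsub>B\<^esub> (s a \<otimes>\<^bsub>B\<^esub> s b)"
      using I.rcoset_mult_add[OF sa(1) sb(1)] by (simp add: quotient_algebra_def FactRing_def)
    then show "?h (a \<otimes>\<^bsub>A\<^esub> b) = ?h a \<otimes>\<^bsub>quotient_algebra B ?I\<^esub> ?h b"
      using hH[OF B.m_closed[OF sa(1) sb(1)]] hD(2)[OF sa(1) sb(1)] sa sb by simp
    have "?h a \<oplus>\<^bsub>quotient_algebra B ?I\<^esub> ?h b = ?I +>\<^bsub>B\<^esub> (s a \<oplus>\<^bsub>B\<^esub> s b)"
      using I.a_rcos_sum[OF sa(1) sb(1)] by (simp add: quotient_algebra_def FactRing_def)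
    then show "?h (a \<oplus>\<^bsub>A\<^esub> b) = ?h a \<oplus>\<^bsub>quotient_algebra B ?I\<^esub> ?h b"
      using hH[OF B.M.a_closed[OF sa(1) sb(1)]] hD(3)[OF sa(1) sb(1)] sa sb by simp
  next
    show "?h \<one>\<^bsub>A\<^esub> = \<one>\<^bsub>quotient_algebra B ?I\<^esub>"
      using hH[OF B.one_closed] hD(4) by (simp add: quotient_algebra_def FactRing_def)
  qed
  moreover have "bij_betw ?h (carrier A) (carrier (quotient_algebra B ?I))"
    unfolding bij_betw_def
  proof
    show "inj_on ?h (carrier A)"
    proof (rule inj_onI)
      fix a b assume ab: "a \<in> carrier A" "b \<in> carrier A" "?h a = ?h b"
      then have "s a \<in> {g \<in> carrier B. H g = b}" using h s[OF ab(1)] by blast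
      then show "a = b" using s(2)[OF ab(1)] by simp
    qed
    show "?h ` carrier A = carrier (quotient_algebra B ?I)"
      unfolding Q
    proof
      show "?h ` carrier A \<subseteq> (\<lambda>f. ?I +>\<^bsub>B\<^esub> f) ` carrier B" using s(1) by blast
      show "(\<lambda>f. ?I +>\<^bsub>B\<^esub> f) ` carrier B \<subseteq> ?h ` carrier A"
      proof
        fix C assume "C \<in> (\<lambda>f. ?I +>\<^bsub>B\<^esub> f) ` carrier B"
        then obtain f where f: "f \<in> carrier B" "C = ?I +>\<^bsub>B\<^esub> f" by blast
        then show "C \<in> ?h ` carrier A" using hH[OF f(1)] hD(1)[OF f(1)] by (metis imageI)
      qed
    qed
  qed
  ultimately show ?thesis using I unfolding algebra_isomorphic_def by blast
qed

text \<open>The projection to cosets followed by the inverse of the isomorphism; injectivity of h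
  lets every identity be checked among cosets.\<close>

lemma hom_of_algebra_isomorphic_quotient:
  assumes B: "algebra R B" and A: "algebra R A" and I: "ideal I B"
    and iso: "algebra_isomorphic R A (quotient_algebra B I)"
  obtains H where "H \<in> algebra_hom R B A" "carrier A \<subseteq> H ` carrier B"
proof -
  interpret B: algebra R B by fact
  interpret A: algebra R A by fact
  interpret I: ideal I B by fact
  let ?Q = "quotient_algebra B I"
  obtain h where h: "h \<in> algebra_hom R A ?Q" "bij_betw h (carrier A) (carrier ?Q)"
    using iso by (auto simp: algebra_isomorphic_def)
  note hD = algebra_homD[OF h(1)]
  have Q: "carrier ?Q = (\<lambda>f. I +>\<^bsub>B\<^esub> f) ` carrier B"
    by (auto simp: quotient_algebra_def FactRing_def A_RCOSETS_def')
  have inj: "a = b" if "a \<in> carrier A" "b \<in> carrier A" "h a = h b" for a b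
    using h(2) that by (auto simp: bij_betw_def inj_on_def)
  have "\<forall>f. \<exists>a. f \<in> carrier B \<longrightarrow> a \<in> carrier A \<and> h a = I +>\<^bsub>B\<^esub> f"
  proof
    fix f
    show "\<exists>a. f \<in> carrier B \<longrightarrow> a \<in> carrier A \<and> h a = I +>\<^bsub>B\<^esub> f"
    proof (cases "f \<in> carrier B")
      case True
      then have "I +>\<^bsub>B\<^esub> f \<in> h ` carrier A" using h(2) Q by (simp add: bij_betw_def)
      then show ?thesis by auto
    qed simp
  qed
  then obtain H where H: "\<And>f. f \<in> carrier B \<Longrightarrow> H f \<in> carrier A" "\<And>f. f \<in> carrier B \<Longrightarrow> h (H f) = I +>\<^bsub>B\<^esub> f"
    by metis
  \<comment> \<open>Another representative differs by some i in I, and r i = (r 1) i stays in I, so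
    the union runs over equal cosets.\<close>
  have smult: "(\<Union>g\<in>I +>\<^bsub>B\<^esub> f. I +>\<^bsub>B\<^esub> (r \<odot>\<^bsub>B\<^esub> g)) = I +>\<^bsub>B\<^esub> (r \<odot>\<^bsub>B\<^esub> f)"
    if r: "r \<in> carrier R" and f: "f \<in> carrier B" for r f
  proof -
    have eq: "I +>\<^bsub>B\<^esub> (r \<odot>\<^bsub>B\<^esub> g) = I +>\<^bsub>B\<^esub> (r \<odot>\<^bsub>B\<^esub> f)" if g: "g \<in> I +>\<^bsub>B\<^esub> f" for g
    proof -
      obtain i where i: "i \<in> I" "g = i \<oplus>\<^bsub>B\<^esub> f" using g by (auto simp: a_r_coset_def')
      have ic: "i \<in> carrier B" using i(1) by (rule I.Icarr)
      have "r \<odot>\<^bsub>B\<^esub> i = (r \<odot>\<^bsub>B\<^esub> \<one>\<^bsub>B\<^esub>) \<otimes>\<^bsub>B\<^esub> i"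
        using B.smult_assoc2[OF r B.one_closed ic] ic by simp
      then have ri: "r \<odot>\<^bsub>B\<^esub> i \<in> I" using I.I_l_closed[OF i(1) B.smult_closed[OF r B.one_closed]] by simp
      have rf: "r \<odot>\<^bsub>B\<^esub> f \<in> carrier B" "r \<odot>\<^bsub>B\<^esub> i \<in> carrier B" using r f ic by auto
      have "r \<odot>\<^bsub>B\<^esub> g = r \<odot>\<^bsub>B\<^esub> i \<oplus>\<^bsub>B\<^esub> r \<odot>\<^bsub>B\<^esub> f" using i(2) r f ic by (simp add: B.smult_r_distr)
      then have "(r \<odot>\<^bsub>B\<^esub> g) \<ominus>\<^bsub>B\<^esub> (r \<odot>\<^bsub>B\<^esub> f) = r \<odot>\<^bsub>B\<^esub> i"
        using rf by (simp add: a_minus_def B.M.a_assoc B.M.r_neg)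
      then show ?thesis
        using ring.quotient_eq_iff_same_a_r_cos[OF _ I, of "r \<odot>\<^bsub>B\<^esub> g" "r \<odot>\<^bsub>B\<^esub> f"] ri rf i(2) r f ic B.M_cring
        by (simp add: cring_def)
    qed
    have "f \<in> I +>\<^bsub>B\<^esub> f" using I.zero_closed f by (force simp: a_r_coset_def')
    then show ?thesis using eq by blast
  qed
  have "H \<in> algebra_hom R B A"
  proof (rule algebra_homI)
    fix f assume f: "f \<in> carrier B"
    show "H f \<in> carrier A" by (rule H(1)[OF f])
    fix r assume r: "r \<in> carrier R"
    have "h (r \<odot>\<^bsub>A\<^esub> H f) = (\<Union>g\<in>I +>\<^bsub>B\<^esub> f. I +>\<^bsub>B\<^esub> (r \<odot>\<^bsub>B\<^esub> g))"
      using hD(5)[OF r H(1)[OF f]] H(2)[OF f] by (simp add: quotient_algebra_def)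
    then show "H (r \<odot>\<^bsub>B\<^esub> f) = r \<odot>\<^bsub>A\<^esub> H f"
      using H(2)[OF B.smult_closed[OF r f]] smult[OF r f]
      by (intro inj H(1) B.smult_closed A.smult_closed r f) simp
  next
    fix f g assume fg: "f \<in> carrier B" "g \<in> carrier B"
    have "h (H f \<otimes>\<^bsub>A\<^esub> H g) = I +>\<^bsub>B\<^esub> (f \<otimes>\<^bsub>B\<^esub> g)"
      using hD(2)[OF H(1)[OF fg(1)] H(1)[OF fg(2)]] H(2) fg I.rcoset_mult_add[OF fg]
      by (simp add: quotient_algebra_def FactRing_def)
    then show "H (f \<otimes>\<^bsub>B\<^esub> g) = H f \<otimes>\<^bsub>A\<^esub> H g"
      using H(2)[OF B.m_closed[OF fg]]
      by (intro inj H(1) B.m_closed A.m_closed fg) simp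
    have "h (H f \<oplus>\<^bsub>A\<^esub> H g) = I +>\<^bsub>B\<^esub> (f \<oplus>\<^bsub>B\<^esub> g)"
      using hD(3)[OF H(1)[OF fg(1)] H(1)[OF fg(2)]] H(2) fg I.a_rcos_sum[OF fg]
      by (simp add: quotient_algebra_def FactRing_def)
    then show "H (f \<oplus>\<^bsub>B\<^esub> g) = H f \<oplus>\<^bsub>A\<^esub> H g"
      using H(2)[OF B.M.a_closed[OF fg]]
      by (intro inj H(1) B.M.a_closed A.M.a_closed fg) simp
  next
    have "h \<one>\<^bsub>A\<^esub> = I +>\<^bsub>B\<^esub> \<one>\<^bsub>B\<^esub>"
      using hD(4) by (simp add: quotient_algebra_def FactRing_def)
    then show "H \<one>\<^bsub>B\<^esub> = \<one>\<^bsub>A\<^esub>"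
      using H(2)[OF B.one_closed] by (intro inj H(1) B.one_closed A.one_closed) simp
  qed
  moreover have "carrier A \<subseteq> H ` carrier B"
  proof
    fix a assume a: "a \<in> carrier A"
    then obtain f where f: "f \<in> carrier B" "h a = I +>\<^bsub>B\<^esub> f" using hD(1) Q by blast
    then have "a = H f" using inj[OF a H(1)] H(2) by simp
    then show "a \<in> H ` carrier B" using f by blast
  qed
  ultimately show thesis using that by blast
qed

lemma WPC_surjective_image:
  assumes W: "WPC D B" and H: "H \<in> algebra_hom (ring_on D) B A" "carrier A \<subseteq> H ` carrier B"
  shows "WPC D A"
  unfolding WPC_def
proof
  fix a assume "a \<in> carrier A"
  then obtain f where f: "f \<in> carrier B" "a = H f" using H(2) by blast
  obtain h where h: "h \<in> algebra_hom (ring_on D) (Int_algebra D) B" "h [:0, 1:] = f"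
    using W f(1) by (auto simp: WPC_def)
  have "H \<circ> h \<in> algebra_hom (ring_on D) (Int_algebra D) A"
    by (rule algebra_homI) (simp_all add: algebra_homD[OF h(1)] algebra_homD[OF H(1)])
  then show "\<exists>h\<in>algebra_hom (ring_on D) (Int_algebra D) A. h [:0, 1:] = a"
    using h f by (intro bexI[of _ "H \<circ> h"]) simp_all
qed

section \<open>Integer-valued polynomials in several variables over a domain of class C\<close>

lemma Int_algebra_mv_simps [simp]:
  "monoid.mult (Int_algebra_mv D X) = (*)" "monoid.one (Int_algebra_mv D X) = 1"
  "ring.zero (Int_algebra_mv D X) = 0" "ring.add (Int_algebra_mv D X) = (+)"
  "module.smult (Int_algebra_mv D X) = mpoly_smult"
  by (simp_all add: Int_algebra_mv_def)

lemma Int_algebra_mv_carrier: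
  "carrier (Int_algebra_mv D X) =
     {f. mpoly_vars f \<subseteq> X \<and> (\<forall>v. (\<forall>x\<in>X. v x \<in> D) \<longrightarrow> mpoly_eval (\<lambda>c. c) v f \<in> D)}"
  by (simp add: Int_algebra_mv_def)

context domain_in_field begin

lemma Int_mv_closed:
  fixes X :: "'x set"
  assumes "f \<in> carrier (Int_algebra_mv D X)"
  shows "c \<in> D \<Longrightarrow> mpoly_smult c f \<in> carrier (Int_algebra_mv D X)"
    "g \<in> carrier (Int_algebra_mv D X) \<Longrightarrow> f + g \<in> carrier (Int_algebra_mv D X)"
    "g \<in> carrier (Int_algebra_mv D X) \<Longrightarrow> f * g \<in> carrier (Int_algebra_mv D X)"
proof -
  interpret i: field_hom_into "\<lambda>c::'k. c" by (rule id_hom)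
  show "c \<in> D \<Longrightarrow> mpoly_smult c f \<in> carrier (Int_algebra_mv D X)"
    using assms mpoly_vars_smult[of c f] by (auto simp: Int_algebra_mv_carrier i.mpoly_eval_smult)
  show "g \<in> carrier (Int_algebra_mv D X) \<Longrightarrow> f + g \<in> carrier (Int_algebra_mv D X)"
    using assms mpoly_vars_add[of f g] by (auto simp: Int_algebra_mv_carrier i.mpoly_eval_add)
  show "g \<in> carrier (Int_algebra_mv D X) \<Longrightarrow> f * g \<in> carrier (Int_algebra_mv D X)"
    using assms mpoly_vars_mult[of f g] by (auto simp: Int_algebra_mv_carrier i.mpoly_eval_mult)
qed

lemma algebra_Int_mv: "algebra (ring_on D) (Int_algebra_mv D (X :: 'x set))"
proof -
  let ?C = "carrier (Int_algebra_mv D X)"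
  have eq: "Int_algebra_mv D X = algebra_on mpoly_smult ?C" by (simp add: Int_algebra_mv_def)
  have one: "1 \<in> ?C" by (simp add: Int_algebra_mv_carrier field_hom_into.mpoly_eval_1[OF id_hom])
  have "algebra (ring_on D) (algebra_on mpoly_smult ?C)"
  proof (rule algebra_algebra_on[where \<iota> = mpoly_const, OF D.is_cring])
    show "1 \<in> ?C" by (rule one)
    show "0 \<in> ?C" using Int_mv_closed(1)[OF one zero_mem] by (simp add: mpoly_smult_def)
    fix f assume f: "f \<in> ?C"
    show "- f \<in> ?C" using Int_mv_closed(1)[OF f uminus_mem[OF one_mem]] by (simp only: uminus_mpoly[symmetric])
    show "mpoly_smult c f \<in> ?C" if "c \<in> D" for c using f that by (rule Int_mv_closed(1))
    fix g assume g: "g \<in> ?C"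
    show "f + g \<in> ?C" "f * g \<in> ?C" using Int_mv_closed(2,3)[OF f g] by auto
  qed (auto simp: mpoly_const_add mpoly_const_mult mpoly_smult_def)
  then show ?thesis by (simp only: eq[symmetric])
qed

lemma peval_Int_mv:
  assumes "f \<in> Int_poly D" "g \<in> carrier (Int_algebra_mv D X)"
  shows "peval mpoly_const f g \<in> carrier (Int_algebra_mv D X)"
proof -
  interpret i: field_hom_into "\<lambda>c::'k. c" by (rule id_hom)
  show ?thesis
    using assms mpoly_vars_peval[of f g]
    by (auto simp: Int_algebra_mv_carrier i.mpoly_eval_peval peval_id Int_poly_def)
qed

text \<open>Substituting g into f from Int(D) keeps values integral, since g takes values in
  \<open>D\<close> and f maps \<open>D\<close> to itself.\<close>

lemma WPC_Int_mv: "WPC D (Int_algebra_mv D X)"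
  unfolding WPC_def
proof
  interpret c: field_hom_into "mpoly_const :: 'k \<Rightarrow> ('x, 'k) mpoly" by (rule const_mpoly_hom)
  fix g assume g: "g \<in> carrier (Int_algebra_mv D X)"
  have "(\<lambda>f. peval mpoly_const f g) \<in> algebra_hom (ring_on D) (Int_algebra D) (Int_algebra_mv D X)"
    by (rule algebra_homI) (use g peval_Int_mv in \<open>auto simp: c.peval_add c.peval_mult c.peval_smult mpoly_smult_def\<close>)
  moreover have "peval mpoly_const [:0, 1:] g = g" by simp
  ultimately show "\<exists>h\<in>algebra_hom (ring_on D) (Int_algebra D) (Int_algebra_mv D X). h [:0, 1:] = g"
    by (intro bexI[of _ "\<lambda>f. peval mpoly_const f g"])
qed

lemma common_denominator:
  assumes "finite C"
  shows "\<exists>d\<in>D. d \<noteq> 0 \<and> (\<forall>c\<in>C. d * c \<in> D)"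
  using assms
proof (induction C rule: finite_induct)
  case empty
  then show ?case by (intro bexI[of _ 1]) auto
next
  case (insert c C)
  then obtain d where d: "d \<in> D" "d \<noteq> 0" "\<forall>c\<in>C. d * c \<in> D" by blast
  obtain a b where ab: "a \<in> D" "b \<in> D" "b \<noteq> 0" "c = a / b" by (rule fraction)
  have "(d * b) * c = d * a" using ab by simp
  moreover have "(d * b) * c' = b * (d * c')" for c' by simp
  ultimately have "\<forall>c'\<in>insert c C. (d * b) * c' \<in> D" using d ab by (metis insert_iff mult_mem)
  then show ?case using d ab by (intro bexI[of _ "d * b"]) auto
qed

end

lemma mpoly_eval_identity: "mpoly_eval mpoly_const mpoly_var f = f"
proof -
  have "mpoly_eval mpoly_const mpoly_var f =
      (\<Sum>m\<in>Poly_Mapping.keys f. mpoly_const (Poly_Mapping.lookup f m) * monom_eval mpoly_var m)"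
    by (simp add: mpoly_eval_def monom_eval_def)
  also have "\<dots> = (\<Sum>m\<in>Poly_Mapping.keys f. Poly_Mapping.single m (Poly_Mapping.lookup f m))"
    by (simp add: monom_eval_var mpoly_const_def mult_single)
  finally show ?thesis by (simp only: poly_mapping_sum_single)
qed

text \<open>Evaluation at the generic point, where every variable is its own value, turns the
  statement about values into an identity of polynomials.\<close>

lemma basis_mon_split_var:
  assumes "e 0 = 1"
  shows "basis_mon e m = peval mpoly_const (e (Poly_Mapping.lookup m x)) (mpoly_var x) * basis_mon e (delete_var x m)"
  using field_hom_into.basis_mon_split[where e = e and \<phi> = mpoly_const and v = mpoly_var and m = m and x = x,
      OF const_mpoly_hom assms]
  by (simp add: mpoly_eval_identity mult.commute)

lemma basis_mon_0 [simp]: "basis_mon e 0 = 1"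
  by (simp add: basis_mon_def)

lemma delete_var_plus_single:
  assumes "x \<notin> Poly_Mapping.keys m"
  shows "delete_var x (m + Poly_Mapping.single x i) = m" "Poly_Mapping.lookup (m + Poly_Mapping.single x i) x = i"
proof -
  have "Poly_Mapping.lookup m x = 0" using assms by (simp add: in_keys_iff)
  then show "Poly_Mapping.lookup (m + Poly_Mapping.single x i) x = i"
    "delete_var x (m + Poly_Mapping.single x i) = m"
    by (auto simp: lookup_add lookup_delete_var lookup_single when_def intro!: poly_mapping_eqI)
qed

context principal_Pi_domain begin

text \<open>The instance S = T = D of the reduction to one variable, where
  \<open>regular_basis_coeff_mem\<close> applies.\<close>

lemma Int_mv_coeff_mem:
  assumes reg: "is_regular_basis e"
    and F: "finite F" "\<And>m. m \<in> F \<Longrightarrow> Poly_Mapping.keys m \<subseteq> X"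
      "(\<Sum>m\<in>F. mpoly_smult (c m) (basis_mon e m)) \<in> carrier (Int_algebra_mv D X)" "m \<in> F"
  shows "c m \<in> D"
proof -
  interpret i: field_hom_into "\<lambda>c::'k. c" by (rule id_hom)
  show ?thesis
  proof (rule i.basis_coeff_mem[where e = e and c = c and S = D and V = "\<Union>m\<in>F. Poly_Mapping.keys m"])
    show "e 0 = 1" using reg by (simp add: is_regular_basis_def)
    show "finite (\<Union>m\<in>F. Poly_Mapping.keys m)" using F(1) by simp
    fix v :: "_ \<Rightarrow> 'k" assume v: "\<And>x. x \<in> (\<Union>m\<in>F. Poly_Mapping.keys m) \<Longrightarrow> v x \<in> D"
    \<comment> \<open>Integer-valuedness is available for points in \<open>D\<close> on all of X,
      while v is controlled only on the variables that occur; the others are set to 0.\<close>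
    define w where "w x = (if x \<in> (\<Union>m\<in>F. Poly_Mapping.keys m) then v x else 0)" for x
    have vw: "v x = w x" if "m \<in> F" "x \<in> Poly_Mapping.keys m" for m x
    proof -
      have "x \<in> (\<Union>m\<in>F. Poly_Mapping.keys m)" using that by blast
      then show ?thesis unfolding w_def by (simp only: if_True)
    qed
    have "mpoly_eval (\<lambda>c. c) v (basis_mon e m) = mpoly_eval (\<lambda>c. c) w (basis_mon e m)" if "m \<in> F" for m
      unfolding i.mpoly_eval_basis_mon by (rule prod.cong[OF refl]) (simp only: vw[OF that])
    then have "(\<Sum>m\<in>F. c m * mpoly_eval (\<lambda>c. c) v (basis_mon e m)) = (\<Sum>m\<in>F. c m * mpoly_eval (\<lambda>c. c) w (basis_mon e m))"
      by (intro sum.cong refl) simp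
    also have "\<dots> = mpoly_eval (\<lambda>c. c) w (\<Sum>m\<in>F. mpoly_smult (c m) (basis_mon e m))"
      by (simp add: i.mpoly_eval_sum i.mpoly_eval_smult)
    also have "\<dots> \<in> D"
    proof -
      have "w x \<in> D" for x
      proof (cases "x \<in> (\<Union>m\<in>F. Poly_Mapping.keys m)")
        case True
        then show ?thesis unfolding w_def if_P[OF True] by (rule v)
      next
        case False
        show ?thesis unfolding w_def if_not_P[OF False] by (rule zero_mem)
      qed
      then show ?thesis using F(3) unfolding Int_algebra_mv_carrier by blast
    qed
    finally show "(\<Sum>m\<in>F. c m * mpoly_eval (\<lambda>c. c) v (basis_mon e m)) \<in> D" .
  next
    fix N and b :: "nat \<Rightarrow> 'k" and n
    assume N: "finite N" "\<And>d. d \<in> D \<Longrightarrow> (\<Sum>n\<in>N. b n * peval (\<lambda>c. c) (e n) d) \<in> D" "n \<in> N"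
    have "(\<Sum>n\<in>N. Polynomial.smult (b n) (e n)) \<in> Int_poly D"
      using N(2) by (simp add: Int_poly_def poly_sum peval_id)
    then show "b n \<in> D" by (rule regular_basis_coeff_mem[OF reg N(1) _ N(3)])
  qed (use F in auto)
qed

text \<open>WPC gives a homomorphism from Int(D) for each variable separately. Independence of the
  basis products makes the subalgebra generated by their graphs again a graph.\<close>

lemma Int_mv_evaluation_hom:
  fixes A :: "('k, 'a, 'm) module_scheme" and X :: "'x set"
  assumes A: "algebra (ring_on D) A" and W: "WPC D A" and a: "\<And>x. x \<in> X \<Longrightarrow> a x \<in> carrier A"
  obtains H where "H \<in> algebra_hom (ring_on D) (Int_algebra_mv D X) A" "\<And>x. x \<in> X \<Longrightarrow> H (mpoly_var x) = a x"
proof -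
  interpret A: algebra "ring_on D" A by fact
  interpret c: field_hom_into "mpoly_const :: 'k \<Rightarrow> ('x, 'k) mpoly" by (rule const_mpoly_hom)
  let ?P = "algebra_on mpoly_smult (UNIV :: ('x, 'k) mpoly set)"
  let ?B = "prod_algebra ?P A"
  interpret P: algebra "ring_on D" ?P by (rule algebra_mpoly)
  interpret B: algebra "ring_on D" ?B by (rule algebra_prod_algebra[OF algebra_mpoly A])
  obtain e where reg: "is_regular_basis e" using regular_basis_exists ..
  have e0: "e 0 = 1" using reg by (simp add: is_regular_basis_def)
  note eI = regular_basis_Int[OF reg]
  have "\<forall>x. \<exists>h. x \<in> X \<longrightarrow> h \<in> algebra_hom (ring_on D) (Int_algebra D) A \<and> h [:0, 1:] = a x"
    using W a unfolding WPC_def by blast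
  then have "\<exists>h. \<forall>x. x \<in> X \<longrightarrow> h x \<in> algebra_hom (ring_on D) (Int_algebra D) A \<and> h x [:0, 1:] = a x"
    by (rule choice)
  then obtain h where h: "\<And>x. x \<in> X \<Longrightarrow> h x \<in> algebra_hom (ring_on D) (Int_algebra D) A"
    "\<And>x. x \<in> X \<Longrightarrow> h x [:0, 1:] = a x" by blast
  note hD = algebra_homD[OF h(1), unfolded Int_algebra_simps carrier_ring_on]
  define \<theta> where "\<theta> x f = (peval mpoly_const f (mpoly_var x), h x f)" for x f
  define \<mu> where "\<mu> m = (\<Otimes>\<^bsub>A\<^esub>x\<in>Poly_Mapping.keys m. h x (e (Poly_Mapping.lookup m x)))" for m
  let ?M = "{m. Poly_Mapping.keys m \<subseteq> X}"
  let ?b = "\<lambda>m. (basis_mon e m, \<mu> m)"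
  let ?S = "?b ` ?M"
  \<comment> \<open>All of Int(D) is used in each variable: the pairs of variables alone would
    generate only the graph over D[X].\<close>
  let ?G = "{\<theta> x f |x f. x \<in> X \<and> f \<in> Int_poly D}"
  have \<theta>B: "\<theta> x f \<in> carrier ?B" if "x \<in> X" "f \<in> Int_poly D" for x f
    using hD(1)[OF that] by (simp add: \<theta>_def)
  have he: "h x (e n) \<in> carrier A" if "x \<in> X" for x n using hD(1)[OF that eI] .
  have \<mu>c: "\<mu> m \<in> carrier A" if "m \<in> ?M" for m
    unfolding \<mu>_def by (rule A.finprod_closed) (use that he in auto)
  have SB: "?S \<subseteq> carrier ?B" using \<mu>c by auto
  have GB: "?G \<subseteq> carrier ?B" using \<theta>B by blast
  have \<mu>_split: "\<mu> m = h x (e (Poly_Mapping.lookup m x)) \<otimes>\<^bsub>A\<^esub> \<mu> (delete_var x m)" if x: "x \<in> X" and m: "m \<in> ?M" for x m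
  proof -
    let ?R = "Poly_Mapping.keys m - {x}"
    have mX: "y \<in> X" if "y \<in> Poly_Mapping.keys m" for y using m that by blast
    have "\<mu> m = (\<Otimes>\<^bsub>A\<^esub>y\<in>insert x ?R. h y (e (Poly_Mapping.lookup m y)))"
      unfolding \<mu>_def
    proof (rule A.finprod_mono_neutral_cong_left)
      fix y assume "y \<in> insert x ?R - Poly_Mapping.keys m"
      then have "y = x" "Poly_Mapping.lookup m x = 0" by (auto simp: in_keys_iff)
      then show "h y (e (Poly_Mapping.lookup m y)) = \<one>\<^bsub>A\<^esub>" using hD(4)[OF x] e0 by simp
    qed (use mX he x in auto)
    also have "\<dots> = h x (e (Poly_Mapping.lookup m x)) \<otimes>\<^bsub>A\<^esub> (\<Otimes>\<^bsub>A\<^esub>y\<in>?R. h y (e (Poly_Mapping.lookup m y)))"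
      by (rule A.finprod_insert) (use mX he x in auto)
    also have "(\<Otimes>\<^bsub>A\<^esub>y\<in>?R. h y (e (Poly_Mapping.lookup m y))) = \<mu> (delete_var x m)"
      unfolding \<mu>_def keys_delete_var
      by (rule A.finprod_cong') (use mX he in \<open>auto simp: lookup_delete_var\<close>)
    finally show ?thesis .
  qed
  have split: "?b m = \<theta> x (e (Poly_Mapping.lookup m x)) \<otimes>\<^bsub>?B\<^esub> ?b (delete_var x m)" if "x \<in> X" "m \<in> ?M" for x m
    using \<mu>_split[OF that] basis_mon_split_var[where e = e, OF e0, of m x] by (simp add: \<theta>_def)
  have plus: "\<theta> x (e i) \<otimes>\<^bsub>?B\<^esub> ?b m \<in> B.lin_span ?S" if x: "x \<in> X" "x \<notin> Poly_Mapping.keys m" and m: "m \<in> ?M" for x i m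
  proof -
    let ?m = "m + Poly_Mapping.single x i"
    have M: "?m \<in> ?M"
    proof -
      have "Poly_Mapping.keys ?m \<subseteq> Poly_Mapping.keys m \<union> {x}"
        using Poly_Mapping.keys_add[of m "Poly_Mapping.single x i"] by (auto split: if_splits)
      then show ?thesis using x(1) m by blast
    qed
    have "\<theta> x (e i) \<otimes>\<^bsub>?B\<^esub> ?b m = ?b ?m"
      using split[OF x(1) M] unfolding delete_var_plus_single[OF x(2)] by (rule sym)
    then show ?thesis using B.lin_span_base[OF SB imageI[OF M]] by (simp only:)
  qed
  have \<theta>_add: "\<theta> x (f + g) = \<theta> x f \<oplus>\<^bsub>?B\<^esub> \<theta> x g" if "x \<in> X" "f \<in> Int_poly D" "g \<in> Int_poly D" for x f g
    using hD(3)[OF that] by (simp add: \<theta>_def c.peval_add)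
  have \<theta>_smult: "\<theta> x (Polynomial.smult d f) = d \<odot>\<^bsub>?B\<^esub> \<theta> x f" if "x \<in> X" "f \<in> Int_poly D" "d \<in> D" for x f d
    using hD(5)[OF that(1,3,2)] by (simp add: \<theta>_def c.peval_smult mpoly_smult_def)
  have \<theta>_mult: "\<theta> x (f * g) = \<theta> x f \<otimes>\<^bsub>?B\<^esub> \<theta> x g" if "x \<in> X" "f \<in> Int_poly D" "g \<in> Int_poly D" for x f g
    using hD(2)[OF that] by (simp add: \<theta>_def c.peval_mult)
  have \<theta>_span: "\<theta> x f \<otimes>\<^bsub>?B\<^esub> ?b m \<in> B.lin_span ?S" if x: "x \<in> X" "x \<notin> Poly_Mapping.keys m" and m: "m \<in> ?M" and f: "f \<in> Int_poly D" for x f m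
  proof -
    obtain d where d: "\<forall>i. d i \<in> D" "f = (\<Sum>i\<le>degree f. Polynomial.smult (d i) (e i))"
      using regular_basis_expansion[OF reg f order.refl] by (elim exE conjE)
    have bB: "?b m \<in> carrier ?B" using SB m by blast
    have smI: "Polynomial.smult (d i) (e i) \<in> Int_poly D" for i using d(1) eI[of i] by (simp add: Int_poly_def)
    have sm: "\<theta> x (Polynomial.smult (d i) (e i)) \<otimes>\<^bsub>?B\<^esub> ?b m \<in> B.lin_span ?S" for i
    proof -
      have di: "d i \<in> carrier (ring_on D)" using d(1) by simp
      have "\<theta> x (Polynomial.smult (d i) (e i)) \<otimes>\<^bsub>?B\<^esub> ?b m = d i \<odot>\<^bsub>?B\<^esub> (\<theta> x (e i) \<otimes>\<^bsub>?B\<^esub> ?b m)"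
        unfolding \<theta>_smult[OF x(1) eI d(1)[rule_format]] by (rule B.smult_assoc2[OF di \<theta>B[OF x(1) eI] bB])
      then show ?thesis using B.lin_span_smult[OF SB plus[OF x m, of i] di] by (simp only:)
    qed
    have "(\<Sum>i\<le>n. Polynomial.smult (d i) (e i)) \<in> Int_poly D \<and>
        \<theta> x (\<Sum>i\<le>n. Polynomial.smult (d i) (e i)) \<otimes>\<^bsub>?B\<^esub> ?b m \<in> B.lin_span ?S" for n
    proof (induction n)
      case 0
      then show ?case using sm[of 0] smI[of 0] by (simp only: atMost_0 sum.insert finite.emptyI empty_iff not_False_eq_True sum.empty add_0_right)
    next
      case (Suc n)
      let ?s = "\<Sum>i\<le>n. Polynomial.smult (d i) (e i)" and ?t = "Polynomial.smult (d (Suc n)) (e (Suc n))"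
      have s: "?s \<in> Int_poly D" using Suc by blast
      have "\<theta> x (?s + ?t) \<otimes>\<^bsub>?B\<^esub> ?b m = \<theta> x ?s \<otimes>\<^bsub>?B\<^esub> ?b m \<oplus>\<^bsub>?B\<^esub> \<theta> x ?t \<otimes>\<^bsub>?B\<^esub> ?b m"
        unfolding \<theta>_add[OF x(1) s smI] by (rule B.l_distr[OF \<theta>B[OF x(1) s] \<theta>B[OF x(1) smI] bB])
      then have "\<theta> x (?s + ?t) \<otimes>\<^bsub>?B\<^esub> ?b m \<in> B.lin_span ?S"
        using B.lin_span_add[OF SB conjunct2[OF Suc] sm[of "Suc n"]] by (simp only:)
      moreover have "?s + ?t \<in> Int_poly D" using s smI[of "Suc n"] by (simp add: Int_poly_def)
      ultimately show ?case by (simp only: sum.atMost_Suc conj_absorb simp_thms)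
    qed
    from this[of "degree f"] show ?thesis by (simp only: d(2)[symmetric])
  qed
  have sub: "B.alg_gen ?G \<subseteq> B.lin_span ?S"
  proof (rule B.alg_gen_subset_lin_span[OF SB GB])
    have "?b 0 \<in> B.lin_span ?S" by (rule B.lin_span_base[OF SB imageI]) simp
    then show "\<one>\<^bsub>?B\<^esub> \<in> B.lin_span ?S" by (simp add: \<mu>_def)
    fix g s assume "g \<in> ?G" "s \<in> ?S"
    then obtain x f m where x: "x \<in> X" "f \<in> Int_poly D" "g = \<theta> x f" and m: "m \<in> ?M" "s = ?b m" by blast
    let ?e = "e (Poly_Mapping.lookup m x)" and ?m = "delete_var x m"
    have m': "?m \<in> ?M" "x \<notin> Poly_Mapping.keys ?m" using m(1) by (auto simp: keys_delete_var)
    have bB: "?b ?m \<in> carrier ?B" using SB m'(1) by blast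
    \<comment> \<open>The factor of s in the variable x is merged with f. The product is in Int(D)
      and can be expanded again in the basis, while the rest of s does not involve x.\<close>
    have "g \<otimes>\<^bsub>?B\<^esub> s = \<theta> x f \<otimes>\<^bsub>?B\<^esub> (\<theta> x ?e \<otimes>\<^bsub>?B\<^esub> ?b ?m)"
      unfolding x(3) m(2) split[OF x(1) m(1)] ..
    also have "\<dots> = \<theta> x (f * ?e) \<otimes>\<^bsub>?B\<^esub> ?b ?m"
      unfolding \<theta>_mult[OF x(1,2) eI] by (rule B.m_assoc[symmetric, OF \<theta>B[OF x(1,2)] \<theta>B[OF x(1) eI] bB])
    also have "\<dots> \<in> B.lin_span ?S"
      by (rule \<theta>_span[OF x(1) m'(2,1)]) (use x(2) eI[of "Poly_Mapping.lookup m x"] in \<open>simp add: Int_poly_def\<close>)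
    finally show "g \<otimes>\<^bsub>?B\<^esub> s \<in> B.lin_span ?S" .
  qed
  have XI: "[:0, 1:] \<in> Int_poly D" by (simp add: Int_poly_def)
  have varG: "(mpoly_var x, a x) \<in> ?G" if "x \<in> X" for x
  proof -
    have "\<theta> x [:0, 1:] = (mpoly_var x, a x)" using h(2)[OF that] by (simp add: \<theta>_def)
    then show ?thesis using that XI by (intro CollectI exI[of _ x] exI[of _ "[:0, 1:]"]) simp
  qed
  have fstG: "P.alg_gen (fst ` ?G) \<subseteq> fst ` B.alg_gen ?G" by (rule fst_alg_gen[OF algebra_mpoly A])
  have img: "carrier (Int_algebra_mv D X) \<subseteq> fst ` B.alg_gen ?G"
  proof
    fix f assume f: "f \<in> carrier (Int_algebra_mv D X)"
    \<comment> \<open>The multiple d f lies in D[X], hence in the span, so f is a combination of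
      basis products over the quotient field; \<open>Int_mv_coeff_mem\<close> then puts the
      coefficients c m / d into \<open>D\<close>.\<close>
    obtain d where d: "d \<in> D" "d \<noteq> 0" "\<forall>c\<in>Poly_Mapping.lookup f ` Poly_Mapping.keys f. d * c \<in> D"
      using common_denominator[of "Poly_Mapping.lookup f ` Poly_Mapping.keys f"] by auto
    have "Poly_Mapping.lookup (mpoly_smult d f) m = d * Poly_Mapping.lookup f m" for m
      unfolding mpoly_smult_def mpoly_const_def mult_map_scale_conv_mult[symmetric]
      by (simp add: Poly_Mapping.map.rep_eq when_def)
    moreover have "d * Poly_Mapping.lookup f m \<in> D" for m
      using d(3) by (cases "m \<in> Poly_Mapping.keys f") (auto simp: in_keys_iff)
    ultimately have "mpoly_smult d f \<in> carrier (mpoly_algebra D X)"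
      using f mpoly_vars_smult[of d f] by (auto simp: mpoly_algebra_carrier Int_algebra_mv_carrier)
    then have "mpoly_smult d f \<in> P.alg_gen (mpoly_var ` X)" using mpoly_algebra_generated[of X] by blast
    moreover have "mpoly_var ` X \<subseteq> fst ` ?G"
    proof (rule image_subsetI)
      fix x assume "x \<in> X"
      from imageI[OF varG[OF this], of fst] show "mpoly_var x \<in> fst ` ?G" by (simp only: fst_conv)
    qed
    ultimately have "mpoly_smult d f \<in> P.alg_gen (fst ` ?G)" by (rule P.alg_gen_mono)
    then have "mpoly_smult d f \<in> fst ` B.alg_gen ?G" using fstG by blast
    then obtain y where "mpoly_smult d f = fst y" "y \<in> B.alg_gen ?G" by (rule imageE)
    then obtain \<alpha> where "(mpoly_smult d f, \<alpha>) \<in> B.alg_gen ?G" by (cases y) (simp only: fst_conv)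
    then have mem: "(mpoly_smult d f, \<alpha>) \<in> B.lin_span ?S" using sub by blast
    have "\<exists>F c. finite F \<and> F \<subseteq> ?M \<and> (\<forall>m\<in>F. c m \<in> D) \<and>
        fst (mpoly_smult d f, \<alpha>) = (\<Sum>m\<in>F. mpoly_smult (c m) (basis_mon e m)) \<and>
        snd (mpoly_smult d f, \<alpha>) = (\<Oplus>\<^bsub>A\<^esub>m\<in>F. c m \<odot>\<^bsub>A\<^esub> \<mu> m)"
      by (rule lin_span_expansion[OF algebra_mpoly A \<mu>c mem])
    then obtain F c where F: "finite F" "F \<subseteq> ?M" "mpoly_smult d f = (\<Sum>m\<in>F. mpoly_smult (c m) (basis_mon e m))"
      unfolding fst_conv by blast
    have "f = mpoly_smult (1 / d) (mpoly_smult d f)"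
      using d(2) by (simp add: mpoly_smult_def mult.assoc[symmetric] mpoly_const_mult[symmetric])
    also have "\<dots> = (\<Sum>m\<in>F. mpoly_smult (c m / d) (basis_mon e m))"
      unfolding F(3) by (simp add: mpoly_smult_def sum_distrib_left mult.assoc[symmetric] mpoly_const_mult[symmetric])
    finally have fs: "f = (\<Sum>m\<in>F. mpoly_smult (c m / d) (basis_mon e m))" .
    have cD: "c m / d \<in> D" if "m \<in> F" for m
      using Int_mv_coeff_mem[OF reg F(1), of X "\<lambda>m. c m / d" m] F(2) f fs that by auto
    have bm: "basis_mon e m \<in> P.alg_gen (fst ` ?G)" if "m \<in> F" for m
      unfolding basis_mon_def
    proof (rule algebra_on_prod_mem[OF algebra_mpoly finite_keys])
      fix x assume "x \<in> Poly_Mapping.keys m"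
      then have "x \<in> X" using F(2) that by blast
      then have "\<theta> x (e (Poly_Mapping.lookup m x)) \<in> ?G" using eI by blast
      then have "fst (\<theta> x (e (Poly_Mapping.lookup m x))) \<in> fst ` ?G" by (rule imageI)
      then show "peval mpoly_const (e (Poly_Mapping.lookup m x)) (mpoly_var x) \<in> P.alg_gen (fst ` ?G)"
        by (intro P.alg_gen.gen) (simp add: \<theta>_def)
    qed
    have summand: "mpoly_smult (c m / d) (basis_mon e m) \<in> P.alg_gen (fst ` ?G)" if "m \<in> F" for m
      using P.alg_gen.smult[OF _ bm[OF that], of "c m / d"] cD[OF that] by simp
    have "f \<in> P.alg_gen (fst ` ?G)"
    proof (cases "F = {}")
      case True
      then show ?thesis using fs P.alg_gen.smult[OF _ P.alg_gen.one, of 0] by (simp add: mpoly_smult_def)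
    next
      case False
      have "(\<Sum>m\<in>F. mpoly_smult (c m / d) (basis_mon e m)) \<in> P.alg_gen (fst ` ?G)"
        by (rule algebra_on_sum_mem[OF algebra_mpoly False F(1) summand])
      then show ?thesis by (simp only: fs[symmetric])
    qed
    then show "f \<in> fst ` B.alg_gen ?G" using fstG by blast
  qed
  obtain H where H: "H \<in> algebra_hom (ring_on D) (Int_algebra_mv D X) A"
    "\<And>f \<alpha>. (f, \<alpha>) \<in> B.alg_gen ?G \<Longrightarrow> H f = \<alpha>"
  proof (rule algebra_hom_of_graph[OF algebra_mpoly A _ _ img])
    show "?G \<subseteq> carrier ?P \<times> carrier A" using GB by simp
    fix \<alpha> assume "(\<zero>\<^bsub>?P\<^esub>, \<alpha>) \<in> B.alg_gen ?G"
    then have mem: "(0, \<alpha>) \<in> B.lin_span ?S" using sub by auto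
    show "\<alpha> = \<zero>\<^bsub>A\<^esub>"
    proof (rule lin_span_functional[OF algebra_mpoly A \<mu>c _ mem])
      fix F c m assume "finite F" "F \<subseteq> ?M" "(\<Sum>m\<in>F. mpoly_smult (c m) (basis_mon e m)) = 0" "m \<in> F"
      then show "c m = 0"
        using basis_mon_independent[where e = e, OF e0 regular_basis(2,3)[OF reg]] by blast
    qed
  qed auto
  have "H (mpoly_var x) = a x" if "x \<in> X" for x
    by (rule H(2)[OF B.alg_gen.gen[OF varG[OF that]]])
  with H(1) that show thesis by blast
qed

end

section \<open>Deduction of the equivalences for both classes\<close>

context domain_in_field begin

lemma class_D_principal_Pi:
  assumes "class_D D"
  obtains \<pi> where "principal_Pi \<pi>"
proof -
  obtain \<pi> where "\<forall>q. primepow q \<longrightarrow> \<pi> q \<in> D \<and> \<pi> q \<noteq> 0 \<and> Pi_ideal D q = {\<pi> q * d |d. d \<in> D} \<and>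
      F_poly (\<pi> q) q \<in> Int_poly D"
    using assms unfolding class_D_def by (elim exE conjE)
  then have "principal_Pi \<pi>" by (simp add: principal_Pi_def)
  then show thesis by (rule that)
qed

lemma mpoly_var_Int_mv: "x \<in> X \<Longrightarrow> mpoly_var x \<in> carrier (Int_algebra_mv D X)"
  by (simp add: Int_algebra_mv_carrier field_hom_into.mpoly_eval_var[OF id_hom])

lemma class_C_principal_Pi_domain:
  assumes "class_C D" "principal_Pi \<pi>"
  shows "principal_Pi_domain D \<pi>"
proof
  show "principal_Pi \<pi>" by (rule assms)
  show "finite {p. t_maximal D p \<and> finite_norm D p \<and> ideal_norm D p \<le> n}" for n
    using assms(1) unfolding class_C_def by blast
qed

end

theorem theorem6p3:
  fixes D :: "'k::field set" and A :: "('k, 'a) module"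
  assumes "domain_with_quotient_field D"
    and "class_D D \<or> class_C D"
    and "algebra (ring_on D) A"
  shows "(WPC D A \<longleftrightarrow>
           (\<forall>a\<in>carrier A. \<forall>p. t_maximal D p \<and> finite_norm D p \<longrightarrow>
              (a [^]\<^bsub>A\<^esub> ideal_norm D p) \<ominus>\<^bsub>A\<^esub> a \<in> extended_ideal p A)) \<and>
         (WPC D A \<longleftrightarrow>
           (\<forall>a\<in>carrier A. \<forall>q::nat. primepow q \<longrightarrow>
              (a [^]\<^bsub>A\<^esub> q) \<ominus>\<^bsub>A\<^esub> a \<in> extended_ideal (Pi_ideal D q) A)) \<and>
         (class_C D \<and> (\<exists>e::'a \<Rightarrow> 'x. inj_on e (carrier A)) \<longrightarrow>
           (WPC D A \<longleftrightarrow>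
             (\<exists>(X::'x set) I. ideal I (Int_algebra_mv D X) \<and>
                algebra_isomorphic (ring_on D) A (quotient_algebra (Int_algebra_mv D X) I))))"
proof -
  interpret domain_in_field D by unfold_locales (rule assms(1))
  note A = assms(3)
  let ?cong2 = "\<forall>a\<in>carrier A. \<forall>p. t_maximal D p \<and> finite_norm D p \<longrightarrow>
    (a [^]\<^bsub>A\<^esub> ideal_norm D p) \<ominus>\<^bsub>A\<^esub> a \<in> extended_ideal p A"
  let ?cong3 = "\<forall>a\<in>carrier A. \<forall>q::nat. primepow q \<longrightarrow>
    (a [^]\<^bsub>A\<^esub> q) \<ominus>\<^bsub>A\<^esub> a \<in> extended_ideal (Pi_ideal D q) A"
  obtain \<pi> where pi: "principal_Pi \<pi>"
    using assms(2) class_D_principal_Pi class_C_principal_Pi by metis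
  have "?cong3" if "WPC D A"
    using WPC_imp_congruence_Pi[OF A pi _ that] by simp
  moreover have "WPC D A" if c3: "?cong3"
  proof -
    have c: "(a [^]\<^bsub>A\<^esub> q) \<ominus>\<^bsub>A\<^esub> a \<in> extended_ideal (Pi_ideal D q) A" if "a \<in> carrier A" "primepow q" for a q
      using c3 that by blast
    show ?thesis
    proof (cases "class_D D")
      case True
      then show ?thesis using c by (rule class_D_congruence_imp_WPC[OF A])
    next
      case False
      then have "class_C D" using assms(2) by blast
      then interpret principal_Pi_domain D \<pi> using pi by (rule class_C_principal_Pi_domain)
      show ?thesis using c by (rule congruence_imp_WPC[OF A])
    qed
  qed
  moreover have "?cong3" if c2: "?cong2"
  proof (intro ballI allI impI)
    fix a and q :: nat
    assume a: "a \<in> carrier A" and q: "primepow q"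
    show "(a [^]\<^bsub>A\<^esub> q) \<ominus>\<^bsub>A\<^esub> a \<in> extended_ideal (Pi_ideal D q) A"
      by (rule congruence_Pi_of_congruence_t_maximal[OF A pi q _ a]) (use c2 a in blast)
  qed
  moreover have "?cong2" if c3: "?cong3"
  proof (intro ballI allI impI)
    fix a p assume a: "a \<in> carrier A" and p: "t_maximal D p \<and> finite_norm D p"
    show "(a [^]\<^bsub>A\<^esub> ideal_norm D p) \<ominus>\<^bsub>A\<^esub> a \<in> extended_ideal p A"
      by (rule congruence_t_maximal_of_congruence_Pi[OF A conjunct1[OF p] conjunct2[OF p]]) (use c3 a in blast)
  qed
  ultimately have "WPC D A \<longleftrightarrow> ?cong2" "WPC D A \<longleftrightarrow> ?cong3" by argo+
  moreover have "WPC D A \<longleftrightarrow> (\<exists>(X::'x set) I. ideal I (Int_algebra_mv D X) \<and>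
      algebra_isomorphic (ring_on D) A (quotient_algebra (Int_algebra_mv D X) I))"
    if C: "class_C D" and e: "\<exists>e::'a \<Rightarrow> 'x. inj_on e (carrier A)"
  proof
    interpret principal_Pi_domain D \<pi> using C pi by (rule class_C_principal_Pi_domain)
    obtain e :: "'a \<Rightarrow> 'x" where e: "inj_on e (carrier A)" using e by blast
    assume W: "WPC D A"
    \<comment> \<open>One variable for each element of A, realized in \<open>'x\<close> by the
      injection; sending each variable to its element makes the evaluation surjective.\<close>
    let ?X = "e ` carrier A"
    have "inv_into (carrier A) e x \<in> carrier A" if "x \<in> ?X" for x using that by (rule inv_into_into)
    then obtain H where H: "H \<in> algebra_hom (ring_on D) (Int_algebra_mv D ?X) A"
      "\<And>x. x \<in> ?X \<Longrightarrow> H (mpoly_var x) = inv_into (carrier A) e x"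
      using Int_mv_evaluation_hom[OF A W, of ?X "inv_into (carrier A) e"] by blast
    have "carrier A \<subseteq> H ` carrier (Int_algebra_mv D ?X)"
    proof
      fix a assume a: "a \<in> carrier A"
      then have "H (mpoly_var (e a)) = a" using H(2)[of "e a"] e by simp
      then show "a \<in> H ` carrier (Int_algebra_mv D ?X)"
        using mpoly_var_Int_mv[of "e a" ?X] a by (metis imageI)
    qed
    then show "\<exists>(X::'x set) I. ideal I (Int_algebra_mv D X) \<and>
      algebra_isomorphic (ring_on D) A (quotient_algebra (Int_algebra_mv D X) I)"
      using algebra_isomorphic_quotient[OF algebra_Int_mv A H(1)] by blast
  next
    assume "\<exists>(X::'x set) I. ideal I (Int_algebra_mv D X) \<and>
      algebra_isomorphic (ring_on D) A (quotient_algebra (Int_algebra_mv D X) I)"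
    then obtain X :: "'x set" and I where I: "ideal I (Int_algebra_mv D X)"
      "algebra_isomorphic (ring_on D) A (quotient_algebra (Int_algebra_mv D X) I)" by blast
    obtain H where "H \<in> algebra_hom (ring_on D) (Int_algebra_mv D X) A"
      "carrier A \<subseteq> H ` carrier (Int_algebra_mv D X)"
      by (rule hom_of_algebra_isomorphic_quotient[OF algebra_Int_mv A I])
    then show "WPC D A" by (rule WPC_surjective_image[OF WPC_Int_mv])
  qed
  ultimately show ?thesis by blast
qed

end
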